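(* Let $f(x)\in\mathcal O[x]$ be a monic and separable polynomial. There exists $r\ge0$ such that all types in $\mathbf t_r(f)$ are $f$-complete, or equivalently, such that $\mathbf t_{r+1}(f)=\emptyset$.
   Context: Setting. $p$ is a prime, $\overline{\mathbb Q}_p$ an algebraic closure of $\mathbb Q_p$, $K\subset\overline{\mathbb Q}_p$ a finite extension of $\mathbb Q_p$ with ring of integers $\mathcal O$, maximal ideal $\mathfrak m$, fixed prime element $\pi$, residue field $\mathbb F$; $v\colon\overline{\mathbb Q}_p\to\mathbb Q\cup\{\infty\}$ is the valuation with $v(K^* )=\mathbb Z$. Put $v(\sum_j b_jx^j)=\min_j v(b_j)$ on $\mathcal O[x]$. A bar denotes reduction to the residue field. For polynomials over a field, $\varphi\sim\psi$ means $\varphi=c\psi$ with a nonzero constant $c$. Empty products are $1$. Principal polygons. A side of slope $\lambda=-h/e$ ($h,e$ positive coprime integers) is a segment of slope $\lambda$ whose end points have nonnegative integer coordinates (a single such point is allowed); its length $\ell(S)$ and height $H(S)$ are the lengths of its horizontal and vertical projections and its degree is $d(S)=\ell(S)/e$. A side of slope $-\infty$ has a positive integer length $\ell$, height $\infty$, degree $1$, a finite end point $(s,u)$, and is thought of as starting at $(s-\ell,\infty)$. A principal polygon $N$ consists of at most one side of slope $-\infty$ followed by a finite part that is a point or a chain of sides of positive length with strictly increasing finite negative slopes; "the sides of $N$" are these sides of positive length, and $\ell(N)$ is the sum of their lengths. For $\lambda\in\mathbb Q_{<0}$, $S_\lambda(N)$ is the set of points $(x,y)$ of the finite part of $N$ at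 which $y+|\lambda|x$ is minimal: a side of slope $\lambda$, possibly a single point. Types. A type of order $0$ is a monic irreducible polynomial $\mathbf t=\psi_0(y)\in\mathbb F[y]$. A type of order $n\ge1$ is a sequence $\mathbf t=(\phi_1(x);\lambda_1,\phi_2(x);\dots;\lambda_{n-1},\phi_n(x);\lambda_n,\psi_n(y))$ with $\phi_i\in\mathcal O[x]$ monic, $\lambda_i=-h_i/e_i$ negative rationals ($h_i,e_i$ positive coprime integers), such that: $\phi_1$ is irreducible modulo $\mathfrak m$, with reduction $\psi_0$; for $1\le i<n$, $N_i(\phi_{i+1})$ has a single side, of positive length and slope $\lambda_i$, $R_i(\phi_{i+1})\sim\psi_i$ with $\psi_i\in\mathbb F_i[y]$ monic irreducible, and $\deg\phi_{i+1}=m_ie_if_i$; and $\psi_n\in\mathbb F_n[y]$ is monic irreducible, $\psi_n\ne y$. Here $\mathbb F_0=\mathbb F$, $\mathbb F_{i+1}=\mathbb F_i[y]/(\psi_i)$, $z_i\in\mathbb F_{i+1}$ is the class of $y$, $f_i=\deg\psi_i$, $m_i=\deg\phi_i$ for $1\le i\le n$, $m_{n+1}=m_ne_nf_n$, $m_1=f_0$, and $\ell_i,\ell_i'$ are fixed integers with $\ell_ih_i-\ell_i'e_i=1$. Operators attached to $\mathbf t$, recursively, for nonzero $P\in\mathcal O[x]$. $v_1=v$, $\omega_1(P)=\mathrm{ord}_{\psi_0}(\overline{P(y)/\pi^{v(P)}})$. For $i\ge1$ let $P=\sum_j a_j\phi_i^j$, $\deg a_j<m_i$, be the $\phi_i$-adic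 development and $u_j=v_i(a_j\phi_i^j)$ ($=\infty$ if $a_j=0$). $N_i(P)$ is the lower convex hull of the points $(j,u_j)$ with $a_j\ne0$, preceded by a side of slope $-\infty$ of length $\mathrm{ord}_{\phi_i}(P)$ if $\phi_i\mid P$; $N_i^-(P)$ is the principal polygon formed by its sides of negative slope, including $-\infty$ (its finite part is the first vertex alone if there is no finite negative slope). For an integer abscissa $j$ of the finite part of $N_i^-(P)$, the residual coefficient $c_j\in\mathbb F_i$ is $0$ if $(j,u_j)$ lies strictly above $N_i^-(P)$; if $(j,u_j)$ lies on it, $c_j$ is the class of $a_j/\pi^{u_j}$ in $\mathcal O[x]/(\pi,\phi_1)=\mathbb F_1$ when $i=1$, and $c_j=z_{i-1}^{t(j)}R_{i-1}(a_j)(z_{i-1})$ with $t(j)=(s_{i-1}(a_j)-\ell_{i-1}u_j)/e_{i-1}\in\mathbb Z$ when $i\ge2$. For a negative rational $\lambda=-h/e$ in lowest terms, $S_\lambda(P)=S_\lambda(N_i^-(P))$ and, if $s$ is its initial abscissa and $d$ its degree, $R_\lambda(P)(y)=\sum_{k=0}^d c_{s+ke}y^k\in\mathbb F_i[y]$ (residual polynomial of order $i$). For $i\le n$: $S_i=S_{\lambda_i}$, $s_i(P)$ is the initial abscissa of $S_i(P)$, $R_i=R_{\lambda_i}$, $v_{i+1}(P)$ is $e_i$ times the ordinate at the origin of the line of slope $\lambda_i$ containing $S_i(P)$, and $\omega_{i+1}(P)=\mathrm{ord}_{\psi_i}(R_i(P))$; we write $\omega_{i+1}^{\mathbf t}$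 to stress the type. A monic $P$ has type $\mathbf t$ if $P\equiv\phi_1^{a_0}\pmod{\mathfrak m}$ with $a_0\ge1$ and, for $1\le i\le n$, $N_i(P)$ has a single side, of slope $\lambda_i$, and $R_i(P)\sim\psi_i^{a_i}$ with $a_i\ge1$. A representative of $\mathbf t$ is a monic $\phi_{n+1}\in\mathcal O[x]$ of type $\mathbf t$ with $R_n(\phi_{n+1})\sim\psi_n$ (for $n=0$: monic with reduction $\psi_0$). Universal family. For every monic irreducible $\psi_0\in\mathbb F[y]$ a monic lift $\phi_1\in\mathcal O[x]$ is fixed once and for all and, recursively, for every type of order $n\ge1$ made up of fixed polynomials a representative $\phi_{n+1}$ is fixed; all types are assumed to be made up of these fixed polynomials only. Sets of types. For monic $P\in\mathcal O[x]$, $\mathbf t_0(P)$ is the set of monic irreducible factors of $\overline P$ in $\mathbb F[y]$, and for $r\ge1$, $\mathbf t_r(P)$ is the set of types $\mathbf t$ of order $r$ with $\omega_{r+1}^{\mathbf t}(P)>0$ and $\omega_r^{\mathbf t}(P)>1$. A type $\mathbf t$ of order $n$ is $f$-complete if $\omega_{n+1}^{\mathbf t}(f)=1$. *)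

theory Defs
  imports "HOL-Analysis.Analysis" "HOL-Computational_Algebra.Computational_Algebra"
begin

section \<open>Finite extensions of the p-adic numbers\<close>

text \<open>
  \<open>Qp\<close> is a completion of the rational numbers for the p-adic valuation, realised inside \<open>K = 'k\<close>:
  the restriction of \<open>v\<close> to the rationals is a positive multiple of the p-adic valuation (as
  \<open>v p > 0\<close>), the rationals are dense in \<open>Qp\<close>, and \<open>Qp\<close> is complete. The field \<open>K\<close> is finite over
  \<open>Qp\<close>, and \<open>v\<close> is the valuation with \<open>v(K\<^sup>*) = \<int>\<close>. The value of the integer-valued \<open>v\<close> at \<open>0\<close> is
  irrelevant; \<open>v 0 = \<infinity>\<close> is rendered by treating \<open>0\<close> separately.
\<close>

locale padic_field =
  fixes p :: nat
    and Qp :: "'k::field_char_0 set"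
    and v :: "'k \<Rightarrow> int"
  assumes prime_p: "prime p"
    and v_mult: "x \<noteq> 0 \<Longrightarrow> y \<noteq> 0 \<Longrightarrow> v (x * y) = v x + v y"
    and v_add: "x \<noteq> 0 \<Longrightarrow> y \<noteq> 0 \<Longrightarrow> x + y \<noteq> 0 \<Longrightarrow> min (v x) (v y) \<le> v (x + y)"
    and v_surj: "v ` (- {0}) = UNIV"
    and v_p: "0 < v (of_nat p)"
    and Qp_rat: "range of_rat \<subseteq> Qp"
    and Qp_add: "x \<in> Qp \<Longrightarrow> y \<in> Qp \<Longrightarrow> x + y \<in> Qp"
    and Qp_mult: "x \<in> Qp \<Longrightarrow> y \<in> Qp \<Longrightarrow> x * y \<in> Qp"
    and Qp_inverse: "x \<in> Qp \<Longrightarrow> inverse x \<in> Qp"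
    and Qp_dense: "x \<in> Qp \<Longrightarrow> \<exists>q::rat. x = of_rat q \<or> N \<le> v (x - of_rat q)"
    and Qp_complete:
      "(\<And>i::nat. X i \<in> Qp) \<Longrightarrow>
       (\<And>N. \<exists>n0. \<forall>i\<ge>n0. \<forall>j\<ge>n0. X i = X j \<or> N \<le> v (X i - X j)) \<Longrightarrow>
       \<exists>x\<in>Qp. \<forall>N. \<exists>n0. \<forall>i\<ge>n0. X i = x \<or> N \<le> v (X i - x)"
    and finite_over_Qp:
      "\<exists>B::'k set. finite B \<and> (\<forall>x. \<exists>c. (\<forall>b\<in>B. c b \<in> Qp) \<and> x = (\<Sum>b\<in>B. c b * b))"
begin

definition integers :: "'k set" ("\<O>") where
  "\<O> = {x. x = 0 \<or> 0 \<le> v x}"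

definition integral_poly :: "'k poly \<Rightarrow> bool" where
  "integral_poly P \<longleftrightarrow> (\<forall>i. coeff P i \<in> \<O>)"

definition monic_integral :: "'k poly \<Rightarrow> bool" where
  "monic_integral P \<longleftrightarrow> integral_poly P \<and> lead_coeff P = 1"

text \<open>The extension of \<open>v\<close> to nonzero polynomials.\<close>

definition gauss_val :: "'k poly \<Rightarrow> int" where
  "gauss_val P = Min (v ` (set (coeffs P) - {0}))"

end


section \<open>Polynomials over a subfield, and quotients by irreducible polynomials\<close>

text \<open>
  All residue fields are realised as subfields of one algebraically closed field. An element of
  \<open>F[y]\<close> is a polynomial over the large field whose coefficients lie in \<open>F\<close>.
\<close>

definition poly_over :: "'a::zero set \<Rightarrow> 'a poly \<Rightarrow> bool" where
  "poly_over F g \<longleftrightarrow> (\<forall>i. coeff g i \<in> F)"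

definition monic_irreducible_over :: "'a::field set \<Rightarrow> 'a poly \<Rightarrow> bool" where
  "monic_irreducible_over F g \<longleftrightarrow>
     poly_over F g \<and> lead_coeff g = 1 \<and> 0 < degree g \<and>
     (\<forall>a b. poly_over F a \<longrightarrow> poly_over F b \<longrightarrow> g = a * b \<longrightarrow> degree a = 0 \<or> degree b = 0)"

definition root_of :: "'a::alg_closed_field poly \<Rightarrow> 'a" where
  "root_of g = (SOME z. poly g z = 0)"

text \<open>
  The quotient \<open>F[y]/(g)\<close>, realised as \<open>F(z)\<close> for the root \<open>z = root_of g\<close>, which plays the role of
  the class of \<open>y\<close>. See the lemma \<open>quotient_kernel\<close>.
\<close>

definition quotient_field :: "'a::alg_closed_field set \<Rightarrow> 'a poly \<Rightarrow> 'a set" where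
  "quotient_field F g = {poly a (root_of g) | a. poly_over F a}"

definition subfield_set :: "'a::field set \<Rightarrow> bool" where
  "subfield_set F \<longleftrightarrow> 1 \<in> F \<and> (\<forall>x\<in>F. \<forall>y\<in>F. x - y \<in> F \<and> x * y \<in> F) \<and> (\<forall>x\<in>F. inverse x \<in> F)"

lemma subfield_set_sum:
  assumes "subfield_set F" "\<And>i. i \<in> A \<Longrightarrow> h i \<in> F"
  shows "sum h A \<in> F"
proof -
  have zero: "0 \<in> F"
    using assms(1) unfolding subfield_set_def by (metis diff_self)
  have add: "x + y \<in> F" if "x \<in> F" "y \<in> F" for x y
    using assms(1) zero that unfolding subfield_set_def
    by (metis diff_0 diff_minus_eq_add)
  show ?thesis
    using assms(2) by (induction A rule: infinite_finite_induct) (auto simp: zero add)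
qed

lemma poly_over_mult:
  assumes "subfield_set F" "poly_over F a" "poly_over F b"
  shows "poly_over F (a * b)"
  using assms
  by (auto simp: poly_over_def coeff_mult subfield_set_def intro!: subfield_set_sum[OF assms(1)])

lemma poly_over_diff:
  assumes "subfield_set F" "poly_over F a" "poly_over F b"
  shows "poly_over F (a - b)"
  using assms by (auto simp: poly_over_def subfield_set_def)

lemma poly_over_add:
  assumes "subfield_set F" "poly_over F a" "poly_over F b"
  shows "poly_over F (a + b)"
  using assms by (simp add: poly_over_def subfield_set_def) (metis diff_0 diff_minus_eq_add diff_self)

lemma poly_over_monom:
  assumes "subfield_set F" "c \<in> F"
  shows "poly_over F (monom c n)"
  using assms subfield_set_sum[OF assms(1), of "{}"] by (auto simp: poly_over_def)

lemma poly_over_division: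
  assumes F: "subfield_set F" and g: "poly_over F g" "lead_coeff g = 1" and a: "poly_over F a"
  shows "\<exists>q r. poly_over F q \<and> poly_over F r \<and> a = g * q + r \<and> (r = 0 \<or> degree r < degree g)"
  using a
proof (induction "degree a" arbitrary: a rule: less_induct)
  case less
  have zero: "poly_over F 0"
    using poly_over_diff[OF F g(1) g(1)] by simp
  show ?case
  proof (cases "a = 0 \<or> degree a < degree g")
    case True
    then show ?thesis
      using less.prems zero by (intro exI[of _ 0] exI[of _ a]) auto
  next
    case False
    define m where "m = monom (lead_coeff a) (degree a - degree g)"
    have m: "poly_over F m"
      unfolding m_def using less.prems by (intro poly_over_monom[OF F]) (simp add: poly_over_def)
    define a' where "a' = a - g * m"
    have a': "poly_over F a'"
      unfolding a'_def by (intro poly_over_diff poly_over_mult F g(1) m less.prems)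
    have g0: "g \<noteq> 0" and m0: "m \<noteq> 0"
      using g(2) False by (auto simp: m_def monom_eq_0_iff)
    have deg: "degree (g * m) = degree a"
      using False g0 m0 by (simp add: degree_mult_eq m_def degree_monom_eq)
    have lc: "lead_coeff (g * m) = lead_coeff a"
      using g(2) False by (simp add: lead_coeff_mult m_def degree_monom_eq del: coeff_degree_mult)
    have IH: "a' = 0 \<or> degree a' < degree a \<or> degree a = 0"
    proof (cases "degree a = 0")
      case dega: False
      have "degree a' \<le> degree a"
        unfolding a'_def using deg by (metis degree_diff_le order_refl)
      moreover have "coeff a' (degree a) = 0"
        unfolding a'_def using lc deg by simp
      ultimately show ?thesis
        by (metis le_neq_implies_less leading_coeff_0_iff)
    qed auto
    have "\<exists>q r. poly_over F q \<and> poly_over F r \<and> a' = g * q + r \<and> (r = 0 \<or> degree r < degree g)"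
    proof (cases "a' = 0")
      case True
      then show ?thesis using zero by (intro exI[of _ 0]) auto
    next
      case a'0: False
      have "degree a' < degree a"
      proof (rule ccontr)
        assume "\<not> degree a' < degree a"
        with IH a'0 have d: "degree a = 0" by auto
        have "degree a' \<le> 0"
          unfolding a'_def using deg d by (metis degree_diff_le order_refl)
        moreover have "coeff a' 0 = 0"
          unfolding a'_def using lc deg d by simp
        ultimately show False using a'0 by (metis le_zero_eq leading_coeff_0_iff)
      qed
      then show ?thesis using less.hyps a' by blast
    qed
    then obtain q r where qr: "poly_over F q" "poly_over F r" "a' = g * q + r"
      "r = 0 \<or> degree r < degree g" by blast
    have "a = g * (q + m) + r"
      using qr(3) by (simp add: a'_def algebra_simps)
    then show ?thesis
      using qr m poly_over_add[OF F] by blast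
  qed
qed

text \<open>
  Evaluation at \<open>root_of g\<close> maps \<open>F[y]\<close> onto \<open>quotient_field F g\<close>, with kernel the ideal \<open>(g)\<close> of \<open>F[y]\<close>.
\<close>

lemma quotient_kernel:
  fixes F :: "'a::alg_closed_field set"
  assumes F: "subfield_set F" and g: "monic_irreducible_over F g" and a: "poly_over F a"
  shows "poly a (root_of g) = 0 \<longleftrightarrow> (\<exists>b. poly_over F b \<and> a = g * b)"
proof -
  define z where "z = root_of g"
  have g': "poly_over F g" "lead_coeff g = 1" "degree g > 0"
    and irr: "\<And>a b. poly_over F a \<Longrightarrow> poly_over F b \<Longrightarrow> g = a * b \<Longrightarrow> degree a = 0 \<or> degree b = 0"
    using g by (auto simp: monic_irreducible_over_def)
  have gz: "poly g z = 0"
    unfolding z_def root_of_def using alg_closed_imp_poly_has_root[OF g'(3)] by (rule someI_ex)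
  define I where "I = (\<lambda>h. poly_over F h \<and> h \<noteq> 0 \<and> poly h z = 0)"
  have Ig: "I g" using g' gz by (auto simp: I_def)
  obtain h where h: "I h" and hmin: "\<And>k. I k \<Longrightarrow> degree h \<le> degree k"
    using ex_has_least_nat[of I g degree] Ig by blast
  define c where "c = inverse (lead_coeff h)"
  define h1 where "h1 = smult c h"
  have c: "c \<noteq> 0" "c \<in> F"
    using h F by (auto simp: c_def I_def poly_over_def subfield_set_def)
  have h1: "poly_over F h1" "lead_coeff h1 = 1" "poly h1 z = 0" "degree h1 = degree h" "h1 \<noteq> 0"
    using h c F by (auto simp: h1_def I_def poly_over_def subfield_set_def c_def)
  have dvd: "\<exists>q. poly_over F q \<and> k = h1 * q" if k: "poly_over F k" "poly k z = 0" for k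
  proof -
    obtain q r where qr: "poly_over F q" "poly_over F r" "k = h1 * q + r"
      "r = 0 \<or> degree r < degree h1"
      using poly_over_division[OF F h1(1,2) k(1)] by blast
    have "poly r z = 0" using qr(3) k(2) h1(3) by simp
    then have "r = 0" using hmin[of r] qr h1(4) unfolding I_def by fastforce
    then show ?thesis using qr by auto
  qed
  obtain q where q: "poly_over F q" "g = h1 * q" using dvd[OF g'(1) gz] by blast
  have "degree h1 \<noteq> 0"
  proof
    assume "degree h1 = 0"
    then obtain d where "h1 = [:d:]" by (auto elim: degree_eq_zeroE)
    then show False using h1(2,3) by simp
  qed
  then have "degree q = 0" using irr[OF h1(1) q] by simp
  then obtain d where d: "q = [:d:]" by (auto elim: degree_eq_zeroE)
  have "lead_coeff g = lead_coeff h1 * lead_coeff q"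
    unfolding q(2) by (rule lead_coeff_mult)
  then have "d = 1" using d h1(2) g'(2) by simp
  then have gh: "g = h1" using q(2) d by simp
  show ?thesis
    unfolding z_def[symmetric] using dvd[OF a] gz gh by auto
qed

definition normalize_monic :: "'a::field poly \<Rightarrow> 'a poly" where
  "normalize_monic g = smult (inverse (lead_coeff g)) g"


text \<open>For \<open>P \<noteq> 0\<close> and \<open>g\<close> of positive degree.\<close>

definition poly_ord :: "'a::field poly \<Rightarrow> 'a poly \<Rightarrow> nat" where
  "poly_ord g P = Max {n. g ^ n dvd P}"


section \<open>Polygons\<close>

text \<open>The numerators of slopes are written with a minus sign: \<open>\<lambda> = - slope_h \<lambda> / slope_e \<lambda>\<close>.\<close>

definition slope_h :: "rat \<Rightarrow> int" where "slope_h lam = - fst (quotient_of lam)"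
definition slope_e :: "rat \<Rightarrow> int" where "slope_e lam = snd (quotient_of lam)"

definition lower_hull :: "(real \<times> real) set \<Rightarrow> (real \<times> real) set" where
  "lower_hull C = {(x, y). (x, y) \<in> convex hull C \<and> (\<forall>y'. (x, y') \<in> convex hull C \<longrightarrow> y \<le> y')}"

definition side :: "rat \<Rightarrow> (real \<times> real) set \<Rightarrow> (real \<times> real) set" where
  "side lam N = {(x, y) \<in> N. \<forall>(x', y') \<in> N.
     y + \<bar>of_rat lam\<bar> * x \<le> y' + \<bar>of_rat lam\<bar> * x'}"

definition initial_abscissa :: "(real \<times> real) set \<Rightarrow> real" where
  "initial_abscissa S = Inf (fst ` S)"

definition side_length :: "(real \<times> real) set \<Rightarrow> real" where
  "side_length S = Sup (fst ` S) - Inf (fst ` S)"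

definition ordinate_at_origin :: "rat \<Rightarrow> (real \<times> real) set \<Rightarrow> real" where
  "ordinate_at_origin lam S = (THE c. \<forall>(x, y) \<in> S. y = c + of_rat lam * x)"

text \<open>The finite part of the polygon formed by the sides of negative slope.\<close>

definition negative_part :: "(real \<times> real) set \<Rightarrow> (real \<times> real) set" where
  "negative_part N =
     {(x, y) \<in> N. \<forall>(x', y') \<in> N. x \<le> x'} \<union>
     \<Union> {side lam N | lam. lam < 0 \<and> 0 < side_length (side lam N)}"

text \<open>
  \<open>residual lam N c\<close> is \<open>\<Sum>\<^bsub>k \<le> d\<^esub> c(s + k e) y\<^sup>k\<close>, for \<open>s\<close> the initial abscissa and \<open>d\<close> the degree
  of the side of slope \<open>lam\<close> of \<open>N\<close>. The arguments of \<open>floor\<close> are integers.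
\<close>

definition residual :: "rat \<Rightarrow> (real \<times> real) set \<Rightarrow> (nat \<Rightarrow> 'a::comm_semiring_1) \<Rightarrow> 'a poly" where
  "residual lam N c =
     (let S = side lam N;
          s = nat \<lfloor>initial_abscissa S\<rfloor>;
          d = nat \<lfloor>side_length S / of_int (slope_e lam)\<rfloor>
      in \<Sum>k\<le>d. monom (c (s + k * nat (slope_e lam))) k)"


section \<open>Polynomial developments\<close>

definition adic_coeff :: "'a::field poly \<Rightarrow> 'a poly \<Rightarrow> nat \<Rightarrow> 'a poly" where
  "adic_coeff \<phi> P j = (P div \<phi> ^ j) mod \<phi>"

lemma adic_development:
  assumes "0 < degree \<phi>"
  shows "P = (\<Sum>j\<le>degree P. adic_coeff \<phi> P j * \<phi> ^ j)"
    and "adic_coeff \<phi> P j = 0 \<or> degree (adic_coeff \<phi> P j) < degree \<phi>"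
proof -
  have *: "P = (\<Sum>j<n. adic_coeff \<phi> P j * \<phi> ^ j) + (P div \<phi> ^ n) * \<phi> ^ n" for n
  proof (induction n)
    case (Suc n)
    have "P div \<phi> ^ Suc n = (P div \<phi> ^ n) div \<phi>"
      by (metis power_Suc2 poly_div_mult_right)
    moreover have "P div \<phi> ^ n = (P div \<phi> ^ n) div \<phi> * \<phi> + adic_coeff \<phi> P n"
      by (simp add: adic_coeff_def)
    ultimately have "(P div \<phi> ^ n) * \<phi> ^ n =
        adic_coeff \<phi> P n * \<phi> ^ n + (P div \<phi> ^ Suc n) * \<phi> ^ Suc n"
      by (metis (no_types, lifting) add.commute distrib_right mult.assoc power_Suc)
    with Suc show ?case by (simp add: add.assoc)
  qed simp
  have "degree P < degree (\<phi> ^ Suc (degree P))"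
  proof -
    have "\<phi> \<noteq> 0" using assms by auto
    then have "degree (\<phi> ^ Suc (degree P)) = Suc (degree P) * degree \<phi>"
      by (rule degree_power_eq)
    also have "\<dots> \<ge> Suc (degree P) * 1"
      using assms by (intro mult_le_mono2) simp
    finally show ?thesis by simp
  qed
  then have "P div \<phi> ^ Suc (degree P) = 0"
    by (rule div_poly_less)
  with *[of "Suc (degree P)"] show "P = (\<Sum>j\<le>degree P. adic_coeff \<phi> P j * \<phi> ^ j)"
    by (simp add: lessThan_Suc_atMost)
  show "adic_coeff \<phi> P j = 0 \<or> degree (adic_coeff \<phi> P j) < degree \<phi>"
    unfolding adic_coeff_def using assms by (intro degree_mod_less) auto
qed

text \<open>
  The finite part of the Newton polygon of \<open>P\<close> with respect to \<open>\<phi>\<close> and a valuation \<open>w\<close>. The side of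
  slope \<open>-\<infinity>\<close>, of length \<open>poly_ord \<phi> P\<close>, is not part of this set.
\<close>

definition newton_polygon :: "('a::field poly \<Rightarrow> int) \<Rightarrow> 'a poly \<Rightarrow> 'a poly \<Rightarrow> (real \<times> real) set" where
  "newton_polygon w \<phi> P = lower_hull
     {(of_nat j, of_int (w (adic_coeff \<phi> P j * \<phi> ^ j))) | j. adic_coeff \<phi> P j \<noteq> 0}"

definition principal_polygon :: "('a::field poly \<Rightarrow> int) \<Rightarrow> 'a poly \<Rightarrow> 'a poly \<Rightarrow> (real \<times> real) set" where
  "principal_polygon w \<phi> P = negative_part (newton_polygon w \<phi> P)"

text \<open>The whole polygon, including its part of slope \<open>-\<infinity>\<close>, is one side of slope \<open>lam\<close>.\<close>

definition single_side :: "('a::field poly \<Rightarrow> int) \<Rightarrow> 'a poly \<Rightarrow> rat \<Rightarrow> 'a poly \<Rightarrow> bool" where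
  "single_side w \<phi> lam P \<longleftrightarrow>
     poly_ord \<phi> P = 0 \<and>
     newton_polygon w \<phi> P = side lam (newton_polygon w \<phi> P) \<and>
     0 < side_length (newton_polygon w \<phi> P)"


section \<open>Types and their operators\<close>

text \<open>
  The type \<open>(\<phi>\<^sub>1; \<lambda>\<^sub>1, \<phi>\<^sub>2; \<dots>; \<lambda>\<^sub>n\<^sub>-\<^sub>1, \<phi>\<^sub>n; \<lambda>\<^sub>n, \<psi>\<^sub>n)\<close> is the pair of the list
  \<open>[(\<phi>\<^sub>n, \<lambda>\<^sub>n), \<dots>, (\<phi>\<^sub>1, \<lambda>\<^sub>1)]\<close>, highest level first, and of \<open>\<psi>\<^sub>n\<close>. A type of order \<open>0\<close> is
  \<open>([], \<psi>\<^sub>0)\<close>. The tail of the list belongs to the truncation of the type.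
\<close>

type_synonym 'k levels = "('k poly \<times> rat) list"
type_synonym ('k, 'l) mtype = "'k levels \<times> 'l poly"

text \<open>
  \<open>red\<close> is the reduction map of the ring of integers onto the residue field; the algebraically
  closed field \<open>'l\<close> contains the residue field. \<open>ell L\<close> is the integer \<open>\<ell>\<^sub>i\<close> attached to the
  level \<open>i = length L\<close> of the types whose first \<open>i\<close> levels are \<open>L\<close>.
\<close>

locale montes_setting = padic_field p Qp v
  for p :: nat and Qp :: "'k::field_char_0 set" and v :: "'k \<Rightarrow> int" +
  fixes \<pi> :: 'k
    and red :: "'k \<Rightarrow> 'l::alg_closed_field"
    and ell :: "'k levels \<Rightarrow> int"
  assumes \<pi>: "\<pi> \<noteq> 0" "v \<pi> = 1"
    and red_add: "x \<in> \<O> \<Longrightarrow> y \<in> \<O> \<Longrightarrow> red (x + y) = red x + red y"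
    and red_mult: "x \<in> \<O> \<Longrightarrow> y \<in> \<O> \<Longrightarrow> red (x * y) = red x * red y"
    and red_one: "red 1 = 1"
    and red_kernel: "x \<in> \<O> \<Longrightarrow> red x = 0 \<longleftrightarrow> x = 0 \<or> 0 < v x"
    and ell: "lam < 0 \<Longrightarrow> \<exists>ell'. ell ((\<phi>, lam) # L) * slope_h lam - ell' * slope_e lam = 1"
begin

definition residue_field :: "'l set" ("\<F>") where
  "\<F> = red ` \<O>"

definition red_poly :: "'k poly \<Rightarrow> 'l poly" where
  "red_poly P = map_poly red P"

text \<open>
  For \<open>L\<close> of length \<open>i\<close>, \<open>val L\<close> is \<open>v\<^sub>i\<^sub>+\<^sub>1\<close>. The argument of \<open>floor\<close> is an integer.
\<close>

fun val :: "'k levels \<Rightarrow> 'k poly \<Rightarrow> int" where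
  "val [] P = gauss_val P"
| "val ((\<phi>, lam) # L) P =
     \<lfloor>of_int (slope_e lam) * ordinate_at_origin lam (side lam (principal_polygon (val L) \<phi> P))\<rfloor>"

text \<open>
  For \<open>L\<close> of length \<open>i\<close>, \<open>res_coeff L \<phi> P j\<close> is the residual coefficient \<open>c\<^sub>j\<close> of order \<open>i + 1\<close>
  with respect to \<open>\<phi> = \<phi>\<^sub>i\<^sub>+\<^sub>1\<close>, and \<open>res_poly L\<close> is the residual polynomial operator \<open>R\<^sub>i\<close>, where
  \<open>R\<^sub>0(P)\<close> is the reduction of \<open>P/\<pi>\<^bsup>v(P)\<^esup>\<close>. The element \<open>z\<close> is \<open>z\<^sub>i\<close>, the class of \<open>y\<close> modulo the
  monic polynomial \<open>\<psi>\<^sub>i\<close> with \<open>\<psi>\<^sub>i \<sim> R\<^sub>i(\<phi>\<^sub>i\<^sub>+\<^sub>1)\<close>. The division by \<open>slope_e lam\<close> is exact.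
\<close>

function (sequential)
  res_coeff :: "'k levels \<Rightarrow> 'k poly \<Rightarrow> 'k poly \<Rightarrow> nat \<Rightarrow> 'l" and
  res_poly :: "'k levels \<Rightarrow> 'k poly \<Rightarrow> 'l poly"
where
  "res_coeff L \<phi> P j =
     (let a = adic_coeff \<phi> P j;
          u = val L (a * \<phi> ^ j);
          z = root_of (normalize_monic (res_poly L \<phi>))
      in if a = 0 \<or> (of_nat j, of_int u) \<notin> principal_polygon (val L) \<phi> P then 0
         else case L of
           [] \<Rightarrow> poly (red_poly (smult (inverse (\<pi> powi u)) a)) z
         | (\<phi>', lam) # L' \<Rightarrow>
             z powi ((\<lfloor>initial_abscissa (side lam (principal_polygon (val L') \<phi>' a))\<rfloor> - ell L * u)
                       div slope_e lam)
             * poly (res_poly L a) z)"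
| "res_poly [] P = red_poly (smult (inverse (\<pi> powi gauss_val P)) P)"
| "res_poly ((\<phi>, lam) # L) P =
     residual lam (principal_polygon (val L) \<phi> P) (res_coeff L \<phi> P)"
  by pat_completeness auto
termination
  by (relation "Wellfounded.measure (\<lambda>x. case x of Inl (L, _) \<Rightarrow> 2 * length L + 1 | Inr (L, _) \<Rightarrow> 2 * length L)")
     auto

text \<open>
  The polynomial \<open>\<psi>\<^sub>i\<close> determined by the levels \<open>L\<close> up to \<open>i\<close> and by \<open>\<phi> = \<phi>\<^sub>i\<^sub>+\<^sub>1\<close>. For \<open>i = 0\<close> this
  is the reduction of the monic polynomial \<open>\<phi>\<^sub>1\<close>.
\<close>

definition psi :: "'k levels \<Rightarrow> 'k poly \<Rightarrow> 'l poly" where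
  "psi L \<phi> = normalize_monic (res_poly L \<phi>)"

fun tower :: "'k levels \<Rightarrow> 'l set" where
  "tower [] = \<F>"
| "tower ((\<phi>, lam) # L) = quotient_field (tower L) (psi L \<phi>)"

fun valid_levels :: "'k levels \<Rightarrow> bool" where
  "valid_levels [] \<longleftrightarrow> True"
| "valid_levels [(\<phi>, lam)] \<longleftrightarrow>
     monic_integral \<phi> \<and> lam < 0 \<and> monic_irreducible_over \<F> (red_poly \<phi>)"
| "valid_levels ((\<phi>, lam) # (\<phi>', lam') # L) \<longleftrightarrow>
     valid_levels ((\<phi>', lam') # L) \<and> monic_integral \<phi> \<and> lam < 0 \<and>
     single_side (val L) \<phi>' lam' \<phi> \<and>
     monic_irreducible_over (tower ((\<phi>', lam') # L)) (psi ((\<phi>', lam') # L) \<phi>) \<and>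
     int (degree \<phi>) = int (degree \<phi>') * slope_e lam' * int (degree (psi ((\<phi>', lam') # L) \<phi>))"

definition is_type :: "('k, 'l) mtype \<Rightarrow> bool" where
  "is_type t \<longleftrightarrow> (case t of (L, \<psi>) \<Rightarrow>
     valid_levels L \<and> monic_irreducible_over (tower L) \<psi> \<and> (L \<noteq> [] \<longrightarrow> \<psi> \<noteq> monom 1 1))"

definition type_order :: "('k, 'l) mtype \<Rightarrow> nat" where
  "type_order t = length (fst t)"

text \<open>The truncation to order \<open>n - 1\<close> of a type of order \<open>n \<ge> 1\<close>.\<close>

definition truncation :: "('k, 'l) mtype \<Rightarrow> ('k, 'l) mtype" where
  "truncation t = (tl (fst t), psi (tl (fst t)) (fst (hd (fst t))))"

text \<open>
  For \<open>t\<close> of order \<open>n\<close> this is \<open>\<omega>\<^sub>n\<^sub>+\<^sub>1\<^sup>t\<close>, and \<open>omega (truncation t)\<close> is \<open>\<omega>\<^sub>n\<^sup>t\<close>. Multiplicities of monic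
  polynomials over a subfield may be taken over the large field.
\<close>

definition omega :: "('k, 'l) mtype \<Rightarrow> 'k poly \<Rightarrow> nat" where
  "omega t P = poly_ord (snd t) (res_poly (fst t) P)"

definition complete_for :: "'k poly \<Rightarrow> ('k, 'l) mtype \<Rightarrow> bool" where
  "complete_for f t \<longleftrightarrow> omega t f = 1"

text \<open>For monic \<open>P\<close> with integral coefficients: \<open>P\<close> has type \<open>(L, \<psi>)\<close>.\<close>

fun has_type :: "'k levels \<Rightarrow> 'l poly \<Rightarrow> 'k poly \<Rightarrow> bool" where
  "has_type [] \<psi> P \<longleftrightarrow> (\<exists>a\<ge>1. red_poly P = \<psi> ^ a)"
| "has_type ((\<phi>, lam) # L) \<psi> P \<longleftrightarrow>
     has_type L (psi L \<phi>) P \<and>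
     single_side (val L) \<phi> lam P \<and>
     (\<exists>a\<ge>1. \<exists>c. c \<noteq> 0 \<and> res_poly ((\<phi>, lam) # L) P = smult c (\<psi> ^ a))"

definition representative :: "('k, 'l) mtype \<Rightarrow> 'k poly \<Rightarrow> bool" where
  "representative t g \<longleftrightarrow> (case t of (L, \<psi>) \<Rightarrow>
     monic_integral g \<and>
     (if L = [] then red_poly g = \<psi>
      else has_type L \<psi> g \<and> (\<exists>c. c \<noteq> 0 \<and> res_poly L g = smult c \<psi>)))"

end


section \<open>The universal family\<close>

text \<open>
  \<open>fixed_levels rep L\<close>: every \<open>\<phi>\<^sub>i\<close> in \<open>L\<close> is the polynomial that \<open>rep\<close> assigns to the type of order
  \<open>i - 1\<close> made up of \<open>\<psi>\<^sub>i\<^sub>-\<^sub>1\<close> and the lower levels.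
\<close>

primrec (in montes_setting) fixed_levels ::
  "(('k, 'l) mtype \<Rightarrow> 'k poly) \<Rightarrow> 'k levels \<Rightarrow> bool"
where
  "fixed_levels rep [] \<longleftrightarrow> True"
| "fixed_levels rep (l # L) \<longleftrightarrow> fixed_levels rep L \<and> fst l = rep (L, psi L (fst l))"

locale universal_family = montes_setting p Qp v \<pi> red ell
  for p :: nat and Qp :: "'k::field_char_0 set" and v :: "'k \<Rightarrow> int"
    and \<pi> :: 'k and red :: "'k \<Rightarrow> 'l::alg_closed_field" and ell :: "'k levels \<Rightarrow> int" +
  fixes rep :: "('k, 'l) mtype \<Rightarrow> 'k poly"
  assumes rep: "is_type t \<Longrightarrow> fixed_levels rep (fst t) \<Longrightarrow> representative t (rep t)"
begin

definition types_of :: "nat \<Rightarrow> 'k poly \<Rightarrow> ('k, 'l) mtype set" where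
  "types_of r P =
     (if r = 0 then {([], \<psi>) | \<psi>. monic_irreducible_over \<F> \<psi> \<and> \<psi> dvd red_poly P}
      else {t. is_type t \<and> fixed_levels rep (fst t) \<and> type_order t = r \<and>
               omega t P > 0 \<and> omega (truncation t) P > 1})"

end

end

theory Submission
  imports Defs
begin

text \<open>
  The residual polynomial of order \<open>i\<close>, twisted by a suitable power of the variable, is multiplicative
  and additive on the initial forms of the valuation \<open>v\<^sub>i\<^sub>+\<^sub>1\<close>. Hence, by induction on the order,
  \<open>\<omega>\<^sub>i\<^sub>+\<^sub>1(f)\<close> is the length of the principal polygon \<open>N\<^sub>i\<^sub>+\<^sub>1\<^sup>-(f)\<close>. A type with \<open>\<omega>\<^sub>r\<^sub>+\<^sub>1(f) \<ge> 2\<close> therefore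
  extends to a type of order \<open>r + 1\<close>, unless that polygon is a side of slope \<open>-\<infinity>\<close>, in which case
  \<open>\<phi>\<^sub>r\<^sub>+\<^sub>1\<^sup>2\<close> divides \<open>f\<close>; conversely \<open>\<omega>\<^sub>r\<^sub>+\<^sub>1(f) \<le> \<omega>\<^sub>r(f)\<close>.

  Termination does not need the theorem of the index. Suppose \<open>\<omega>\<^sub>r\<^sub>+\<^sub>1(f) \<ge> 2\<close> and let
  \<open>\<Gamma> = v\<^sub>r\<^sub>+\<^sub>1(\<phi>\<^sub>r)\<close>. The side of slope \<open>\<lambda>\<^sub>r\<close> of \<open>f\<close> ends at an abscissa \<open>\<ge> 2\<close>, so
  \<open>v\<^sub>r\<^sub>+\<^sub>1(f) \<ge> 2 \<Gamma>\<close>, and \<open>v\<^sub>r\<^sub>+\<^sub>1(P') \<ge> v\<^sub>r\<^sub>+\<^sub>1(P) - \<Gamma>\<close> for all \<open>P\<close>. A Bezout relation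
  \<open>A f + B f' = \<pi>\<^sup>N\<close> with integral \<open>A\<close>, \<open>B\<close> then gives \<open>\<Gamma> \<le> N e\<^sub>1 \<cdots> e\<^sub>r \<le> N deg f\<close>, whereas \<open>\<Gamma> \<ge> r\<close>.
\<close>

section \<open>Sides of lower hulls\<close>

text \<open>The twist is forced by additivity: two polynomials of equal value may have sides that
  begin at different abscissas, so their residual polynomials cannot be added as they stand. The
  natural target is a ring of Laurent polynomials. Instead of building it, the proof records values
  at all nonzero \<open>x\<close>; the field is infinite, so these values determine the Laurent
  polynomial. The engine at each level is that evaluation at \<open>z\<close> kills the initial form
  of \<phi>, but that of no nonzero polynomial of smaller degree. It comes from the degree count
  \<open>deg \<phi> = m e f\<close>, and it gives both the product rule for the next valuation and
  the equality of multiplicity and polygon length. Order \<open>0\<close> behaves differently: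
  \<open>y\<close> is an admissible residual factor there, so evaluation at \<open>0\<close> must be
  allowed and constant terms may vanish, but no twist occurs. At higher orders constant terms never
  vanish and \<open>z\<close> is nonzero. The flag \<open>base\<close> separates the two situations,
  so that one argument serves both.\<close>

lemma infinite_UNIV_alg_closed: "infinite (UNIV :: 'a::alg_closed_field set)"
proof
  assume fin: "finite (UNIV :: 'a set)"
  define q :: "'a poly" where "q = (\<Prod>a\<in>UNIV. [:- a, 1:])"
  have "degree q = (\<Sum>a\<in>(UNIV :: 'a set). degree [:- a, 1:])"
    unfolding q_def by (rule degree_prod_sum_eq) auto
  also have "\<dots> > 0"
    using fin by (simp add: card_gt_0_iff)
  finally have "degree q > 0" .
  then have "degree (q + 1) > 0"
    by (metis degree_1 degree_add_eq_left)
  then obtain x where "poly (q + 1) x = 0"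
    using alg_closed_imp_poly_has_root by blast
  moreover have "poly q x = 0"
    unfolding q_def using fin by (auto simp: poly_prod intro!: bexI[of _ x])
  ultimately show False by simp
qed

text \<open>Omitting the point \<open>0\<close> matters because the Laurent polynomials used below
  have values only at nonzero points.\<close>

lemma poly_eqI_nonzero:
  fixes p q :: "'a::alg_closed_field poly"
  assumes "\<And>x. x \<noteq> 0 \<Longrightarrow> poly p x = poly q x"
  shows "p = q"
proof (rule ccontr)
  assume "p \<noteq> q"
  then have "finite {x. poly (p - q) x = 0}"
    by (intro poly_roots_finite) simp
  moreover have "UNIV \<subseteq> insert 0 {x. poly (p - q) x = 0}"
    using assms by auto
  ultimately show False
    using infinite_UNIV_alg_closed finite_subset by blast
qed

lemma exists_nonroot:
  fixes p :: "'a::alg_closed_field poly"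
  assumes "p \<noteq> 0"
  obtains x where "x \<noteq> 0" "poly p x \<noteq> 0"
  using poly_eqI_nonzero[of p 0] assms by auto

section \<open>Multiplicity of a factor\<close>

lemma finite_power_dvd:
  fixes g P :: "'a::field poly"
  assumes "0 < degree g" "P \<noteq> 0"
  shows "finite {n. g ^ n dvd P}"
proof (rule finite_subset)
  show "{n. g ^ n dvd P} \<subseteq> {..degree P}"
  proof
    fix n assume "n \<in> {n. g ^ n dvd P}"
    then have "degree (g ^ n) \<le> degree P"
      using assms(2) by (auto intro: dvd_imp_degree_le)
    moreover have "degree (g ^ n) = n * degree g"
      using assms(1) by (intro degree_power_eq) auto
    ultimately have "n * 1 \<le> degree P"
      using assms(1) by (metis Suc_leI mult_le_mono2 One_nat_def order_trans)
    then show "n \<in> {..degree P}" by simp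
  qed
qed simp

lemma poly_ord_dvd_iff:
  fixes g P :: "'a::field poly"
  assumes "0 < degree g" "P \<noteq> 0"
  shows "g ^ n dvd P \<longleftrightarrow> n \<le> poly_ord g P"
proof
  assume "g ^ n dvd P"
  then show "n \<le> poly_ord g P"
    unfolding poly_ord_def using finite_power_dvd[OF assms] by (intro Max_ge) auto
next
  assume *: "n \<le> poly_ord g P"
  have "poly_ord g P \<in> {n. g ^ n dvd P}"
    unfolding poly_ord_def using finite_power_dvd[OF assms]
    by (intro Max_in) (auto intro: exI[of _ 0])
  with * show "g ^ n dvd P"
    using le_imp_power_dvd dvd_trans by blast
qed

lemma poly_ord_eqI:
  fixes g P :: "'a::field poly"
  assumes "0 < degree g" "P \<noteq> 0" "g ^ n dvd P" "\<not> g ^ Suc n dvd P"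
  shows "poly_ord g P = n"
  using assms poly_ord_dvd_iff[of g P n] poly_ord_dvd_iff[of g P "Suc n"] by simp

lemma negative_slope:
  assumes "lam < 0"
  shows "0 < slope_h lam" "0 < slope_e lam" "coprime (slope_h lam) (slope_e lam)"
    and "lam = - of_int (slope_h lam) / of_int (slope_e lam)"
    and "of_rat lam = (- of_int (slope_h lam) / of_int (slope_e lam) :: real)"
    and "\<bar>of_rat lam :: real\<bar> = of_int (slope_h lam) / of_int (slope_e lam)"
proof -
  obtain a b where ab: "quotient_of lam = (a, b)" by (cases "quotient_of lam")
  have b: "0 < b" using quotient_of_denom_pos[OF ab] .
  have l: "lam = of_int a / of_int b" using quotient_of_div[OF ab] .
  show pos: "0 < slope_e lam" using b ab by (simp add: slope_e_def)
  have "a < 0"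
    using assms b l by (simp add: divide_less_0_iff)
  then show h: "0 < slope_h lam" using ab by (simp add: slope_h_def)
  show "coprime (slope_h lam) (slope_e lam)"
    using quotient_of_coprime[OF ab] ab by (simp add: slope_h_def slope_e_def)
  show eq: "lam = - of_int (slope_h lam) / of_int (slope_e lam)"
    using l ab by (simp add: slope_h_def slope_e_def)
  show "of_rat lam = (- of_int (slope_h lam) / of_int (slope_e lam) :: real)"
    by (subst eq) (simp add: of_rat_divide of_rat_minus)
  then show "\<bar>of_rat lam :: real\<bar> = of_int (slope_h lam) / of_int (slope_e lam)"
    using h pos by simp
qed

section \<open>Sides of finite sets of lattice points\<close>

definition points :: "nat set \<Rightarrow> (nat \<Rightarrow> int) \<Rightarrow> (real \<times> real) set" where
  "points J u = {(of_nat j, of_int (u j)) | j. j \<in> J}"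

text \<open>This is \<open>y + |lam| x\<close> with the denominator cleared, so that comparisons
  stay in the integers. Its minimum over the points is \<open>e\<close> times the ordinate at the
  origin of the supporting line, which is the value of the next valuation.\<close>

definition height_along :: "rat \<Rightarrow> (nat \<Rightarrow> int) \<Rightarrow> nat \<Rightarrow> int" where
  "height_along lam u j = slope_e lam * u j + slope_h lam * int j"

lemma of_int_height_along:
  "of_int (height_along lam u j) =
    of_int (slope_e lam) * of_int (u j) + of_int (slope_h lam) * (of_nat j :: 'a::ring_1)"
  by (simp add: height_along_def)

text \<open>Discrete counterpart of \<open>side\<close>: \<open>s\<close> and \<open>t\<close> are
  the abscissas of the two ends, equal if the side is a single point. Later arguments work with this
  predicate; polygons as sets of real points occur only in the translation.\<close>

definition side_of_points :: "rat \<Rightarrow> nat set \<Rightarrow> (nat \<Rightarrow> int) \<Rightarrow> nat \<Rightarrow> nat \<Rightarrow> bool" where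
  "side_of_points lam J u s t \<longleftrightarrow> s \<in> J \<and> t \<in> J \<and> height_along lam u t = height_along lam u s \<and>
     (\<forall>j\<in>J. height_along lam u s \<le> height_along lam u j \<and>
       (height_along lam u j = height_along lam u s \<longrightarrow> s \<le> j \<and> j \<le> t))"

lemma side_of_points_exists:
  assumes "finite J" "J \<noteq> {}"
  obtains s t where "side_of_points lam J u s t"
proof -
  define M where "M = Min (height_along lam u ` J)"
  define A where "A = {j \<in> J. height_along lam u j = M}"
  have "M \<in> height_along lam u ` J"
    unfolding M_def using assms by (intro Min_in) auto
  then have A: "finite A" "A \<noteq> {}" using assms by (auto simp: A_def)
  have "Min A \<in> A" "Max A \<in> A" using A by auto
  moreover have "M \<le> height_along lam u j" if "j \<in> J" for j
    unfolding M_def using assms that by auto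
  moreover have "Min A \<le> j \<and> j \<le> Max A" if "j \<in> J" "height_along lam u j = M" for j
    using A(1) that by (auto simp: A_def)
  ultimately have "side_of_points lam J u (Min A) (Max A)"
    unfolding side_of_points_def A_def by auto
  then show ?thesis by (rule that)
qed

text \<open>The open half plane above the supporting line, together with the part of the line over
  \<open>[s, t]\<close>, is convex and contains all points, hence contains their hull.\<close>

lemma lower_hull_side_bounds:
  assumes side: "side_of_points lam J u s t" and lam: "lam < 0"
    and xy: "(x, y) \<in> convex hull (points J u)"
  shows "of_int (height_along lam u s) \<le> of_int (slope_e lam) * y + of_int (slope_h lam) * x"
    and "of_int (slope_e lam) * y + of_int (slope_h lam) * x = of_int (height_along lam u s) \<Longrightarrow>
      of_nat s \<le> x \<and> x \<le> of_nat t"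
proof -
  define M :: real where "M = of_int (height_along lam u s)"
  define g where "g = (\<lambda>(x, y). of_int (slope_e lam) * y + of_int (slope_h lam) * x :: real)"
  define H where "H = {p. M < g p \<or> (g p = M \<and> of_nat s \<le> fst p \<and> fst p \<le> (of_nat t :: real))}"
  have lin: "g (a *\<^sub>R p + b *\<^sub>R q) = a * g p + b * g q" for a b p q
    by (cases p; cases q) (simp add: g_def algebra_simps)
  have "convex H"
    unfolding convex_def
  proof (intro ballI allI impI)
    fix p q and a b :: real
    assume p: "p \<in> H" and q: "q \<in> H" and a: "0 \<le> a" and b: "0 \<le> b" and ab: "a + b = 1"
    have gp: "M \<le> g p" and gq: "M \<le> g q" using p q by (auto simp: H_def)
    show "a *\<^sub>R p + b *\<^sub>R q \<in> H"
    proof (cases "a = 0 \<or> b = 0")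
      case True
      then show ?thesis using p q ab by auto
    next
      case False
      then have pos: "0 < a" "0 < b" using a b by auto
      have Mab: "M = a * M + b * M" using ab by (metis distrib_right mult_1)
      have pq: "a * M \<le> a * g p" "b * M \<le> b * g q" using gp gq a b by (auto intro: mult_left_mono)
      show ?thesis
      proof (cases "g p = M \<and> g q = M")
        case True
        then have 1: "of_nat s \<le> fst p" "fst p \<le> of_nat t" "of_nat s \<le> fst q" "fst q \<le> of_nat t"
          using p q by (auto simp: H_def)
        have "fst (a *\<^sub>R p + b *\<^sub>R q) = a * fst p + b * fst q" by simp
        moreover have "a * of_nat s \<le> a * fst p" "b * of_nat s \<le> b * fst q"
          "a * fst p \<le> a * of_nat t" "b * fst q \<le> b * of_nat t"
          using 1 a b by (auto intro: mult_left_mono)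
        moreover have "of_nat s = a * of_nat s + b * (of_nat s :: real)"
          "of_nat t = a * of_nat t + b * (of_nat t :: real)"
          using ab by (metis distrib_right mult_1)+
        ultimately have "of_nat s \<le> fst (a *\<^sub>R p + b *\<^sub>R q)" "fst (a *\<^sub>R p + b *\<^sub>R q) \<le> of_nat t"
          by linarith+
        then show ?thesis using True Mab by (simp add: H_def lin)
      next
        case False
        then have "M < g p \<or> M < g q" using gp gq by auto
        then have "a * M < a * g p \<or> b * M < b * g q" using pos by auto
        then have "M < a * g p + b * g q" using pq Mab by linarith
        then show ?thesis by (simp add: H_def lin)
      qed
    qed
  qed
  moreover have "points J u \<subseteq> H"
  proof
    fix p assume "p \<in> points J u"
    then obtain j where j: "j \<in> J" "p = (of_nat j, of_int (u j))" by (auto simp: points_def)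
    have "g p = of_int (height_along lam u j)" using j by (simp add: g_def height_along_def)
    then show "p \<in> H" using side j unfolding side_of_points_def H_def M_def
      by (auto simp: less_le)
  qed
  ultimately have "convex hull (points J u) \<subseteq> H" by (rule hull_minimal[rotated])
  with xy have H: "(x, y) \<in> H" by auto
  then show "of_int (height_along lam u s) \<le> of_int (slope_e lam) * y + of_int (slope_h lam) * x"
    by (auto simp: H_def g_def M_def)
  show "of_nat s \<le> x \<and> x \<le> of_nat t"
    if "of_int (slope_e lam) * y + of_int (slope_h lam) * x = of_int (height_along lam u s)"
    using H that by (auto simp: H_def g_def M_def)
qed

lemma point_on_lower_hull:
  assumes side: "side_of_points lam J u s t" and lam: "lam < 0"
    and xy: "(x, y) \<in> convex hull (points J u)"
    and eq: "of_int (slope_e lam) * y + of_int (slope_h lam) * x = of_int (height_along lam u s)"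
  shows "(x, y) \<in> lower_hull (points J u)"
proof -
  have "y \<le> y'" if "(x, y') \<in> convex hull (points J u)" for y'
  proof -
    have "of_int (slope_e lam) * y \<le> of_int (slope_e lam) * (y' :: real)"
      using lower_hull_side_bounds(1)[OF side lam that] eq by linarith
    then show ?thesis using negative_slope(2)[OF lam] by simp
  qed
  then show ?thesis using xy by (simp add: lower_hull_def)
qed

lemma points_in_hull: "j \<in> J \<Longrightarrow> (of_nat j, of_int (u j)) \<in> convex hull (points J u)"
  by (intro hull_inc) (auto simp: points_def)

lemma side_point_on_lower_hull:
  assumes side: "side_of_points lam J u s t" and lam: "lam < 0"
    and j: "j \<in> J" "height_along lam u j = height_along lam u s"
  shows "(of_nat j, of_int (u j)) \<in> lower_hull (points J u)"
  by (intro point_on_lower_hull[OF side lam] points_in_hull j(1))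
    (simp add: j(2)[symmetric] of_int_height_along)

lemma side_lower_hull:
  assumes side: "side_of_points lam J u s t" and lam: "lam < 0"
  shows "side lam (lower_hull (points J u)) = {(x, y) \<in> lower_hull (points J u).
    of_int (slope_e lam) * y + of_int (slope_h lam) * x = of_int (height_along lam u s)}"
proof -
  define N where "N = lower_hull (points J u)"
  have e: "(0::real) < of_int (slope_e lam)" using negative_slope(2)[OF lam] by simp
  have cmp: "y + \<bar>of_rat lam\<bar> * x \<le> y' + \<bar>of_rat lam\<bar> * x' \<longleftrightarrow>
      of_int (slope_e lam) * y + of_int (slope_h lam) * x
        \<le> of_int (slope_e lam) * y' + of_int (slope_h lam) * x'" for x y x' y' :: real
    proof -
    have *: "e * (y + h / e * x) = e * y + h * x" if "0 < e" for e h y x :: real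
      using that by (simp add: field_simps)
    show ?thesis
      unfolding negative_slope(6)[OF lam] *[OF e, symmetric] using e by simp
  qed
  have hull: "p \<in> N \<Longrightarrow> p \<in> convex hull (points J u)" for p
    by (auto simp: N_def lower_hull_def)
  have s: "(of_nat s, of_int (u s)) \<in> N"
    unfolding N_def using side
    by (intro side_point_on_lower_hull[OF side lam]) (auto simp: side_of_points_def)
  have hs: "of_int (slope_e lam) * of_int (u s) + of_int (slope_h lam) * of_nat s =
      (of_int (height_along lam u s) :: real)"
    by (simp add: height_along_def)
  show ?thesis
    unfolding side_def cmp N_def[symmetric]
  proof (intro set_eqI iffI; clarify)
    fix x y assume xy: "(x, y) \<in> N" and "\<forall>(x', y')\<in>N. of_int (slope_e lam) * y + of_int (slope_h lam) * x
          \<le> of_int (slope_e lam) * y' + of_int (slope_h lam) * x'"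
    then have "of_int (slope_e lam) * y + of_int (slope_h lam) * x
        \<le> of_int (slope_e lam) * of_int (u s) + of_int (slope_h lam) * of_nat s"
      using s by blast
    then show "of_int (slope_e lam) * y + of_int (slope_h lam) * x = of_int (height_along lam u s)"
      using lower_hull_side_bounds(1)[OF side lam hull[OF xy]] hs by linarith
  next
    fix x y x' y' :: real assume "of_int (slope_e lam) * y + of_int (slope_h lam) * x = of_int (height_along lam u s)"
      "(x', y') \<in> N"
    then show "of_int (slope_e lam) * y + of_int (slope_h lam) * x
        \<le> of_int (slope_e lam) * y' + of_int (slope_h lam) * x'"
      using lower_hull_side_bounds(1)[OF side lam hull] by fastforce
  qed
qed

lemma
  assumes side: "side_of_points lam J u s t" and lam: "lam < 0"
  defines "S \<equiv> side lam (lower_hull (points J u))"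
  shows initial_abscissa_side: "initial_abscissa S = of_nat s"
    and side_length_side: "side_length S = of_nat t - of_nat s"
    and ordinate_side:
      "ordinate_at_origin lam S = of_int (height_along lam u s) / of_int (slope_e lam)"
proof -
  have S: "S = {(x, y) \<in> lower_hull (points J u).
    of_int (slope_e lam) * y + of_int (slope_h lam) * x = of_int (height_along lam u s)}"
    unfolding S_def by (rule side_lower_hull[OF side lam])
  have mem: "(of_nat j, of_int (u j)) \<in> S" if "j \<in> J" "height_along lam u j = height_along lam u s" for j
    unfolding S using side_point_on_lower_hull[OF side lam that] that(2)
    by (simp add: that(2)[symmetric] of_int_height_along)
  have s: "(of_nat s, of_int (u s)) \<in> S" and t: "(of_nat t, of_int (u t)) \<in> S"
    using side by (auto simp: side_of_points_def intro!: mem)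
  have bd: "of_nat s \<le> x \<and> x \<le> of_nat t" if "x \<in> fst ` S" for x
    using that lower_hull_side_bounds(2)[OF side lam] by (auto simp: S lower_hull_def)
  have "Inf (fst ` S) = of_nat s"
    using bd s by (intro cInf_eq_minimum) (auto intro: image_eqI[rotated])
  moreover have "Sup (fst ` S) = of_nat t"
    using bd t by (intro cSup_eq_maximum) (auto intro: image_eqI[rotated])
  ultimately show "initial_abscissa S = of_nat s" "side_length S = of_nat t - of_nat s"
    by (simp_all add: initial_abscissa_def side_length_def)
  have e: "(0::real) < of_int (slope_e lam)" using negative_slope(2)[OF lam] by simp
  have lamr: "(of_rat lam :: real) = - of_int (slope_h lam) / of_int (slope_e lam)"
    using negative_slope(5)[OF lam] .
  have line: "y = of_int (height_along lam u s) / of_int (slope_e lam) + of_rat lam * x"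
    if "(x, y) \<in> S" for x y
    using that e unfolding S lamr by (auto simp: field_simps)
  show "ordinate_at_origin lam S = of_int (height_along lam u s) / of_int (slope_e lam)"
    unfolding ordinate_at_origin_def
  proof (rule the_equality)
    show "\<forall>(x, y)\<in>S. y = of_int (height_along lam u s) / of_int (slope_e lam) + of_rat lam * x"
      using line by auto
    fix c assume "\<forall>(x, y)\<in>S. y = c + of_rat lam * x"
    then have "of_int (u s) = c + of_rat lam * of_nat s" using s by blast
    then show "c = of_int (height_along lam u s) / of_int (slope_e lam)"
      using line[OF s] by simp
  qed
qed

text \<open>
  The principal polygon is made up of sides of positive length. It contains \<open>S\<^sub>\<lambda>\<close> also when this is a
  single point, as such a point is the end point of a steeper side or leftmost.
\<close>

lemma steeper_side_exists:
  assumes J: "finite J" and s: "s \<in> J" and j0: "j0 \<in> J" "j0 < s"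
    and left: "\<And>j. j \<in> J \<Longrightarrow> j < s \<Longrightarrow> lam * of_nat s + of_int (u j) - of_int (u s) > lam * of_nat j"
    and right: "\<And>j. j \<in> J \<Longrightarrow> s < j \<Longrightarrow> lam * of_nat s + of_int (u j) - of_int (u s) \<ge> lam * of_nat j"
    and lam: "lam \<le> (0 :: rat)"
  obtains lam' i where "lam' < lam" "side_of_points lam' J u i s" "i < s"
proof -
  \<comment> \<open>\<open>\<mu> j\<close> is the rate of descent from the point at \<open>j\<close>
    to the point at \<open>s\<close>. The smallest rate belongs to the edge of the hull that ends at
    \<open>s\<close>, so \<open>- m\<close> is the slope of that edge.\<close>
  define \<mu> where "\<mu> = (\<lambda>j. of_int (u j - u s) / of_nat (s - j) :: rat)"
  define A where "A = {j\<in>J. j < s}"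
  define m where "m = Min (\<mu> ` A)"
  have A: "finite (\<mu> ` A)" "\<mu> ` A \<noteq> {}" using J j0 by (auto simp: A_def)
  have "m \<in> \<mu> ` A" unfolding m_def by (rule Min_in[OF A])
  then obtain k where k: "k \<in> J" "k < s" "m = \<mu> k" by (auto simp: A_def)
  have lower: "m \<le> \<mu> j" if "j \<in> J" "j < s" for j
    unfolding m_def using A that by (auto simp: A_def)
  have "- lam < \<mu> k"
    using left[OF k(1,2)] k(2) unfolding \<mu>_def by (simp add: field_simps of_nat_diff)
  then have m: "- m < lam" using k(3) by simp
  then have neg: "- m < 0" using lam by simp
  obtain s' t' where st: "side_of_points (- m) J u s' t'"
    using side_of_points_exists[of J "- m" u] J s by blast
  note sl = negative_slope[OF neg]
  have e: "(0::rat) < of_int (slope_e (- m))" using sl(2) by simp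
  have meq: "m = of_int (slope_h (- m)) / of_int (slope_e (- m))"
    using sl(4) by (metis minus_divide_left neg_equal_iff_equal)
  have h: "(of_int (height_along (- m) u j) :: rat) = of_int (slope_e (- m)) * (of_int (u j) + m * of_nat j)" for j
    using e by (subst (3) meq) (simp add: height_along_def field_simps)
  have cmp: "height_along (- m) u s \<le> height_along (- m) u j \<longleftrightarrow>
      of_int (u s) + m * of_nat s \<le> of_int (u j) + m * of_nat j" for j
    unfolding of_int_le_iff[symmetric, where ?'a = rat] h using e by simp
  have cmpeq: "height_along (- m) u s = height_along (- m) u j \<longleftrightarrow>
      of_int (u s) + m * of_nat s = of_int (u j) + m * of_nat j" for j
    unfolding of_int_eq_iff[symmetric, where ?'a = rat] h using e by simp
  have min_l: "height_along (- m) u s \<le> height_along (- m) u j" if "j \<in> J" "j < s" for j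
    using lower[OF that] that(2) unfolding cmp \<mu>_def by (simp add: field_simps of_nat_diff)
  \<comment> \<open>To the right of \<open>s\<close> the points lie on or above the line of slope
    \<open>lam\<close> through the point at \<open>s\<close>, which is there strictly above the
    steeper line of slope \<open>- m\<close>. Hence the side ends exactly at
    \<open>s\<close>.\<close>
  have min_r: "height_along (- m) u s < height_along (- m) u j" if "j \<in> J" "s < j" for j
  proof -
    have "(lam + m) * (of_nat j - of_nat s) > 0" using m that(2) by (intro mult_pos_pos) auto
    then have "of_int (u s) + m * of_nat s < of_int (u j) + m * of_nat j"
      using right[OF that] by (simp add: algebra_simps)
    then show ?thesis using cmp[of j] cmpeq[of j] by linarith
  qed
  have ks: "height_along (- m) u k = height_along (- m) u s"
  proof -
    have "m * (of_nat s - of_nat k) = of_int (u k) - of_int (u s)"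
      using k(2,3) unfolding \<mu>_def by (simp add: of_nat_diff)
    then have "of_int (u s) + m * of_nat s = of_int (u k) + m * of_nat k"
      by (simp add: algebra_simps)
    then show ?thesis using cmpeq[of k] by simp
  qed
  have min: "height_along (- m) u s \<le> height_along (- m) u j" if "j \<in> J" for j
    using min_l[OF that] min_r[OF that] by (cases j s rule: linorder_cases) auto
  have s's: "height_along (- m) u s' = height_along (- m) u s"
    using st min s unfolding side_of_points_def by (metis order_antisym)
  then have "s \<le> t'" "s' \<le> k" using st s k ks unfolding side_of_points_def by auto
  moreover have "t' \<le> s"
    using min_r[of t'] st s's unfolding side_of_points_def by (metis less_irrefl not_le)
  ultimately have "t' = s" "s' < s" using k by auto
  then show ?thesis using that st m by blast
qed

lemma side_subset_negative_part:
  assumes J: "finite J" and side: "side_of_points lam J u s t" and lam: "lam < 0"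
  shows "side lam (lower_hull (points J u)) \<subseteq> negative_part (lower_hull (points J u))"
proof -
  define N where "N = lower_hull (points J u)"
  note sl = negative_slope[OF lam]
  have st: "s \<in> J" "t \<in> J" using side by (auto simp: side_of_points_def)
  show ?thesis
  proof (cases "s < t")
    case True
    then have "0 < side_length (side lam N)"
      unfolding N_def side_length_side[OF side lam] by simp
    then show ?thesis using lam unfolding N_def negative_part_def by blast
  next
    case False
    then have "t = s" using side by (force simp: side_of_points_def)
    then have side': "side_of_points lam J u s s" using side by simp
    have single: "side lam N \<subseteq> {(of_nat s, of_int (u s))}"
    proof
      fix p assume "p \<in> side lam N"
      then obtain x y where p: "p = (x, y)" "(x, y) \<in> convex hull (points J u)"
        and eq: "of_int (slope_e lam) * y + of_int (slope_h lam) * x = of_int (height_along lam u s)"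
        unfolding N_def side_lower_hull[OF side lam] by (auto simp: lower_hull_def)
      have x: "x = of_nat s"
        using lower_hull_side_bounds(2)[OF side' lam p(2) eq] by simp
      have "of_int (slope_e lam) * y = of_int (slope_e lam) * (of_int (u s) :: real)"
        using eq unfolding x of_int_height_along by linarith
      then show "p \<in> {(of_nat s, of_int (u s))}" using x sl(2) p(1) by simp
    qed
    have pt: "(of_nat s, of_int (u s)) \<in> N"
      unfolding N_def by (rule side_point_on_lower_hull[OF side lam st(1) refl])
    have "(of_nat s, of_int (u s)) \<in> negative_part N"
    proof (cases "\<exists>j0\<in>J. j0 < s")
      case False
      have "convex hull (points J u) \<subseteq> {p. of_nat s \<le> fst p}"
      proof (rule hull_minimal)
        show "points J u \<subseteq> {p. of_nat s \<le> fst p}"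
          using False by (auto simp: points_def not_less)
        show "convex {p :: real \<times> real. of_nat s \<le> fst p}"
          using convex_halfspace_ge[of "of_nat s" "(1, 0) :: real \<times> real"]
          by (simp add: inner_prod_def)
      qed
      then have "\<forall>(x', y')\<in>N. of_nat s \<le> x'"
        by (auto simp: N_def lower_hull_def)
      then show ?thesis using pt unfolding negative_part_def by auto
    next
      case True
      then obtain j0 where j0: "j0 \<in> J" "j0 < s" by blast
      have e: "(0::rat) < of_int (slope_e lam)" using sl(2) by simp
      have leq: "lam = - of_int (slope_h lam) / of_int (slope_e lam)" by (rule sl(4))
      have *: "of_int (height_along lam u j) = of_int (slope_e lam) * (of_int (u j) - lam * of_nat j)" for j
        using e by (subst (3) leq) (simp add: of_int_height_along field_simps)
      have cmp: "height_along lam u s < height_along lam u j \<longleftrightarrow>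
          of_int (u s) - lam * of_nat s < of_int (u j) - lam * of_nat j" for j
        unfolding of_int_less_iff[symmetric, where ?'a = rat] * using e by simp
      have gt: "height_along lam u s < height_along lam u j" if "j \<in> J" "j \<noteq> s" for j
        using side' that unfolding side_of_points_def by force
      obtain lam' i where lam': "lam' < lam" "side_of_points lam' J u i s" "i < s"
      proof (rule steeper_side_exists[of J s j0 lam u])
        fix j assume "j \<in> J" "j < s"
        then show "lam * of_nat j < lam * of_nat s + of_int (u j) - of_int (u s)"
          using gt[of j] cmp[of j] by linarith
      next
        fix j assume "j \<in> J" "s < j"
        then show "lam * of_nat j \<le> lam * of_nat s + of_int (u j) - of_int (u s)"
          using gt[of j] cmp[of j] by linarith
      qed (use J st j0 lam in auto)
      have neg': "lam' < 0" using lam'(1) lam by simp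
      have "(of_nat s, of_int (u s)) \<in> side lam' N"
        unfolding N_def side_lower_hull[OF lam'(2) neg']
        using pt[unfolded N_def] lam'(2)
        by (simp add: side_of_points_def flip: of_int_height_along)
      moreover have "0 < side_length (side lam' N)"
        unfolding N_def side_length_side[OF lam'(2) neg'] using lam'(3) by simp
      ultimately show ?thesis using neg' unfolding negative_part_def by blast
    qed
    then show ?thesis using single unfolding N_def by blast
  qed
qed

lemma negative_part_subset: "negative_part N \<subseteq> N"
  by (auto simp: negative_part_def side_def)

text \<open>A subset of the polygon that still contains all minimisers of \<open>y + |lam| x\<close>
  has the same minimisers.\<close>

lemma side_negative_part:
  assumes J: "finite J" and side: "side_of_points lam J u s t" and lam: "lam < 0"
  shows "side lam (negative_part (lower_hull (points J u))) = side lam (lower_hull (points J u))"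
proof -
  define N where "N = lower_hull (points J u)"
  have st: "s \<in> J" using side by (auto simp: side_of_points_def)
  have "(of_nat s, of_int (u s)) \<in> side lam N"
    using side_point_on_lower_hull[OF side lam st refl]
    unfolding N_def side_lower_hull[OF side lam] by (simp flip: of_int_height_along)
  then have ne: "side lam N \<noteq> {}" by blast
  have sub: "side lam N \<subseteq> negative_part N"
    unfolding N_def by (rule side_subset_negative_part[OF J side lam])
  have "side lam A = side lam N" if "side lam N \<subseteq> A" "A \<subseteq> N" for A
  proof -
    obtain a b where ab: "(a, b) \<in> side lam N" using ne by auto
    then have ab': "(a, b) \<in> A" using that by auto
    have min: "b + \<bar>of_rat lam\<bar> * a \<le> y + \<bar>of_rat lam\<bar> * x" if "(x, y) \<in> N" for x y
      using ab that by (auto simp: side_def)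
    show ?thesis
    proof (intro equalityI subsetI)
      fix q assume q: "q \<in> side lam A"
      then obtain x y where xy: "q = (x, y)" "(x, y) \<in> A" "y + \<bar>of_rat lam\<bar> * x \<le> b + \<bar>of_rat lam\<bar> * a"
        using ab' by (auto simp: side_def)
      then show "q \<in> side lam N"
        using that(2) min unfolding side_def by fastforce
    next
      fix q assume "q \<in> side lam N"
      then show "q \<in> side lam A" using that by (auto simp: side_def)
    qed
  qed
  from this[OF sub negative_part_subset] show ?thesis by (simp add: N_def)
qed

text \<open>Over \<open>[s, t]\<close> the chord between the two ends bounds the lower hull from
  above, so a point of the polygon cannot be higher than the side. This turns the geometric test in
  the definition of the residual coefficients into an equality of integers.\<close>

lemma point_on_negative_part_iff:
  assumes J: "finite J" and side: "side_of_points lam J u s t" and lam: "lam < 0"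
    and j: "j \<in> J" "s \<le> j" "j \<le> t"
  shows "(of_nat j, of_int (u j)) \<in> negative_part (lower_hull (points J u)) \<longleftrightarrow>
    height_along lam u j = height_along lam u s"
proof
  assume eq: "height_along lam u j = height_along lam u s"
  have "(of_nat j, of_int (u j)) \<in> side lam (lower_hull (points J u))"
    using side_point_on_lower_hull[OF side lam j(1) eq]
    unfolding side_lower_hull[OF side lam] by (simp flip: of_int_height_along add: eq)
  then show "(of_nat j, of_int (u j)) \<in> negative_part (lower_hull (points J u))"
    using side_subset_negative_part[OF J side lam] by blast
next
  assume "(of_nat j, of_int (u j)) \<in> negative_part (lower_hull (points J u))"
  then have low: "(of_nat j, y') \<in> convex hull (points J u) \<Longrightarrow> of_int (u j) \<le> y'" for y'
    using negative_part_subset by (fastforce simp: lower_hull_def)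
  have st: "s \<in> J" "t \<in> J" "height_along lam u t = height_along lam u s"
    "height_along lam u s \<le> height_along lam u j"
    using side j(1) by (auto simp: side_of_points_def)
  have "height_along lam u j \<le> height_along lam u s"
  proof (cases "s = t")
    case True
    then show ?thesis using j by auto
  next
    case False
    then have "s < t" using j by simp
    define c :: real where "c = (of_nat j - of_nat s) / (of_nat t - of_nat s)"
    have c: "0 \<le> c" "c \<le> 1"
      using j \<open>s < t\<close> by (auto simp: c_def field_simps)
    have "c * (of_nat t - of_nat s) = of_nat j - of_nat s"
      using \<open>s < t\<close> by (simp add: c_def)
    then have cj: "(1 - c) * of_nat s + c * of_nat t = of_nat j"
      by (simp add: algebra_simps)
    define y where "y = (1 - c) * of_int (u s) + c * of_int (u t)"
    have "(1 - c) *\<^sub>R (of_nat s, of_int (u s)) + c *\<^sub>R (of_nat t, of_int (u t)) \<in> convex hull (points J u)"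
      using c st by (intro convexD convex_convex_hull points_in_hull) auto
    then have y: "(of_nat j, y) \<in> convex hull (points J u)"
      using cj by (simp add: y_def)
    have *: "of_int (slope_e lam) * y + of_int (slope_h lam) * of_nat j =
        (1 - c) * of_int (height_along lam u s) + c * of_int (height_along lam u t)"
      unfolding y_def of_int_height_along cj[symmetric] by (simp add: algebra_simps)
    have "of_int (slope_e lam) * of_int (u j) \<le> of_int (slope_e lam) * y"
      using low[OF y] negative_slope(2)[OF lam] by simp
    then have "(of_int (height_along lam u j) :: real) \<le> of_int (height_along lam u s)"
      using * unfolding of_int_height_along[of lam u j] st(3) by (simp add: algebra_simps)
    then show ?thesis by simp
  qed
  then show "height_along lam u j = height_along lam u s" using st by simp
qed

text \<open>The vertical slice of the hull over \<open>j\<close> is compact and nonempty, so it has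
  a lowest point, which belongs to the lower hull. If the lower hull is a single side, this point
  lies between the ends of the side.\<close>

lemma single_side_bounds:
  assumes J: "finite J" and side: "side_of_points lam J u s t" and lam: "lam < 0"
    and single: "lower_hull (points J u) = side lam (lower_hull (points J u))"
    and j: "j \<in> J"
  shows "s \<le> j \<and> j \<le> t"
proof -
  have fin: "finite (points J u)"
    using J by (simp add: points_def setcompr_eq_image)
  define Y where "Y = snd ` (convex hull (points J u) \<inter> {p. fst p = of_nat j})"
  have Y: "y' \<in> Y \<longleftrightarrow> (of_nat j, y') \<in> convex hull (points J u)" for y'
    unfolding Y_def by (auto simp: image_iff Bex_def)
  have "closed {p :: real \<times> real. fst p = of_nat j}"
    by (intro closed_Collect_eq continuous_intros)
  then have "compact Y"
    unfolding Y_def using finite_imp_compact_convex_hull[OF fin]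
    by (intro compact_continuous_image continuous_intros compact_Int_closed) auto
  moreover have "of_int (u j) \<in> Y"
    unfolding Y by (rule points_in_hull[OF j])
  ultimately obtain y where y: "y \<in> Y" "\<forall>y'\<in>Y. y \<le> y'"
    using compact_attains_inf by blast
  have "(of_nat j, y) \<in> lower_hull (points J u)"
  proof -
    show ?thesis using y Y unfolding lower_hull_def by auto
  qed
  then have *: "(of_nat j, y) \<in> side lam (lower_hull (points J u))" using single by blast
  then have "of_nat s \<le> (of_nat j :: real) \<and> of_nat j \<le> (of_nat t :: real)"
    unfolding side_lower_hull[OF side lam]
    by (intro lower_hull_side_bounds(2)[OF side lam, of _ y]) (auto simp: lower_hull_def)
  then show ?thesis by simp
qed

section \<open>Augmentation of a valuation with residual polynomials\<close>

definition adic_support :: "'a::field poly \<Rightarrow> 'a poly \<Rightarrow> nat set" where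
  "adic_support \<phi> P = {j. adic_coeff \<phi> P j \<noteq> 0}"

lemma adic_coeff_0 [simp]: "adic_coeff \<phi> 0 j = 0"
  by (simp add: adic_coeff_def)

lemma adic_coeff_add: "adic_coeff \<phi> (P + Q) j = adic_coeff \<phi> P j + adic_coeff \<phi> Q j"
  by (simp add: adic_coeff_def poly_div_add_left poly_mod_add_left)

lemma degree_adic_coeff:
  "0 < degree \<phi> \<Longrightarrow> adic_coeff \<phi> P j = 0 \<or> degree (adic_coeff \<phi> P j) < degree \<phi>"
  by (rule adic_development(2))

lemma adic_coeff_monomial:
  fixes \<phi> a :: "'a::field poly"
  assumes "0 < degree \<phi>" "a = 0 \<or> degree a < degree \<phi>"
  shows "adic_coeff \<phi> (a * \<phi> ^ i) j = (if i = j then a else 0)"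
proof -
  have \<phi>: "\<phi> \<noteq> 0" using assms(1) by auto
  have a: "a div \<phi> = 0" "a mod \<phi> = a"
    using assms by (auto simp: div_poly_less mod_poly_less)
  consider "i = j" | "i < j" | "j < i" by linarith
  then show ?thesis
  proof cases
    case 1
    then show ?thesis using \<phi> a by (simp add: adic_coeff_def)
  next
    case 2
    then have "j = i + Suc (j - i - 1)" by simp
    then have "\<phi> ^ j = \<phi> ^ i * (\<phi> * \<phi> ^ (j - i - 1))"
      by (metis power_Suc power_add)
    then have "(a * \<phi> ^ i) div \<phi> ^ j = a div (\<phi> * \<phi> ^ (j - i - 1))"
      using \<phi> by (simp add: mult.commute)
    also have "\<dots> = 0"
      using a(1) by (simp add: poly_div_mult_right)
    finally show ?thesis using 2 by (simp add: adic_coeff_def)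
  next
    case 3
    then have "i = j + Suc (i - j - 1)" by simp
    then have "\<phi> ^ i = \<phi> ^ j * (\<phi> * \<phi> ^ (i - j - 1))"
      by (metis power_Suc power_add)
    then have "(a * \<phi> ^ i) div \<phi> ^ j = a * (\<phi> * \<phi> ^ (i - j - 1))"
      using \<phi> by (simp add: mult.left_commute)
    then show ?thesis using 3 by (simp add: adic_coeff_def)
  qed
qed

lemma adic_support_subset:
  assumes "0 < degree \<phi>"
  shows "adic_support \<phi> P \<subseteq> {..degree P}"
proof
  fix j assume "j \<in> adic_support \<phi> P"
  then have "P div \<phi> ^ j \<noteq> 0" by (auto simp: adic_support_def adic_coeff_def)
  then have "degree (\<phi> ^ j) \<le> degree P" using div_poly_less by (metis not_le)
  moreover have "degree (\<phi> ^ j) = j * degree \<phi>"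
    using assms by (intro degree_power_eq) auto
  ultimately have "j * 1 \<le> degree P"
    using assms by (metis Suc_leI mult_le_mono2 One_nat_def order_trans)
  then show "j \<in> {..degree P}" by simp
qed

lemma adic_support_degree:
  assumes "0 < degree \<phi>" "j \<in> adic_support \<phi> P"
  shows "j * degree \<phi> \<le> degree P"
proof -
  have "P div \<phi> ^ j \<noteq> 0" using assms(2) by (auto simp: adic_support_def adic_coeff_def)
  then have "degree (\<phi> ^ j) \<le> degree P" using div_poly_less by (metis not_le)
  moreover have "degree (\<phi> ^ j) = j * degree \<phi>"
    using assms by (intro degree_power_eq) auto
  ultimately show ?thesis by simp
qed

lemma finite_adic_support: "0 < degree \<phi> \<Longrightarrow> finite (adic_support \<phi> P)"
  using adic_support_subset finite_subset by blast

lemma adic_expansion: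
  assumes "0 < degree \<phi>"
  shows "P = (\<Sum>j\<in>adic_support \<phi> P. adic_coeff \<phi> P j * \<phi> ^ j)"
proof -
  have "P = (\<Sum>j\<le>degree P. adic_coeff \<phi> P j * \<phi> ^ j)"
    by (rule adic_development(1)[OF assms(1)])
  also have "\<dots> = (\<Sum>j\<in>adic_support \<phi> P. adic_coeff \<phi> P j * \<phi> ^ j)"
    using assms adic_support_subset[OF assms(1), of P]
    by (intro sum.mono_neutral_right) (auto simp: adic_support_def)
  finally show ?thesis .
qed

lemma adic_support_nonempty:
  assumes "0 < degree \<phi>" "P \<noteq> 0"
  shows "adic_support \<phi> P \<noteq> {}"
  using adic_expansion[OF assms(1), of P] assms(2) by auto

lemma adic_support_monomial:
  fixes \<phi> a :: "'a::field poly"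
  assumes "0 < degree \<phi>" "a \<noteq> 0" "degree a < degree \<phi>"
  shows "adic_support \<phi> (a * \<phi> ^ i) = {i}"
  using assms by (auto simp: adic_support_def adic_coeff_monomial)

text \<open>The filtration defined by \<open>w\<close>. Zero belongs to every step of it; this
  replaces the value infinity, which an integer-valued \<open>w\<close> cannot take.\<close>

definition above :: "('a::zero \<Rightarrow> int) \<Rightarrow> int \<Rightarrow> 'a \<Rightarrow> bool" where
  "above w \<alpha> P \<longleftrightarrow> P = 0 \<or> \<alpha> \<le> w P"

text \<open>For \<open>above w \<alpha> P\<close> this is the image of the class of \<open>P\<close>
  in the graded piece of degree \<alpha>. Outside that range it is a mere default, and additivity is
  claimed only inside it.\<close>

definition component :: "('a::zero \<Rightarrow> int) \<Rightarrow> ('a \<Rightarrow> 'b::zero) \<Rightarrow> int \<Rightarrow> 'a \<Rightarrow> 'b" where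
  "component w \<rho> \<alpha> P = (if P \<noteq> 0 \<and> w P = \<alpha> then \<rho> P else 0)"

text \<open>
  \<open>\<rho>\<close> is a ring homomorphism from the graded ring of the valuation \<open>w\<close> to a field, evaluated at the
  initial forms of the elements.
\<close>

locale graded =
  fixes w :: "'a::field poly \<Rightarrow> int" and \<rho> :: "'a poly \<Rightarrow> 'b::field"
  assumes w_mult: "P \<noteq> 0 \<Longrightarrow> Q \<noteq> 0 \<Longrightarrow> w (P * Q) = w P + w Q"
    and w_add: "P \<noteq> 0 \<Longrightarrow> Q \<noteq> 0 \<Longrightarrow> P + Q \<noteq> 0 \<Longrightarrow> min (w P) (w Q) \<le> w (P + Q)"
    and rho_zero: "\<rho> 0 = 0"
    and rho_mult: "\<rho> (P * Q) = \<rho> P * \<rho> Q"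
    and rho_add: "above w \<alpha> P \<Longrightarrow> above w \<alpha> Q \<Longrightarrow>
      component w \<rho> \<alpha> (P + Q) = component w \<rho> \<alpha> P + component w \<rho> \<alpha> Q"
begin

lemma above_add: "above w \<alpha> P \<Longrightarrow> above w \<alpha> Q \<Longrightarrow> above w \<alpha> (P + Q)"
  using w_add[of P Q] by (cases "P = 0"; cases "Q = 0"; cases "P + Q = 0") (auto simp: above_def)

lemma above_sum: "(\<And>i. i \<in> A \<Longrightarrow> above w \<alpha> (g i)) \<Longrightarrow> above w \<alpha> (sum g A)"
  by (induction A rule: infinite_finite_induct) (auto simp: above_add, auto simp: above_def)

lemma component_sum:
  "(\<And>i. i \<in> A \<Longrightarrow> above w \<alpha> (g i)) \<Longrightarrow>
    component w \<rho> \<alpha> (sum g A) = (\<Sum>i\<in>A. component w \<rho> \<alpha> (g i))"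
  by (induction A rule: infinite_finite_induct)
    (auto simp: rho_add above_sum, auto simp: component_def)

lemma above_mult: "above w \<alpha> P \<Longrightarrow> above w \<beta> Q \<Longrightarrow> above w (\<alpha> + \<beta>) (P * Q)"
  using w_mult[of P Q] by (cases "P = 0"; cases "Q = 0") (auto simp: above_def)

lemma w_one: "w 1 = 0"
  using w_mult[of 1 1] by simp

lemma w_power: "P \<noteq> 0 \<Longrightarrow> w (P ^ n) = int n * w P"
  by (induction n) (auto simp: w_one w_mult algebra_simps)

lemma w_uminus: "P \<noteq> 0 \<Longrightarrow> w (- P) = w P"
proof -
  assume P: "P \<noteq> 0"
  have "w (- 1) = 0" using w_mult[of "- 1" "- 1"] w_one by simp
  then show ?thesis using w_mult[of "- 1" P] P by simp
qed

lemma above_uminus: "above w \<alpha> (- P) \<longleftrightarrow> above w \<alpha> P"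
  by (cases "P = 0") (auto simp: above_def w_uminus)

end

text \<open>One step from a valuation to the next. In the application \<open>w\<close> is
  \<open>v_{i+1}\<close>, \<phi> is the key polynomial of degree \<open>m_{i+1}\<close>, and \<rho>
  evaluates twisted residual polynomials of order \<open>i\<close> at \<open>z_i\<close>. The unit
  \<eta> reconciles two normalisations of the residual coefficients, by the ordinates and by the
  values of the coefficients of the development.\<close>

locale augmentation = graded w \<rho>
  for w :: "'a::field poly \<Rightarrow> int" and \<rho> :: "'a poly \<Rightarrow> 'b::alg_closed_field" +
  fixes \<phi> :: "'a poly" and lam :: rat and l :: int and \<eta> :: 'b
  assumes deg: "0 < degree \<phi>"
    and rho_nonzero: "a \<noteq> 0 \<Longrightarrow> degree a < degree \<phi> \<Longrightarrow> \<rho> a \<noteq> 0"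
    and rho_phi: "\<rho> \<phi> = 0"
    and lam: "lam < 0"
    and l: "\<exists>l'. l * slope_h lam - l' * slope_e lam = 1"
    and eta: "\<eta> \<noteq> 0"
begin

abbreviation "e \<equiv> slope_e lam"
abbreviation "h \<equiv> slope_h lam"
abbreviation "coef \<equiv> adic_coeff \<phi>"
abbreviation "supp \<equiv> adic_support \<phi>"

definition u :: "'a poly \<Rightarrow> nat \<Rightarrow> int" where
  "u P j = w (coef P j * \<phi> ^ j)"

definition aw :: "'a poly \<Rightarrow> int" where
  "aw P = Min (height_along lam (u P) ` supp P)"

text \<open>The power of \<open>x\<close> attached to abscissa \<open>j\<close> on the line of
  height \<alpha>. If \<open>e a + h j = \<alpha>\<close>, then \<open>l h - l' e = 1\<close> gives
  \<open>j - l \<alpha> = - e (l a + l' j)\<close>: the division is exact on lattice points of the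
  line, and the exponent is additive in the pair of \<alpha> and \<open>j\<close>. This additivity
  makes the twisted sums multiplicative.\<close>

definition expo :: "int \<Rightarrow> nat \<Rightarrow> int" where
  "expo \<alpha> j = (int j - l * \<alpha>) div e"

text \<open>The class of \<open>P\<close> in degree \<alpha> is a Laurent polynomial in one
  variable. Only its value at \<open>x\<close> is kept, so that sums and products become identities
  in a field.\<close>

definition acomp :: "'b \<Rightarrow> int \<Rightarrow> 'a poly \<Rightarrow> 'b" where
  "acomp x \<alpha> P = (\<Sum>j\<in>{j \<in> supp P. height_along lam (u P) j = \<alpha>}.
     \<eta> ^ j * \<rho> (coef P j) * x powi expo \<alpha> j)"

definition aT :: "'b \<Rightarrow> 'a poly \<Rightarrow> 'b" where
  "aT x P = (if P = 0 then 0 else acomp x (aw P) P)"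

lemma e_pos: "0 < e" and h_pos: "0 < h"
  using negative_slope[OF lam] by auto

lemma phi_nonzero: "\<phi> \<noteq> 0"
  using deg by auto

lemma u_eq: "j \<in> supp P \<Longrightarrow> u P j = w (coef P j) + int j * w \<phi>"
  by (simp add: u_def adic_support_def w_mult phi_nonzero w_power)

lemma expo_exact: "e * a + h * int j = \<alpha> \<Longrightarrow> e * expo \<alpha> j = int j - l * \<alpha>"
proof -
  assume \<alpha>: "e * a + h * int j = \<alpha>"
  obtain l' where l': "l * h - l' * e = 1" using l by blast
  have "int j - l * \<alpha> = e * (- (l * a) - l' * int j) + int j * (1 - (l * h - l' * e))"
    unfolding \<alpha>[symmetric] by (simp add: algebra_simps)
  also have "\<dots> = e * (- (l * a) - l' * int j)" using l' by simp
  finally show ?thesis by (simp add: expo_def)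
qed

lemma expo_add:
  assumes "e * a + h * int i = \<alpha>" "e * b + h * int j = \<beta>"
  shows "expo (\<alpha> + \<beta>) (i + j) = expo \<alpha> i + expo \<beta> j"
proof -
  have "e * (a + b) + h * int (i + j) = \<alpha> + \<beta>" using assms by (simp add: algebra_simps)
  from expo_exact[OF this] expo_exact[OF assms(1)] expo_exact[OF assms(2)]
  have "e * expo (\<alpha> + \<beta>) (i + j) = e * (expo \<alpha> i + expo \<beta> j)" by (simp add: algebra_simps)
  then show ?thesis using e_pos by simp
qed

lemma aw_side:
  assumes "P \<noteq> 0" "side_of_points lam (supp P) (u P) s t"
  shows "aw P = height_along lam (u P) s"
  unfolding aw_def using assms finite_adic_support[OF deg]
  by (intro Min_eqI) (auto simp: side_of_points_def)

lemma above_aw_iff: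
  "above aw \<alpha> P \<longleftrightarrow> (\<forall>j\<in>supp P. \<alpha> \<le> height_along lam (u P) j)"
proof (cases "P = 0")
  case True
  then show ?thesis by (simp add: above_def adic_support_def)
next
  case False
  then show ?thesis
    using finite_adic_support[OF deg] adic_support_nonempty[OF deg False]
    by (simp add: above_def aw_def)
qed

lemma component_aw:
  assumes "above aw \<alpha> P"
  shows "component aw (aT x) \<alpha> P = acomp x \<alpha> P"
proof (cases "P = 0 \<or> aw P = \<alpha>")
  case True
  then show ?thesis by (auto simp: component_def aT_def acomp_def adic_support_def)
next
  case False
  have "height_along lam (u P) j \<noteq> \<alpha>" if "j \<in> supp P" for j
  proof -
    have "aw P \<le> height_along lam (u P) j"
      unfolding aw_def using that finite_adic_support[OF deg] by auto
    then show ?thesis using False assms by (auto simp: above_def)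
  qed
  then have none: "{j \<in> supp P. height_along lam (u P) j = \<alpha>} = {}" by auto
  show ?thesis using False unfolding component_def acomp_def none by simp
qed

definition mono_comp :: "'b \<Rightarrow> int \<Rightarrow> nat \<Rightarrow> 'a poly \<Rightarrow> 'b" where
  "mono_comp x \<alpha> j a = (if a \<noteq> 0 \<and> e * (w a + int j * w \<phi>) + h * int j = \<alpha>
     then \<eta> ^ j * \<rho> a * x powi expo \<alpha> j else 0)"

text \<open>For fixed \<open>j\<close> the height \<alpha> prescribes the value \<beta> of the
  coefficient, because \<open>e > 0\<close>; so this is additivity of \<rho> in degree \<beta>. If
  no \<beta> fits, both sides vanish.\<close>

lemma mono_comp_add:
  assumes "a \<noteq> 0 \<Longrightarrow> \<alpha> \<le> e * (w a + int j * w \<phi>) + h * int j"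
    and "b \<noteq> 0 \<Longrightarrow> \<alpha> \<le> e * (w b + int j * w \<phi>) + h * int j"
  shows "mono_comp x \<alpha> j (a + b) = mono_comp x \<alpha> j a + mono_comp x \<alpha> j b"
proof (cases "\<exists>\<beta>. e * (\<beta> + int j * w \<phi>) + h * int j = \<alpha>")
  case True
  then obtain \<beta> where \<beta>: "e * (\<beta> + int j * w \<phi>) + h * int j = \<alpha>" by blast
  have iff: "e * (\<gamma> + int j * w \<phi>) + h * int j = \<alpha> \<longleftrightarrow> \<gamma> = \<beta>"
    "\<alpha> \<le> e * (\<gamma> + int j * w \<phi>) + h * int j \<longleftrightarrow> \<beta> \<le> \<gamma>" for \<gamma>
    using \<beta> e_pos by auto
  have "mono_comp x \<alpha> j c = \<eta> ^ j * component w \<rho> \<beta> c * x powi expo \<alpha> j" for c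
    by (simp add: mono_comp_def component_def iff)
  moreover have "above w \<beta> a" "above w \<beta> b"
    using assms by (auto simp: above_def iff)
  ultimately show ?thesis by (simp add: rho_add algebra_simps)
qed (auto simp: mono_comp_def)

lemma height_along_u:
  "j \<in> supp P \<Longrightarrow> height_along lam (u P) j = e * (w (coef P j) + int j * w \<phi>) + h * int j"
  by (simp add: height_along_def u_eq)

lemma acomp_eq:
  assumes "supp P \<subseteq> A" "finite A"
  shows "acomp x \<alpha> P = (\<Sum>j\<in>A. mono_comp x \<alpha> j (coef P j))"
proof -
  have "acomp x \<alpha> P = (\<Sum>j\<in>{j \<in> supp P. height_along lam (u P) j = \<alpha>}. mono_comp x \<alpha> j (coef P j))"
    unfolding acomp_def by (intro sum.cong) (auto simp: mono_comp_def adic_support_def height_along_u)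
  also have "\<dots> = (\<Sum>j\<in>A. mono_comp x \<alpha> j (coef P j))"
    using assms by (intro sum.mono_neutral_left) (auto simp: mono_comp_def adic_support_def height_along_u)
  finally show ?thesis .
qed

lemma above_aw_iff':
  "above aw \<alpha> P \<longleftrightarrow> (\<forall>j. coef P j \<noteq> 0 \<longrightarrow> \<alpha> \<le> e * (w (coef P j) + int j * w \<phi>) + h * int j)"
  unfolding above_aw_iff by (metis (mono_tags, lifting) adic_support_def height_along_u mem_Collect_eq)

lemma acomp_add:
  assumes P: "above aw \<alpha> P" and Q: "above aw \<alpha> Q"
  shows "above aw \<alpha> (P + Q)" "acomp x \<alpha> (P + Q) = acomp x \<alpha> P + acomp x \<alpha> Q"
proof -
  have le: "\<alpha> \<le> e * (w (coef P j + coef Q j) + int j * w \<phi>) + h * int j"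
    if nz: "coef P j + coef Q j \<noteq> 0" for j
  proof -
    consider "coef P j = 0" | "coef Q j = 0" | "coef P j \<noteq> 0" "coef Q j \<noteq> 0" by blast
    then show ?thesis
    proof cases
      case 3
      then have "w (coef P j) \<le> w (coef P j + coef Q j) \<or> w (coef Q j) \<le> w (coef P j + coef Q j)"
        using w_add[OF 3 nz] by linarith
      then have "e * (w (coef P j) + int j * w \<phi>) \<le> e * (w (coef P j + coef Q j) + int j * w \<phi>) \<or>
          e * (w (coef Q j) + int j * w \<phi>) \<le> e * (w (coef P j + coef Q j) + int j * w \<phi>)"
        using e_pos by auto
      moreover have "\<alpha> \<le> e * (w (coef P j) + int j * w \<phi>) + h * int j"
        "\<alpha> \<le> e * (w (coef Q j) + int j * w \<phi>) + h * int j"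
        using P Q 3 unfolding above_aw_iff' by auto
      ultimately show ?thesis by linarith
    qed (use P[unfolded above_aw_iff'] Q[unfolded above_aw_iff'] nz in auto)
  qed
  show "above aw \<alpha> (P + Q)"
    unfolding above_aw_iff' adic_coeff_add using le by blast
  define A where "A = supp P \<union> supp Q"
  have A: "finite A" by (simp add: A_def finite_adic_support[OF deg])
  have "supp (P + Q) \<subseteq> A"
    by (auto simp: A_def adic_support_def adic_coeff_add)
  then have "acomp x \<alpha> (P + Q) = (\<Sum>j\<in>A. mono_comp x \<alpha> j (coef P j + coef Q j))"
    using acomp_eq A by (simp add: adic_coeff_add)
  also have "\<dots> = (\<Sum>j\<in>A. mono_comp x \<alpha> j (coef P j) + mono_comp x \<alpha> j (coef Q j))"
    using P Q unfolding above_aw_iff' by (intro sum.cong mono_comp_add) auto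
  also have "\<dots> = acomp x \<alpha> P + acomp x \<alpha> Q"
    using A by (simp add: sum.distrib acomp_eq[of _ A] A_def)
  finally show "acomp x \<alpha> (P + Q) = acomp x \<alpha> P + acomp x \<alpha> Q" .
qed

lemma acomp_zero: "above aw \<alpha> 0" "acomp x \<alpha> 0 = 0"
  by (simp_all add: above_def acomp_def adic_support_def)

lemma acomp_sum:
  "(\<And>i. i \<in> A \<Longrightarrow> above aw \<alpha> (g i)) \<Longrightarrow>
    above aw \<alpha> (sum g A) \<and> acomp x \<alpha> (sum g A) = (\<Sum>i\<in>A. acomp x \<alpha> (g i))"
  by (induction A rule: infinite_finite_induct) (auto simp: acomp_zero acomp_add)

text \<open>
  Key property of \<open>\<phi>\<close>: since \<open>\<rho>\<close> kills \<open>\<phi>\<close> but no nonzero polynomial of smaller degree, reduction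
  modulo \<open>\<phi>\<close> of a product of two of the latter does not change its initial form.
\<close>

lemma product_mod_phi:
  assumes a: "a \<noteq> 0" "degree a < degree \<phi>" and b: "b \<noteq> 0" "degree b < degree \<phi>"
  defines "q \<equiv> (a * b) div \<phi>" and "r \<equiv> (a * b) mod \<phi>"
  shows "r \<noteq> 0" "w r = w a + w b" "\<rho> r = \<rho> a * \<rho> b" "q \<noteq> 0 \<Longrightarrow> w a + w b \<le> w q + w \<phi>"
    "degree r < degree \<phi>" "degree q < degree \<phi>"
proof -
  have ab: "a * b = q * \<phi> + r" by (simp add: q_def r_def)
  have ab0: "a * b \<noteq> 0" using a b by simp
  have rhoab: "\<rho> (a * b) \<noteq> 0" using a b rho_nonzero by (simp add: rho_mult)
  have wab: "w (a * b) = w a + w b" using a b by (simp add: w_mult)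
  have rhoq: "\<rho> (q * \<phi>) = 0" by (simp add: rho_mult rho_phi)
  show r0: "r \<noteq> 0"
    using ab rhoab rhoq by auto
  show degr: "degree r < degree \<phi>"
    using degree_mod_less[OF phi_nonzero, of "a * b"] r0 by (simp add: r_def)
  have rhor: "\<rho> r \<noteq> 0" using rho_nonzero r0 degr by blast
  \<comment> \<open>If \<open>q * \<phi>\<close> had a smaller value than \<open>a * b\<close>, the
    initial forms of \<open>q * \<phi>\<close> and \<open>r\<close> would cancel. But \<rho> kills
    the first and not the second, since \<open>r\<close> has degree below that of \<phi>.\<close>
  show qle: "w a + w b \<le> w q + w \<phi>" if q0: "q \<noteq> 0"
  proof (rule ccontr)
    assume neg: "\<not> w a + w b \<le> w q + w \<phi>"
    define \<beta> where "\<beta> = w (q * \<phi>)"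
    have q\<phi>: "q * \<phi> \<noteq> 0" "w (q * \<phi>) < w (a * b)" using q0 phi_nonzero neg by (auto simp: w_mult wab)
    have "above w \<beta> (a * b)" "above w \<beta> (- (q * \<phi>))"
      using q\<phi> by (auto simp: above_def \<beta>_def w_uminus simp del: mult_minus_left mult_minus_right)
    then have ar: "above w \<beta> r" "above w \<beta> (q * \<phi>)" using above_add[of \<beta> "a * b" "- (q * \<phi>)"]
      by (auto simp: ab above_uminus simp del: mult_minus_left mult_minus_right)
    then have "component w \<rho> \<beta> (a * b) = component w \<rho> \<beta> (q * \<phi>) + component w \<rho> \<beta> r"
      unfolding ab by (intro rho_add)
    then have "component w \<rho> \<beta> r = 0"
      using q\<phi> by (auto simp: component_def rhoq \<beta>_def split: if_splits)
    then have "w r > \<beta>" using ar r0 rhor by (auto simp: component_def above_def split: if_splits)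
    moreover have "min (w (a * b)) (w (- r)) \<le> w (a * b + - r)"
      using q\<phi> ab0 r0 ab by (intro w_add) auto
    then have "min (w (a * b)) (w r) \<le> \<beta>"
      using r0 by (simp add: w_uminus ab \<beta>_def)
    ultimately show False using q\<phi> by (simp add: \<beta>_def min_def split: if_splits)
  qed
  define \<alpha> where "\<alpha> = w a + w b"
  have aq: "above w \<alpha> (q * \<phi>)" 
    using qle phi_nonzero by (cases "q = 0") (auto simp: above_def \<alpha>_def w_mult)
  have "above w \<alpha> (a * b + - (q * \<phi>))"
  proof (rule above_add)
    show "above w \<alpha> (a * b)" by (simp add: above_def wab \<alpha>_def)
    show "above w \<alpha> (- (q * \<phi>))" unfolding above_uminus by (rule aq)
  qed
  then have ar: "above w \<alpha> r" by (simp add: ab)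
  have "component w \<rho> \<alpha> (a * b) = component w \<rho> \<alpha> (q * \<phi>) + component w \<rho> \<alpha> r"
    unfolding ab by (intro rho_add aq ar)
  then have *: "component w \<rho> \<alpha> r = \<rho> (a * b)"
    using ab0 by (simp add: component_def rhoq \<alpha>_def wab split: if_splits)
  then show "w r = w a + w b" "\<rho> r = \<rho> a * \<rho> b"
    using rhoab by (auto simp: component_def \<alpha>_def rho_mult split: if_splits)
  show "degree q < degree \<phi>"
  proof (cases "q = 0")
    case False
    have "degree (q * \<phi>) = degree q + degree \<phi>"
      using False phi_nonzero by (simp add: degree_mult_eq)
    moreover have "degree (q * \<phi>) \<le> max (degree (a * b)) (degree r)"
      by (metis ab add_diff_cancel_right' degree_diff_le_max)
    moreover have "degree (a * b) = degree a + degree b" using a b by (simp add: degree_mult_eq)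
    ultimately show ?thesis using a b degr by (auto simp: max_def split: if_splits)
  qed (use deg in simp)
qed

lemma above_monomial_iff:
  assumes "a = 0 \<or> degree a < degree \<phi>"
  shows "above aw \<alpha> (a * \<phi> ^ i) \<longleftrightarrow> (a \<noteq> 0 \<longrightarrow> \<alpha> \<le> e * (w a + int i * w \<phi>) + h * int i)"
  unfolding above_aw_iff' adic_coeff_monomial[OF deg assms] by auto

lemma acomp_monomial:
  assumes "a = 0 \<or> degree a < degree \<phi>"
  shows "acomp x \<alpha> (a * \<phi> ^ i) = mono_comp x \<alpha> i a"
proof -
  have "supp (a * \<phi> ^ i) \<subseteq> {i}"
    by (auto simp: adic_support_def adic_coeff_monomial[OF deg assms] split: if_splits)
  then show ?thesis by (simp add: acomp_eq[of _ "{i}"] adic_coeff_monomial[OF deg assms])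
qed

lemma acomp_eq_0: "above aw \<beta> P \<Longrightarrow> \<alpha> < \<beta> \<Longrightarrow> acomp x \<alpha> P = 0"
  unfolding acomp_def above_aw_iff by (intro sum.neutral) auto

text \<open>Write \<open>a * b = q * \<phi> + r\<close>. The carry
  \<open>q * \<phi> ^ Suc (i + j)\<close> is strictly higher than the sum of the two heights,
  because the additional factor \<phi> contributes \<open>h > 0\<close>. So only
  \<open>r * \<phi> ^ (i + j)\<close> is seen in the leading degree, and \<rho> is multiplicative on
  it.\<close>

lemma acomp_monomial_mult:
  assumes a: "a = 0 \<or> degree a < degree \<phi>" and b: "b = 0 \<or> degree b < degree \<phi>"
    and ab: "above aw \<alpha> (a * \<phi> ^ i)" "above aw \<beta> (b * \<phi> ^ j)" and x: "x \<noteq> 0"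
  shows "above aw (\<alpha> + \<beta>) (a * \<phi> ^ i * (b * \<phi> ^ j))"
    "acomp x (\<alpha> + \<beta>) (a * \<phi> ^ i * (b * \<phi> ^ j)) = acomp x \<alpha> (a * \<phi> ^ i) * acomp x \<beta> (b * \<phi> ^ j)"
proof -
  have "above aw (\<alpha> + \<beta>) (a * \<phi> ^ i * (b * \<phi> ^ j)) \<and>
    acomp x (\<alpha> + \<beta>) (a * \<phi> ^ i * (b * \<phi> ^ j)) = acomp x \<alpha> (a * \<phi> ^ i) * acomp x \<beta> (b * \<phi> ^ j)"
  proof (cases "a = 0 \<or> b = 0")
    case True
    then show ?thesis by (auto simp: acomp_zero)
  next
    case False
    define q r where "q = (a * b) div \<phi>" and "r = (a * b) mod \<phi>"
    have nz: "a \<noteq> 0" "b \<noteq> 0" and dg: "degree a < degree \<phi>" "degree b < degree \<phi>"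
      using False a b by auto
    note qr = product_mod_phi[OF nz(1) dg(1) nz(2) dg(2), folded q_def r_def]
    define \<alpha>' \<beta>' where "\<alpha>' = e * (w a + int i * w \<phi>) + h * int i"
      and "\<beta>' = e * (w b + int j * w \<phi>) + h * int j"
    have le: "\<alpha> \<le> \<alpha>'" "\<beta> \<le> \<beta>'"
      using ab False by (auto simp: above_monomial_iff[OF a] above_monomial_iff[OF b] \<alpha>'_def \<beta>'_def)
    have ab_eq: "a * b = q * \<phi> + r" by (simp add: q_def r_def)
    have "a * \<phi> ^ i * (b * \<phi> ^ j) = (a * b) * \<phi> ^ (i + j)"
      by (simp add: power_add algebra_simps)
    also have "\<dots> = (q * \<phi> + r) * \<phi> ^ (i + j)" by (simp only: ab_eq)
    finally have "a * \<phi> ^ i * (b * \<phi> ^ j) = (q * \<phi> + r) * \<phi> ^ (i + j)" .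
    then have split: "a * \<phi> ^ i * (b * \<phi> ^ j) = q * \<phi> ^ Suc (i + j) + r * \<phi> ^ (i + j)"
      by (simp add: algebra_simps)
    have r: "above aw (\<alpha>' + \<beta>') (r * \<phi> ^ (i + j))"
      using qr by (simp add: above_monomial_iff \<alpha>'_def \<beta>'_def algebra_simps)
    have "\<alpha>' + \<beta>' + 1 \<le> e * (w q + int (Suc (i + j)) * w \<phi>) + h * int (Suc (i + j))" if "q \<noteq> 0"
    proof -
      have "e * (w a + w b) \<le> e * (w q + w \<phi>)" using qr(4)[OF that] e_pos by simp
      then show ?thesis using h_pos by (simp add: \<alpha>'_def \<beta>'_def algebra_simps)
    qed
    then have q: "above aw (\<alpha>' + \<beta>' + 1) (q * \<phi> ^ Suc (i + j))"
      using qr(6) above_monomial_iff by blast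
    then have q': "above aw (\<alpha>' + \<beta>') (q * \<phi> ^ Suc (i + j))" by (auto simp: above_def)
    note sum = acomp_add[OF q' r, folded split]
    have above: "above aw (\<alpha> + \<beta>) (a * \<phi> ^ i * (b * \<phi> ^ j))"
      using sum(1) le by (auto simp: above_def)
    show ?thesis
    proof (cases "\<alpha>' = \<alpha> \<and> \<beta>' = \<beta>")
      case True
      have "acomp x (\<alpha>' + \<beta>') (q * \<phi> ^ Suc (i + j)) = 0"
        using acomp_eq_0[OF q] by simp
      moreover have "expo (\<alpha>' + \<beta>') (i + j) = expo \<alpha>' i + expo \<beta>' j"
        by (rule expo_add[OF \<alpha>'_def[symmetric] \<beta>'_def[symmetric]])
      moreover have "e * (w a + w b + int (i + j) * w \<phi>) + h * int (i + j) = \<alpha>' + \<beta>'"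
        by (simp add: \<alpha>'_def \<beta>'_def algebra_simps)
      then have "acomp x (\<alpha>' + \<beta>') (r * \<phi> ^ (i + j)) =
          \<eta> ^ (i + j) * (\<rho> a * \<rho> b) * x powi expo (\<alpha>' + \<beta>') (i + j)"
        using qr by (simp add: acomp_monomial mono_comp_def)
      ultimately have "acomp x (\<alpha>' + \<beta>') (a * \<phi> ^ i * (b * \<phi> ^ j)) =
          (\<eta> ^ i * \<rho> a * x powi expo \<alpha>' i) * (\<eta> ^ j * \<rho> b * x powi expo \<beta>' j)"
        using x by (simp add: sum(2) power_add power_int_add)
      also have "\<dots> = acomp x \<alpha>' (a * \<phi> ^ i) * acomp x \<beta>' (b * \<phi> ^ j)"
        using nz dg by (simp add: acomp_monomial mono_comp_def \<alpha>'_def \<beta>'_def)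
      finally show ?thesis using True above by simp
    next
      case neq: False
      then have lt: "\<alpha> + \<beta> < \<alpha>' + \<beta>'" using le by auto
      have "acomp x (\<alpha> + \<beta>) (a * \<phi> ^ i * (b * \<phi> ^ j)) = 0"
        by (rule acomp_eq_0[OF sum(1) lt])
      moreover have "acomp x \<alpha> (a * \<phi> ^ i) = 0 \<or> acomp x \<beta> (b * \<phi> ^ j) = 0"
        using neq a b by (auto simp: acomp_monomial mono_comp_def \<alpha>'_def \<beta>'_def)
      ultimately show ?thesis using above by auto
    qed
  qed
  then show "above aw (\<alpha> + \<beta>) (a * \<phi> ^ i * (b * \<phi> ^ j))"
    "acomp x (\<alpha> + \<beta>) (a * \<phi> ^ i * (b * \<phi> ^ j)) = acomp x \<alpha> (a * \<phi> ^ i) * acomp x \<beta> (b * \<phi> ^ j)"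
    by auto
qed

lemma acomp_mult:
  assumes P: "above aw \<alpha> P" and Q: "above aw \<beta> Q" and x: "x \<noteq> 0"
  shows "above aw (\<alpha> + \<beta>) (P * Q)" "acomp x (\<alpha> + \<beta>) (P * Q) = acomp x \<alpha> P * acomp x \<beta> Q"
proof -
  define p where "p = (\<lambda>i. coef P i * \<phi> ^ i)"
  define q where "q = (\<lambda>j. coef Q j * \<phi> ^ j)"
  have Peq: "P = sum p (supp P)" and Qeq: "Q = sum q (supp Q)"
    unfolding p_def q_def by (rule adic_expansion[OF deg])+
  note dg = degree_adic_coeff[OF deg]
  have pa: "above aw \<alpha> (p i)" for i
    using P[unfolded above_aw_iff'] by (simp add: p_def above_monomial_iff[OF dg])
  have qa: "above aw \<beta> (q i)" for i
    using Q[unfolded above_aw_iff'] by (simp add: q_def above_monomial_iff[OF dg])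
  have pq: "above aw (\<alpha> + \<beta>) (p i * q j)" "acomp x (\<alpha> + \<beta>) (p i * q j) = acomp x \<alpha> (p i) * acomp x \<beta> (q j)" for i j
    unfolding p_def q_def
    by (rule acomp_monomial_mult[OF dg dg pa[unfolded p_def] qa[unfolded q_def] x])+
  have "P * Q = (\<Sum>i\<in>supp P. \<Sum>j\<in>supp Q. p i * q j)"
    by (subst Peq, subst Qeq) (simp add: sum_product)
  moreover have inner: "above aw (\<alpha> + \<beta>) (\<Sum>j\<in>supp Q. p i * q j) \<and>
      acomp x (\<alpha> + \<beta>) (\<Sum>j\<in>supp Q. p i * q j) = (\<Sum>j\<in>supp Q. acomp x (\<alpha> + \<beta>) (p i * q j))" for i
    by (rule acomp_sum) (rule pq)
  ultimately have "above aw (\<alpha> + \<beta>) (P * Q) \<and>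
      acomp x (\<alpha> + \<beta>) (P * Q) = (\<Sum>i\<in>supp P. acomp x (\<alpha> + \<beta>) (\<Sum>j\<in>supp Q. p i * q j))"
    using acomp_sum[of "supp P" "\<alpha> + \<beta>" "\<lambda>i. \<Sum>j\<in>supp Q. p i * q j" x] by simp
  moreover have "(\<Sum>i\<in>supp P. acomp x (\<alpha> + \<beta>) (\<Sum>j\<in>supp Q. p i * q j)) =
      (\<Sum>i\<in>supp P. acomp x \<alpha> (p i)) * (\<Sum>j\<in>supp Q. acomp x \<beta> (q j))"
    using inner by (simp add: pq sum_product)
  moreover have "(\<Sum>i\<in>supp P. acomp x \<alpha> (p i)) = acomp x \<alpha> P"
    by (subst (2) Peq) (use acomp_sum[of "supp P" \<alpha> p x] pa in simp)
  moreover have "(\<Sum>j\<in>supp Q. acomp x \<beta> (q j)) = acomp x \<beta> Q"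
    by (subst (2) Qeq) (use acomp_sum[of "supp Q" \<beta> q x] qa in simp)
  ultimately show "above aw (\<alpha> + \<beta>) (P * Q)" "acomp x (\<alpha> + \<beta>) (P * Q) = acomp x \<alpha> P * acomp x \<beta> Q"
    by simp_all
qed

section \<open>The residual polynomial of an augmentation\<close>

definition on_line :: "'a poly \<Rightarrow> nat \<Rightarrow> bool" where
  "on_line P j \<longleftrightarrow> j \<in> supp P \<and> height_along lam (u P) j = aw P"

definition aR :: "'a poly \<Rightarrow> nat \<Rightarrow> nat \<Rightarrow> 'b poly" where
  "aR P s d = (\<Sum>k\<le>d. monom (if on_line P (s + k * nat e)
      then \<eta> ^ (s + k * nat e) * \<rho> (coef P (s + k * nat e)) else 0) k)"

text \<open>Along the line \<open>e\<close> divides \<open>h\<close> times the difference of the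
  abscissas, and \<open>e\<close> is coprime to \<open>h\<close>.\<close>

lemma on_line_cong:
  assumes "on_line P i" "on_line P j" "i \<le> j"
  obtains k where "j = i + k * nat e"
proof -
  have "e * u P i + h * int i = e * u P j + h * int j"
    using assms by (simp add: on_line_def height_along_def)
  then have "h * (int j - int i) = e * (u P i - u P j)" by (simp add: algebra_simps)
  then have "e dvd h * (int j - int i)" by simp
  then have "e dvd int j - int i"
    using negative_slope(3)[OF lam] by (simp add: coprime_commute coprime_dvd_mult_right_iff)
  then obtain k where k: "int j - int i = e * k" by blast
  have "0 \<le> e * k" using k assms(3) by simp
  then have "0 \<le> k" using e_pos by (simp add: zero_le_mult_iff)
  then have "int j = int (i + nat k * nat e)" using k e_pos by (simp add: algebra_simps)
  then have "j = i + nat k * nat e" by (simp only: of_nat_eq_iff)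
  then show ?thesis by (rule that)
qed

lemma aR_exact:
  assumes P: "P \<noteq> 0" and st: "side_of_points lam (supp P) (u P) s t"
  obtains d where "t = s + d * nat e" "on_line P s" "on_line P t"
    "\<And>j. on_line P j \<Longrightarrow> \<exists>k\<le>d. j = s + k * nat e"
proof -
  have s: "on_line P s" and t: "on_line P t" and "s \<le> t"
    using st by (auto simp: on_line_def aw_side[OF P st] side_of_points_def)
  obtain d where d: "t = s + d * nat e" using on_line_cong[OF s t \<open>s \<le> t\<close>] .
  have "\<exists>k\<le>d. j = s + k * nat e" if j: "on_line P j" for j
  proof -
    have "s \<le> j" "j \<le> t"
      using j st by (auto simp: on_line_def aw_side[OF P st] side_of_points_def)
    obtain k where k: "j = s + k * nat e" using on_line_cong[OF s j \<open>s \<le> j\<close>] .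
    then have "k * nat e \<le> d * nat e" using \<open>j \<le> t\<close> d by simp
    then have "k \<le> d" using e_pos by simp
    then show ?thesis using k by blast
  qed
  then show ?thesis by (rule that[OF d s t])
qed

text \<open>A move by \<open>e\<close> to the right along the line raises \<open>expo\<close> by
  exactly one. So the power belonging to the initial abscissa factors out, and an ordinary
  polynomial remains.\<close>

lemma aT_aR:
  assumes P: "P \<noteq> 0" and st: "side_of_points lam (supp P) (u P) s t" and d: "t = s + d * nat e"
    and x: "x \<noteq> 0"
  shows "aT x P = x powi expo (aw P) s * poly (aR P s d) x"
proof -
  obtain d' where d': "t = s + d' * nat e" "on_line P s"
    and on: "\<And>j. on_line P j \<Longrightarrow> \<exists>k\<le>d'. j = s + k * nat e"
    using aR_exact[OF P st] by metis
  have "d' = d" using d d'(1) e_pos by simp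
  define c where "c = (\<lambda>j. \<eta> ^ j * \<rho> (coef P j))"
  have ex: "expo (aw P) (s + k * nat e) = expo (aw P) s + int k" if "on_line P (s + k * nat e)" for k
  proof -
    have "e * expo (aw P) (s + k * nat e) = int (s + k * nat e) - l * aw P"
      using that by (intro expo_exact[of "u P (s + k * nat e)"]) (auto simp: on_line_def height_along_def)
    moreover have "e * expo (aw P) s = int s - l * aw P"
      using d' by (intro expo_exact[of "u P s"]) (auto simp: on_line_def height_along_def)
    ultimately have "e * expo (aw P) (s + k * nat e) = e * (expo (aw P) s + int k)"
      using e_pos by (simp add: algebra_simps)
    then show ?thesis using e_pos by simp
  qed
  have "{j \<in> supp P. height_along lam (u P) j = aw P} = {j. on_line P j}"
    by (auto simp: on_line_def)
  also have "\<dots> = (\<lambda>k. s + k * nat e) ` {k. k \<le> d \<and> on_line P (s + k * nat e)}"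
    using on unfolding \<open>d' = d\<close> by auto
  finally have set: "{j \<in> supp P. height_along lam (u P) j = aw P} =
    (\<lambda>k. s + k * nat e) ` {k. k \<le> d \<and> on_line P (s + k * nat e)}" .
  have "aT x P = (\<Sum>k\<in>{k. k \<le> d \<and> on_line P (s + k * nat e)}.
      c (s + k * nat e) * x powi expo (aw P) (s + k * nat e))"
    unfolding aT_def acomp_def set using P e_pos
    by (subst sum.reindex) (auto simp: c_def inj_on_def)
  also have "\<dots> = (\<Sum>k\<in>{k. k \<le> d \<and> on_line P (s + k * nat e)}.
      x powi expo (aw P) s * (c (s + k * nat e) * x ^ k))"
    using x by (intro sum.cong) (auto simp: ex power_int_add)
  also have "\<dots> = (\<Sum>k\<le>d. x powi expo (aw P) s *
      ((if on_line P (s + k * nat e) then c (s + k * nat e) else 0) * x ^ k))"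
    by (intro sum.mono_neutral_cong_left) auto
  also have "\<dots> = x powi expo (aw P) s * poly (aR P s d) x"
    by (simp add: aR_def poly_sum poly_monom sum_distrib_left c_def cong: if_cong)
  finally show ?thesis .
qed

lemma coeff_aR:
  "coeff (aR P s d) k = (if k \<le> d \<and> on_line P (s + k * nat e)
     then \<eta> ^ (s + k * nat e) * \<rho> (coef P (s + k * nat e)) else 0)"
  by (simp add: aR_def coeff_sum)

lemma rho_coef: "j \<in> supp P \<Longrightarrow> \<rho> (coef P j) \<noteq> 0"
  using rho_nonzero degree_adic_coeff[OF deg] by (auto simp: adic_support_def)

lemma coeff_aR_nonzero:
  assumes P: "P \<noteq> 0" and st: "side_of_points lam (supp P) (u P) s t" and d: "t = s + d * nat e"
  shows "coeff (aR P s d) 0 \<noteq> 0" "degree (aR P s d) = d"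
proof -
  have "on_line P s" "on_line P t"
    using st by (auto simp: on_line_def aw_side[OF P st] side_of_points_def)
  then have "coeff (aR P s d) 0 \<noteq> 0" "coeff (aR P s d) d \<noteq> 0"
    using d eta rho_coef by (auto simp: coeff_aR on_line_def)
  moreover have "degree (aR P s d) \<le> d" by (intro degree_le) (auto simp: coeff_aR)
  ultimately show "coeff (aR P s d) 0 \<noteq> 0" "degree (aR P s d) = d"
    using le_degree by (auto intro: antisym)
qed

text \<open>The filtration gives one inequality. For the other, take a nonzero \<open>x\<close> at
  which neither residual polynomial vanishes: there the part of the product in degree
  \<open>aw P + aw Q\<close> has a nonzero value.\<close>

lemma aw_mult: 
  assumes P: "P \<noteq> 0" and Q: "Q \<noteq> 0"
  shows "aw (P * Q) = aw P + aw Q"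
proof -
  have ex: "\<exists>G. G \<noteq> 0 \<and> (\<forall>x. x \<noteq> 0 \<longrightarrow> poly G x \<noteq> 0 \<longrightarrow> aT x P \<noteq> 0)" if P: "P \<noteq> 0" for P
  proof -
    obtain s t where st: "side_of_points lam (supp P) (u P) s t"
      using side_of_points_exists[OF finite_adic_support[OF deg] adic_support_nonempty[OF deg P]] by metis
    obtain d where d: "t = s + d * nat e" using aR_exact[OF P st] by metis
    have "aR P s d \<noteq> 0" using coeff_aR_nonzero(1)[OF P st d] by auto
    moreover have "aT x P \<noteq> 0" if "x \<noteq> 0" "poly (aR P s d) x \<noteq> 0" for x
      using aT_aR[OF P st d that(1)] that by simp
    ultimately show ?thesis by blast
  qed
  obtain G where G: "G \<noteq> 0" "\<And>x. x \<noteq> 0 \<Longrightarrow> poly G x \<noteq> 0 \<Longrightarrow> aT x P \<noteq> 0"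
    using ex[OF P] by blast
  obtain H where H: "H \<noteq> 0" "\<And>x. x \<noteq> 0 \<Longrightarrow> poly H x \<noteq> 0 \<Longrightarrow> aT x Q \<noteq> 0"
    using ex[OF Q] by blast
  obtain x where x: "x \<noteq> 0" "poly (G * H) x \<noteq> 0"
    using exists_nonroot[of "G * H"] G(1) H(1) by auto
  have *: "above aw (aw P) P" "above aw (aw Q) Q" by (auto simp: above_def)
  note m = acomp_mult[OF * x(1)]
  have "acomp x (aw P + aw Q) (P * Q) = aT x P * aT x Q"
    using P Q by (simp add: m(2) aT_def)
  also have "\<dots> \<noteq> 0" using G H x by simp
  finally have "\<not> aw P + aw Q < aw (P * Q)"
    using acomp_eq_0[of "aw (P * Q)" "P * Q" "aw P + aw Q" x] by (auto simp: above_def)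
  then show ?thesis using m(1) P Q by (auto simp: above_def)
qed

text \<open>The output has the shape of the input, for every nonzero \<open>x\<close>; taking for
  \<open>x\<close> the root of the next residual factor lets the construction be repeated.\<close>

lemma graded_aw: "x \<noteq> 0 \<Longrightarrow> graded aw (aT x)"
proof
  assume x: "x \<noteq> 0"
  show "aw (P * Q) = aw P + aw Q" if "P \<noteq> 0" "Q \<noteq> 0" for P Q by (rule aw_mult[OF that])
  show "min (aw P) (aw Q) \<le> aw (P + Q)" if "P \<noteq> 0" "Q \<noteq> 0" "P + Q \<noteq> 0" for P Q
    using acomp_add(1)[of "min (aw P) (aw Q)" P Q] that by (auto simp: above_def)
  show "aT x 0 = 0" by (simp add: aT_def)
  show "aT x (P * Q) = aT x P * aT x Q" for P Q
  proof (cases "P = 0 \<or> Q = 0")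
    case False
    then show ?thesis
      using acomp_mult(2)[of "aw P" P "aw Q" Q x] x by (simp add: above_def aT_def aw_mult)
  qed (auto simp: aT_def)
  show "component aw (aT x) \<alpha> (P + Q) = component aw (aT x) \<alpha> P + component aw (aT x) \<alpha> Q"
    if "above aw \<alpha> P" "above aw \<alpha> Q" for \<alpha> P Q
    using acomp_add[OF that] that by (simp add: component_aw)
qed

end

section \<open>Multiplicities and polygons\<close>

text \<open>A nonzero constant term fixes the lowest exponent of a Laurent polynomial, so the power
  and the polynomial can be separated. At level zero constant terms may vanish, but there both
  exponents are \<open>0\<close>.\<close>

lemma powi_poly_eq_imp_eq:
  fixes p q :: "'a::alg_closed_field poly"
  assumes eq: "\<And>x. x \<noteq> 0 \<Longrightarrow> x powi a * poly p x = x powi b * poly q x"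
    and nz: "(a = 0 \<and> b = 0) \<or> (coeff p 0 \<noteq> 0 \<and> coeff q 0 \<noteq> 0)"
  shows "p = q \<and> a = b"
proof -
  have *: "p = q \<and> a = b" if ab: "a \<le> b" and eq: "\<And>x. x \<noteq> 0 \<Longrightarrow> x powi a * poly p x = x powi b * poly q x"
    and nz: "(a = 0 \<and> b = 0) \<or> coeff p 0 \<noteq> 0" for a b and p q :: "'a poly"
  proof -
    have p: "p = monom 1 (nat (b - a)) * q"
    proof (rule poly_eqI_nonzero)
      fix x :: 'a assume x: "x \<noteq> 0"
      have "x powi b = x powi a * x ^ nat (b - a)"
        using ab x by (simp flip: power_int_of_nat power_int_add)
      then have "x powi a * poly p x = x powi a * (x ^ nat (b - a) * poly q x)"
        using eq[OF x] by simp
      then show "poly p x = poly (monom 1 (nat (b - a)) * q) x"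
        using x by (simp add: poly_monom)
    qed
    have "nat (b - a) = 0"
      using nz
    proof
      assume "coeff p 0 \<noteq> 0"
      then show ?thesis unfolding p by (simp add: coeff_mult split: if_splits)
    qed simp
    then show ?thesis using p ab by simp
  qed
  show ?thesis
  proof (cases "a \<le> b")
    case True
    then show ?thesis using *[OF True eq] nz by blast
  next
    case False
    have "q = p \<and> b = a" using False nz by (intro *) (auto simp: eq)
    then show ?thesis by simp
  qed
qed

lemma dvd_monom_mult_cancel:
  fixes g q :: "'a::field poly"
  assumes "coeff g 0 \<noteq> 0" "g dvd monom 1 n * q"
  shows "g dvd q"
  using assms(2)
proof (induction n)
  case (Suc n)
  obtain r where r: "monom 1 (Suc n) * q = g * r" using Suc.prems by (auto elim: dvdE)
  have "coeff g 0 * coeff r 0 = coeff (monom 1 (Suc n) * q) 0"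
    unfolding r by (simp add: coeff_mult)
  also have "\<dots> = 0" by (simp add: coeff_mult)
  finally have "coeff r 0 = 0" using assms(1) by simp
  then obtain r' where r': "r = pCons 0 r'" by (cases r) auto
  have "pCons 0 (monom 1 n * q) = pCons 0 (g * r')"
    using r unfolding r' by (simp add: monom_Suc)
  then show ?case using Suc.IH by simp
qed (simp add: monom_0)

text \<open>
  \<open>y\<^bsup>k P\<^esup> R P\<close> is a Laurent polynomial attached to the initial form of \<open>P\<close>; at the level \<open>0\<close> the
  exponent is \<open>0\<close>, and at the higher levels the constant term of \<open>R P\<close> is not \<open>0\<close>.
\<close>

locale residual_system =
  fixes w :: "'a::field poly \<Rightarrow> int" and k :: "'a poly \<Rightarrow> int"
    and R :: "'a poly \<Rightarrow> 'b::alg_closed_field poly" and base :: bool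
  assumes graded: "x \<noteq> 0 \<or> base \<Longrightarrow> graded w (\<lambda>P. if P = 0 then 0 else x powi k P * poly (R P) x)"
    and R_nonzero: "P \<noteq> 0 \<Longrightarrow> R P \<noteq> 0"
    and k_base: "base \<Longrightarrow> P \<noteq> 0 \<Longrightarrow> k P = 0"
    and R_0: "\<not> base \<Longrightarrow> P \<noteq> 0 \<Longrightarrow> coeff (R P) 0 \<noteq> 0"
begin

lemma w_mult: "P \<noteq> 0 \<Longrightarrow> Q \<noteq> 0 \<Longrightarrow> w (P * Q) = w P + w Q"
  using graded.w_mult[OF graded[of 1]] by simp

lemma w_power: "P \<noteq> 0 \<Longrightarrow> w (P ^ n) = int n * w P"
  using graded.w_power[OF graded[of 1]] by simp

text \<open>The graded structure gives multiplicativity only for the twisted values; nonzero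
  constant terms, or zero exponents at the base, separate the twist from the residual
  polynomial.\<close>

lemma R_k_mult:
  assumes "P \<noteq> 0" "Q \<noteq> 0"
  shows "R (P * Q) = R P * R Q \<and> k (P * Q) = k P + k Q"
proof (rule powi_poly_eq_imp_eq)
  fix x :: 'b assume x: "x \<noteq> 0"
  show "x powi k (P * Q) * poly (R (P * Q)) x = x powi (k P + k Q) * poly (R P * R Q) x"
    using graded.rho_mult[OF graded[of x], of P Q] x assms by (simp add: power_int_add)
next
  show "(k (P * Q) = 0 \<and> k P + k Q = 0) \<or> (coeff (R (P * Q)) 0 \<noteq> 0 \<and> coeff (R P * R Q) 0 \<noteq> 0)"
    using assms k_base R_0 by (cases base) (simp_all add: coeff_mult)
qed

lemma R_power: "P \<noteq> 0 \<Longrightarrow> R (P ^ n) = R P ^ n"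
proof (induction n)
  case 0
  have "R (1 * 1) = R 1 * R 1" using R_k_mult[of 1 1] by simp
  then have "R 1 * R 1 = R 1 * 1" by simp
  then show ?case using R_nonzero[of 1] by simp
qed (simp add: R_k_mult)

end

text \<open>The condition \<open>nonroot\<close> is the engine of the induction: together with
  \<open>R_phi\<close> and \<open>root\<close> it says that evaluation at \<open>z\<close> detects
  divisibility by \<phi> on initial forms. At the base level \<open>z = 0\<close> is
  possible.\<close>

locale key_polynomial = residual_system w k R base
  for w :: "'a::field poly \<Rightarrow> int" and k :: "'a poly \<Rightarrow> int"
    and R :: "'a poly \<Rightarrow> 'b::alg_closed_field poly" and base :: bool +
  fixes \<phi> :: "'a poly" and \<psi> :: "'b poly" and c z :: 'b
  assumes deg: "0 < degree \<phi>" and degpsi: "0 < degree \<psi>"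
    and R_phi: "R \<phi> = smult c \<psi>" and root: "poly \<psi> z = 0"
    and nonroot: "a \<noteq> 0 \<Longrightarrow> degree a < degree \<phi> \<Longrightarrow> poly (R a) z \<noteq> 0"
begin

lemma phi_nonzero: "\<phi> \<noteq> 0" using deg by auto

lemma c_nonzero: "c \<noteq> 0"
  using R_phi R_nonzero[OF phi_nonzero] by auto

lemma z_nonzero:
  assumes "\<not> base"
  shows "z \<noteq> 0"
proof
  assume "z = 0"
  then have "coeff \<psi> 0 = 0" using root by (simp add: poly_0_coeff_0)
  then show False using R_0[OF assms phi_nonzero] R_phi by simp
qed

lemma coeff_psi_0: "\<not> base \<Longrightarrow> coeff \<psi> 0 \<noteq> 0"
  using R_0[OF _ phi_nonzero] R_phi by auto

text \<open>
  The finite part of the principal polygon of \<open>P\<close> ends at the first abscissa \<open>s\<close> at which the ordinate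
  is minimal; \<open>s\<close> is the multiplicity of \<open>\<psi>\<close> in the residual polynomial of the previous order,
  since among the terms of minimal value the one of index \<open>s\<close> is least divisible by \<open>\<psi>\<close>.
\<close>

lemma multiplicity_eq_polygon_end:
  assumes P: "P \<noteq> 0"
  defines "u \<equiv> \<lambda>j. w (adic_coeff \<phi> P j * \<phi> ^ j)"
  obtains s where "s \<in> adic_support \<phi> P" "\<And>j. j \<in> adic_support \<phi> P \<Longrightarrow> u s \<le> u j"
    "\<And>j. j \<in> adic_support \<phi> P \<Longrightarrow> j < s \<Longrightarrow> u s < u j" "w P = u s" "poly_ord \<psi> (R P) = s"
proof -
  define J where "J = adic_support \<phi> P"
  have fin: "finite J" and ne: "J \<noteq> {}"
    using finite_adic_support[OF deg] adic_support_nonempty[OF deg P] by (auto simp: J_def)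
  define \<beta> where "\<beta> = Min (u ` J)"
  define A where "A = {j \<in> J. u j = \<beta>}"
  have "\<beta> \<in> u ` J" unfolding \<beta>_def using fin ne by (intro Min_in) auto
  then have A: "finite A" "A \<noteq> {}" using fin by (auto simp: A_def)
  define s where "s = Min A"
  have sA: "s \<in> A" unfolding s_def using A by (rule Min_in)
  have s: "s \<in> J" "u s = \<beta>" using sA by (auto simp: A_def)
  have min: "\<beta> \<le> u j" if "j \<in> J" for j using that fin by (auto simp: \<beta>_def)
  have sle: "s \<le> j" if "j \<in> A" for j using that A by (auto simp: s_def)
  define p where "p = (\<lambda>j. adic_coeff \<phi> P j * \<phi> ^ j)"
  have Pp: "P = sum p J" unfolding p_def J_def by (rule adic_expansion[OF deg])
  have a0: "adic_coeff \<phi> P j \<noteq> 0" if "j \<in> J" for j using that by (simp add: J_def adic_support_def)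
  have p0: "p j \<noteq> 0" if "j \<in> J" for j using a0[OF that] phi_nonzero by (simp add: p_def)
  have Rp: "R (p j) = smult (c ^ j) (R (adic_coeff \<phi> P j) * \<psi> ^ j)" if "j \<in> J" for j
  proof -
    have "R (p j) = R (adic_coeff \<phi> P j) * R \<phi> ^ j"
      using a0[OF that] phi_nonzero by (simp add: p_def R_k_mult R_power)
    then show ?thesis by (simp add: R_phi smult_power)
  qed
  define T where "T = (\<lambda>x Q. if Q = 0 then 0 else x powi k Q * poly (R Q) x)"
  \<comment> \<open>Multiplication by \<open>x powi M\<close> makes all exponents involved
    nonnegative, so that \<open>G\<close> below is a genuine polynomial. At the base level all
    exponents are \<open>0\<close>, and so is \<open>M\<close>.\<close>
  define M where "M = \<bar>k P\<bar> + (\<Sum>j\<in>A. \<bar>k (p j)\<bar>)"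
  have M: "0 \<le> M" "0 \<le> M + k P" "0 \<le> M + k (p j)" if "j \<in> A" for j
  proof -
    have "\<bar>k (p j)\<bar> \<le> (\<Sum>j\<in>A. \<bar>k (p j)\<bar>)" using A that by (intro member_le_sum) auto
    then show "0 \<le> M" "0 \<le> M + k P" "0 \<le> M + k (p j)" by (auto simp: M_def)
  qed
  have Mbase: "M = 0" if base
    using that k_base P p0 by (auto simp: M_def A_def)
  define G where "G = (\<Sum>j\<in>A. monom 1 (nat (M + k (p j))) * R (p j))"
  have powM: "x ^ nat (M + i) = x powi M * x powi i" if "0 \<le> M + i" "x \<noteq> 0" for i and x :: 'b
    using that by (simp flip: power_int_of_nat power_int_add)
  have G: "poly G x = x powi M * component w (T x) \<beta> P" if x: "x \<noteq> 0" for x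
  proof -
    interpret g: graded w "T x" unfolding T_def using x by (intro graded) simp
    have "component w (T x) \<beta> P = (\<Sum>j\<in>J. component w (T x) \<beta> (p j))"
      unfolding Pp using min by (intro g.component_sum) (auto simp: above_def u_def p_def)
    also have "\<dots> = (\<Sum>j\<in>A. T x (p j))"
      using fin p0 unfolding A_def
      by (intro sum.mono_neutral_cong_right) (auto simp: component_def u_def p_def)
    finally have "x powi M * component w (T x) \<beta> P = (\<Sum>j\<in>A. x powi M * T x (p j))"
      by (simp add: sum_distrib_left)
    also have "\<dots> = (\<Sum>j\<in>A. poly (monom 1 (nat (M + k (p j))) * R (p j)) x)"
      using p0 M powM[OF _ x] by (intro sum.cong) (auto simp: T_def A_def poly_monom)
    finally show ?thesis by (simp add: G_def poly_sum)
  qed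
  have dvd: "\<psi> ^ s dvd G"
    unfolding G_def
  proof (rule dvd_sum)
    fix j assume j: "j \<in> A"
    have "\<psi> ^ s dvd \<psi> ^ j" using sle[OF j] by (rule le_imp_power_dvd)
    then show "\<psi> ^ s dvd monom 1 (nat (M + k (p j))) * R (p j)"
      using j by (auto simp: Rp A_def intro!: dvd_smult dvd_mult)
  qed
  \<comment> \<open>All terms of index greater than \<open>s\<close> are divisible by
    \<open>\<psi> ^ Suc s\<close>. The term of index \<open>s\<close> is not: after division by
    \<open>\<psi> ^ s\<close> its value at the root \<open>z\<close> is nonzero, as its coefficient
    has degree below that of \<phi>.\<close>
  have not_dvd: "\<not> \<psi> ^ Suc s dvd G"
  proof
    assume *: "\<psi> ^ Suc s dvd G"
    define a where "a = adic_coeff \<phi> P s"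
    have "G = monom 1 (nat (M + k (p s))) * R (p s) +
        (\<Sum>j\<in>A - {s}. monom 1 (nat (M + k (p j))) * R (p j))"
      unfolding G_def using A sA by (simp add: sum.remove)
    moreover have "\<psi> ^ Suc s dvd (\<Sum>j\<in>A - {s}. monom 1 (nat (M + k (p j))) * R (p j))"
    proof (rule dvd_sum)
      fix j assume j: "j \<in> A - {s}"
      then have "Suc s \<le> j" using sle[of j] by auto
      then have "\<psi> ^ Suc s dvd \<psi> ^ j" by (rule le_imp_power_dvd)
      then show "\<psi> ^ Suc s dvd monom 1 (nat (M + k (p j))) * R (p j)"
        using j by (auto simp: Rp A_def simp del: power_Suc intro!: dvd_smult dvd_mult)
    qed
    ultimately have "\<psi> ^ Suc s dvd monom 1 (nat (M + k (p s))) * R (p s)"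
      using * by (simp only: dvd_add_left_iff)
    also have "\<dots> = \<psi> ^ s * (monom (c ^ s) (nat (M + k (p s))) * R a)"
    proof -
      have "monom (c ^ s) n = smult (c ^ s) (monom 1 n)" for n by (simp add: smult_monom)
      then show ?thesis by (simp add: Rp[OF s(1)] a_def ac_simps)
    qed
    finally have "\<psi> dvd monom (c ^ s) (nat (M + k (p s))) * R a"
    proof -
      assume "\<psi> ^ Suc s dvd \<psi> ^ s * (monom (c ^ s) (nat (M + k (p s))) * R a)"
      moreover have "\<psi> ^ s \<noteq> 0" using degpsi by auto
      ultimately show ?thesis by (simp only: power_Suc2 dvd_mult_cancel_left) simp
    qed
    then have "poly (monom (c ^ s) (nat (M + k (p s))) * R a) z = 0"
      using root by (elim dvdE) simp
    \<comment> \<open>At the base level \<open>z\<close> may be \<open>0\<close>, but then the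
      exponent is \<open>0\<close> and the power is \<open>1\<close>.\<close>
    moreover have "z ^ nat (M + k (p s)) \<noteq> 0"
      using z_nonzero Mbase k_base[OF _ p0[OF s(1)]] by (cases base) auto
    moreover have "poly (R a) z \<noteq> 0"
      using nonroot[of a] a0[OF s(1)] degree_adic_coeff[OF deg, of P s] by (simp add: a_def)
    ultimately show False using c_nonzero by (simp add: poly_monom)
  qed
  then have "G \<noteq> 0" by auto
  \<comment> \<open>Were the value of \<open>P\<close> different from the minimum \<beta> of the
    values of its terms, its component in degree \<beta> would vanish at every nonzero
    \<open>x\<close>, and \<open>G\<close> would be zero.\<close>
  have wP: "w P = \<beta>"
  proof (rule ccontr)
    assume "w P \<noteq> \<beta>"
    then have "G = 0" using G by (intro poly_eqI_nonzero) (simp add: component_def)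
    then show False using \<open>G \<noteq> 0\<close> by simp
  qed
  have Geq: "G = monom 1 (nat (M + k P)) * R P"
    using G wP P M(2)[OF sA] powM by (intro poly_eqI_nonzero) (simp add: component_def T_def poly_monom)
  have iff: "\<psi> ^ i dvd R P \<longleftrightarrow> \<psi> ^ i dvd G" for i
  proof
    assume "\<psi> ^ i dvd G"
    show "\<psi> ^ i dvd R P"
    proof (cases base)
      case True
      then show ?thesis using \<open>\<psi> ^ i dvd G\<close> k_base[OF True P] Mbase by (simp add: Geq monom_0)
    next
      case False
      have "coeff (\<psi> ^ i) 0 \<noteq> 0" using coeff_psi_0[OF False]
        by (simp add: coeff_0_power)
      then show ?thesis using \<open>\<psi> ^ i dvd G\<close> dvd_monom_mult_cancel unfolding Geq by blast
    qed
  qed (simp add: Geq)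
  have "poly_ord \<psi> (R P) = s"
    using dvd not_dvd by (intro poly_ord_eqI degpsi R_nonzero P) (simp_all add: iff del: power_Suc)
  moreover have "u s < u j" if "j \<in> J" "j < s" for j
    using that sle[of j] min[of j] s(2) by (auto simp: A_def less_le)
  ultimately show ?thesis using that s min wP unfolding J_def by auto
qed

end

section \<open>Subfields\<close>

lemma subfield_setD:
  assumes "subfield_set F"
  shows "0 \<in> F" "1 \<in> F" "x \<in> F \<Longrightarrow> y \<in> F \<Longrightarrow> x * y \<in> F" "x \<in> F \<Longrightarrow> y \<in> F \<Longrightarrow> x - y \<in> F"
    "x \<in> F \<Longrightarrow> inverse x \<in> F" "x \<in> F \<Longrightarrow> - x \<in> F"
proof -
  have *: "x - y \<in> F" "x * y \<in> F" if "x \<in> F" "y \<in> F" for x y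
    using assms that unfolding subfield_set_def by blast+
  show 1: "1 \<in> F" using assms unfolding subfield_set_def by blast
  show 0: "0 \<in> F" using *(1)[OF 1 1] by simp
  show "- x \<in> F" if "x \<in> F" using *(1)[OF 0 that] by simp
  show "inverse x \<in> F" if "x \<in> F" using assms that unfolding subfield_set_def by blast
  show "x * y \<in> F" "x - y \<in> F" if "x \<in> F" "y \<in> F" using * that by blast+
qed

lemma subfield_set_power: "subfield_set F \<Longrightarrow> x \<in> F \<Longrightarrow> x ^ n \<in> F"
  by (induction n) (auto simp: subfield_setD)

lemma subfield_set_powi: "subfield_set F \<Longrightarrow> x \<in> F \<Longrightarrow> x powi n \<in> F"
  by (auto simp: power_int_def subfield_set_power subfield_setD)

lemma poly_over_smult: "subfield_set F \<Longrightarrow> c \<in> F \<Longrightarrow> poly_over F g \<Longrightarrow> poly_over F (smult c g)"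
  by (simp add: poly_over_def subfield_setD)

lemma root_of_root:
  fixes g :: "'a::alg_closed_field poly"
  assumes "0 < degree g"
  shows "poly g (root_of g) = 0"
  unfolding root_of_def using alg_closed_imp_poly_has_root[OF assms] by (rule someI_ex)

lemma poly_root_nonzero:
  assumes F: "subfield_set F" and g: "monic_irreducible_over F g" and a: "poly_over F a"
    and deg: "a \<noteq> 0" "degree a < degree g"
  shows "poly a (root_of g) \<noteq> 0"
proof
  assume "poly a (root_of g) = 0"
  then have "g dvd a" using quotient_kernel[OF F g a] by (auto intro: dvdI)
  then show False using deg dvd_imp_degree_le[of g a] by simp
qed

lemma subfield_quotient_field:
  assumes F: "subfield_set F" and g: "monic_irreducible_over F g"
  shows "subfield_set (quotient_field F g)"
proof -
  define z where "z = root_of g"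
  have g': "poly_over F g" "lead_coeff g = 1" "0 < degree g"
    and irr: "\<And>a b. poly_over F a \<Longrightarrow> poly_over F b \<Longrightarrow> g = a * b \<Longrightarrow> degree a = 0 \<or> degree b = 0"
    using g by (auto simp: monic_irreducible_over_def)
  have gz: "poly g z = 0" unfolding z_def by (rule root_of_root[OF g'(3)])
  note ring = poly_over_mult[OF F] poly_over_diff[OF F]
  have Q: "x \<in> quotient_field F g \<longleftrightarrow> (\<exists>a. poly_over F a \<and> x = poly a z)" for x
    by (auto simp: quotient_field_def z_def)
  have const: "poly_over F [:c:]" if "c \<in> F" for c
    using that subfield_setD(1)[OF F] by (auto simp: poly_over_def coeff_pCons split: nat.split)
  \<comment> \<open>Euclid's algorithm as an induction on the degree: \<open>g = a1 * q + r\<close>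
    evaluated at \<open>z\<close> gives \<open>c a(z) q(z) = - r(z)\<close>, and the inverse of
    \<open>r(z)\<close> is available because \<open>r\<close> has smaller degree.\<close>
  have inv: "inverse (poly a z) \<in> quotient_field F g" if "poly_over F a" "a \<noteq> 0" "degree a < degree g" for a
    using that
  proof (induction "degree a" arbitrary: a rule: less_induct)
    case less
    define c where "c = inverse (lead_coeff a)"
    define a1 where "a1 = smult c a"
    have c: "c \<noteq> 0" "c \<in> F" using less.prems F by (auto simp: c_def poly_over_def subfield_setD)
    have a1: "poly_over F a1" "lead_coeff a1 = 1" "degree a1 = degree a" "a1 \<noteq> 0"
      using less.prems c by (auto simp: a1_def c_def intro: poly_over_smult[OF F])
    obtain q r where qr: "poly_over F q" "poly_over F r" "g = a1 * q + r" "r = 0 \<or> degree r < degree a1"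
      using poly_over_division[OF F a1(1,2) g'(1)] by blast
    show ?case
    proof (cases "degree a = 0")
      case True
      then obtain d where d: "a = [:d:]" by (auto elim: degree_eq_zeroE)
      have "coeff a 0 \<in> F" using less.prems(1) unfolding poly_over_def by blast
      then have "inverse d \<in> F" using d subfield_setD(5)[OF F] by simp
      then have "poly_over F [:inverse d:] \<and> inverse (poly a z) = poly [:inverse d:] z"
        using const d by simp
      then show ?thesis unfolding Q by blast
    next
      case False
      have "r \<noteq> 0"
      proof
        assume "r = 0"
        then have eq: "g = a1 * q" using qr by simp
        then have "degree q = 0" using irr[OF a1(1) qr(1)] a1(3) False by auto
        moreover have "q \<noteq> 0" using eq g'(3) by auto
        ultimately have "degree g = degree a1" using a1(4) by (simp add: eq degree_mult_eq)
        then show False using a1(3) less.prems by simp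
      qed
      then have "degree r < degree a" using qr a1 by simp
      then obtain b where b: "poly_over F b" "inverse (poly r z) = poly b z"
        using less.hyps[OF _ qr(2) \<open>r \<noteq> 0\<close>] less.prems Q by auto
      have az: "poly a z \<noteq> 0"
        unfolding z_def by (rule poly_root_nonzero[OF F g less.prems])
      have rz: "poly r z \<noteq> 0"
        unfolding z_def using less.prems(3) \<open>degree r < degree a\<close>
        by (intro poly_root_nonzero[OF F g qr(2) \<open>r \<noteq> 0\<close>]) simp
      have "c * poly a z * poly q z + poly r z = 0"
        using gz by (simp add: qr(3) a1_def mult.assoc)
      then have "poly a z * (c * poly q z) = - poly r z"
        by (simp add: algebra_simps eq_neg_iff_add_eq_0)
      then have *: "- (poly a z * (c * poly q z)) = poly r z" by simp
      have "poly a z * (- c * poly q z * poly b z) = - (poly a z * (c * poly q z)) * poly b z"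
        by (simp add: algebra_simps)
      also have "\<dots> = 1" unfolding * b(2)[symmetric] using rz by simp
      finally have "poly a z * (- c * poly q z * poly b z) = 1" .
      then have "inverse (poly a z) = - c * poly q z * poly b z"
        using az by (simp add: inverse_unique)
      also have "\<dots> = poly (smult (- c) (q * b)) z" by simp
      finally show ?thesis
        unfolding Q using poly_over_smult[OF F _ ring(1)[OF qr(1) b(1)], of "- c"] c subfield_setD(6)[OF F] by blast
    qed
  qed
  have "inverse x \<in> quotient_field F g" if x: "x \<in> quotient_field F g" for x
  proof -
    obtain a where a: "poly_over F a" "x = poly a z" using x Q by auto
    obtain q r where qr: "poly_over F q" "poly_over F r" "a = g * q + r" "r = 0 \<or> degree r < degree g"
      using poly_over_division[OF F g'(1,2) a(1)] by blast
    have "x = poly r z" using a qr gz by simp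
    then show ?thesis using inv[OF qr(2)] qr(4) x by (cases "r = 0") auto
  qed
  moreover have "1 \<in> quotient_field F g"
    unfolding Q using const[OF subfield_setD(2)[OF F]] by (intro exI[of _ "[:1:]"]) simp
  moreover have "x - y \<in> quotient_field F g \<and> x * y \<in> quotient_field F g"
    if xy: "x \<in> quotient_field F g" "y \<in> quotient_field F g" for x y
  proof -
    obtain a b where ab: "poly_over F a" "x = poly a z" "poly_over F b" "y = poly b z"
      using xy unfolding Q by blast
    have "x - y = poly (a - b) z" "x * y = poly (a * b) z" using ab by simp_all
    then show ?thesis unfolding Q using ring[OF ab(1,3)] by blast
  qed
  ultimately show ?thesis by (simp add: subfield_set_def)
qed

lemma poly_in_quotient_field: "poly_over F a \<Longrightarrow> poly a (root_of g) \<in> quotient_field F g"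
  by (auto simp: quotient_field_def)

lemma root_in_quotient_field: "subfield_set F \<Longrightarrow> root_of g \<in> quotient_field F g"
  using poly_in_quotient_field[OF poly_over_monom[of F 1 1], of g]
  by (simp add: subfield_setD poly_monom)

lemma irreducible_factor_over:
  assumes F: "subfield_set F" and a: "poly_over F a" "0 < degree a"
  obtains g where "monic_irreducible_over F g" "g dvd a"
proof -
  have "\<exists>g. monic_irreducible_over F g \<and> g dvd a" using a
  proof (induction "degree a" arbitrary: a rule: less_induct)
    case less
    define g where "g = smult (inverse (lead_coeff a)) a"
    have a0: "a \<noteq> 0" using less.prems by auto
    have g: "poly_over F g" "lead_coeff g = 1" "degree g = degree a"
      using a0 less.prems F by (auto simp: g_def poly_over_def subfield_setD)
    have gdvd: "g dvd a" using a0 by (simp add: g_def smult_dvd_iff)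
    show ?case
    proof (cases "monic_irreducible_over F g")
      case False
      then obtain b d where bd: "poly_over F b" "poly_over F d" "g = b * d" "degree b \<noteq> 0" "degree d \<noteq> 0"
        using g less.prems by (auto simp: monic_irreducible_over_def)
      have "b \<noteq> 0" "d \<noteq> 0" using bd by auto
      then have "degree b < degree a" using bd g(3) by (simp add: degree_mult_eq)
      then obtain g' where "monic_irreducible_over F g'" "g' dvd b"
        using less.hyps[of b] bd by auto
      then show ?thesis using bd(3) gdvd by (metis dvd_mult2 dvd_trans)
    qed (use gdvd in blast)
  qed
  then show ?thesis using that by blast
qed

section \<open>The level zero\<close>

text \<open>The two valuations may differ at \<open>0\<close>, because \<open>above\<close> and
  \<open>component\<close> never look at the value there.\<close>

lemma graded_cong:
  assumes g: "graded w \<rho>" and w: "\<And>P. P \<noteq> 0 \<Longrightarrow> w' P = w P" and \<rho>: "\<And>P. \<rho>' P = \<rho> P"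
  shows "graded w' \<rho>'"
proof -
  have "above w' \<alpha> P \<longleftrightarrow> above w \<alpha> P" "component w' \<rho>' \<alpha> P = component w \<rho> \<alpha> P" for \<alpha> P
    using w[of P] by (cases "P = 0"; simp add: above_def component_def \<rho>)+
  then show ?thesis using g w \<rho> by (simp add: graded_def)
qed

section \<open>The valuation ring and integral polynomials\<close>

context padic_field
begin

lemma v_one: "v 1 = 0"
  using v_mult[of 1 1] by simp

lemma v_inverse: "x \<noteq> 0 \<Longrightarrow> v (inverse x) = - v x"
  using v_mult[of x "inverse x"] v_one by simp

lemma v_uminus: "v (- x) = v x"
proof (cases "x = 0")
  case False
  have "v (- 1) = 0" using v_mult[of "- 1" "- 1"] v_one by simp
  then show ?thesis using v_mult[of "- 1" x] False by simp
qed simp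

lemma v_power: "x \<noteq> 0 \<Longrightarrow> v (x ^ n) = int n * v x"
  by (induction n) (auto simp: v_one v_mult algebra_simps)

lemma integers_closed:
  "0 \<in> \<O>" "1 \<in> \<O>" "x \<in> \<O> \<Longrightarrow> y \<in> \<O> \<Longrightarrow> x + y \<in> \<O>" "x \<in> \<O> \<Longrightarrow> y \<in> \<O> \<Longrightarrow> x * y \<in> \<O>"
  "x \<in> \<O> \<Longrightarrow> - x \<in> \<O>"
proof -
  show "x + y \<in> \<O>" if "x \<in> \<O>" "y \<in> \<O>"
    using that v_add[of x y] by (cases "x = 0"; cases "y = 0"; cases "x + y = 0") (auto simp: integers_def)
  show "x * y \<in> \<O>" if "x \<in> \<O>" "y \<in> \<O>"
    using that v_mult[of x y] by (cases "x = 0"; cases "y = 0") (auto simp: integers_def)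
qed (auto simp: integers_def v_one v_uminus)

lemma integers_sum: "(\<And>i. i \<in> A \<Longrightarrow> g i \<in> \<O>) \<Longrightarrow> sum g A \<in> \<O>"
  by (induction A rule: infinite_finite_induct) (auto simp: integers_closed)

lemma integral_poly_mult: "integral_poly P \<Longrightarrow> integral_poly Q \<Longrightarrow> integral_poly (P * Q)"
  by (auto simp: integral_poly_def coeff_mult intro!: integers_sum integers_closed)

lemma above_gauss_iff: "above gauss_val \<alpha> P \<longleftrightarrow> (\<forall>i. coeff P i \<noteq> 0 \<longrightarrow> \<alpha> \<le> v (coeff P i))"
proof (cases "P = 0")
  case False
  then have "set (coeffs P) - {0} \<noteq> {}"
    by (auto simp: range_coeff[symmetric] poly_eq_iff)
  then have "above gauss_val \<alpha> P \<longleftrightarrow> (\<forall>c\<in>set (coeffs P) - {0}. \<alpha> \<le> v c)"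
    using False by (simp add: above_def gauss_val_def)
  also have "set (coeffs P) - {0} = range (coeff P) - {0}"
    by (auto simp: range_coeff)
  finally show ?thesis by auto
qed (simp add: above_def)

lemma integral_poly_iff: "integral_poly P \<longleftrightarrow> above gauss_val 0 P"
  by (auto simp: integral_poly_def integers_def above_gauss_iff)

lemma integral_poly_shift:
  assumes "c \<noteq> 0"
  shows "integral_poly (smult (inverse c) P) \<longleftrightarrow> above gauss_val (v c) P"
proof -
  have "inverse c * coeff P i \<in> \<O> \<longleftrightarrow> (coeff P i \<noteq> 0 \<longrightarrow> v c \<le> v (coeff P i))" for i
    using assms by (cases "coeff P i = 0") (simp_all add: integers_def v_mult v_inverse)
  then show ?thesis by (simp add: integral_poly_def above_gauss_iff)
qed

end

section \<open>The Gauss valuation and reduction of polynomials\<close>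

context montes_setting
begin

lemma v_pi_powi: "v (\<pi> powi n) = n"
proof (cases "0 \<le> n")
  case True
  then show ?thesis using \<pi> by (simp add: power_int_def v_power)
next
  case False
  then show ?thesis using \<pi> by (simp add: power_int_def v_power v_inverse)
qed

lemma pi_powi_nonzero: "\<pi> powi n \<noteq> 0"
  using \<pi> by simp

lemma red_zero: "red 0 = 0"
  using red_kernel[of 0] integers_closed(1) by simp

lemma red_uminus: "x \<in> \<O> \<Longrightarrow> red (- x) = - red x"
  using red_add[of x "- x"] by (simp add: integers_closed red_zero eq_neg_iff_add_eq_0 add.commute)

lemma red_sum: "(\<And>i. i \<in> A \<Longrightarrow> g i \<in> \<O>) \<Longrightarrow> red (sum g A) = (\<Sum>i\<in>A. red (g i))"
  by (induction A rule: infinite_finite_induct) (auto simp: red_zero red_add integers_sum)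

lemma coeff_red_poly: "coeff (red_poly P) i = red (coeff P i)"
  by (simp add: red_poly_def coeff_map_poly red_zero)

lemma red_poly_add: "integral_poly P \<Longrightarrow> integral_poly Q \<Longrightarrow> red_poly (P + Q) = red_poly P + red_poly Q"
  by (intro poly_eqI) (simp add: coeff_red_poly red_add integral_poly_def)

lemma red_poly_mult: "integral_poly P \<Longrightarrow> integral_poly Q \<Longrightarrow> red_poly (P * Q) = red_poly P * red_poly Q"
proof (intro poly_eqI)
  fix n assume "integral_poly P" "integral_poly Q"
  then show "coeff (red_poly (P * Q)) n = coeff (red_poly P * red_poly Q) n"
    by (simp add: coeff_red_poly coeff_mult red_sum red_mult integral_poly_def integers_closed)
qed

definition scaled :: "int \<Rightarrow> 'k poly \<Rightarrow> 'k poly" where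
  "scaled \<alpha> P = smult (inverse (\<pi> powi \<alpha>)) P"

lemma integral_scaled: "integral_poly (scaled \<alpha> P) \<longleftrightarrow> above gauss_val \<alpha> P"
  using integral_poly_shift[OF pi_powi_nonzero, of \<alpha> P] by (simp add: scaled_def v_pi_powi)

lemma scaled_add: "scaled \<alpha> (P + Q) = scaled \<alpha> P + scaled \<alpha> Q"
  by (simp add: scaled_def smult_add_right)

lemma scaled_mult: "scaled (\<alpha> + \<beta>) (P * Q) = scaled \<alpha> P * scaled \<beta> Q"
  using \<pi> by (simp add: scaled_def power_int_add mult.commute)

lemma red_scaled_eq_0_iff:
  assumes "above gauss_val \<alpha> P"
  shows "red_poly (scaled \<alpha> P) = 0 \<longleftrightarrow> P = 0 \<or> \<alpha> < gauss_val P"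
proof -
  have int: "coeff (scaled \<alpha> P) i \<in> \<O>" for i
    using assms integral_scaled by (auto simp: integral_poly_def)
  have v: "v (coeff (scaled \<alpha> P) i) = v (coeff P i) - \<alpha>" if "coeff P i \<noteq> 0" for i
    using that pi_powi_nonzero by (simp add: scaled_def v_mult v_inverse v_pi_powi)
  have "red_poly (scaled \<alpha> P) = 0 \<longleftrightarrow> (\<forall>i. red (coeff (scaled \<alpha> P) i) = 0)"
    by (auto simp: poly_eq_iff coeff_red_poly)
  also have "\<dots> \<longleftrightarrow> (\<forall>i. coeff P i \<noteq> 0 \<longrightarrow> \<alpha> + 1 \<le> v (coeff P i))"
  proof (intro iff_allI)
    fix i
    show "red (coeff (scaled \<alpha> P) i) = 0 \<longleftrightarrow> (coeff P i \<noteq> 0 \<longrightarrow> \<alpha> + 1 \<le> v (coeff P i))"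
      using red_kernel[OF int, of i] v[of i] pi_powi_nonzero by (auto simp: scaled_def)
  qed
  also have "\<dots> \<longleftrightarrow> above gauss_val (\<alpha> + 1) P" by (simp add: above_gauss_iff)
  finally show ?thesis by (auto simp: above_def)
qed

lemma res_poly_Nil: "res_poly [] P = red_poly (scaled (gauss_val P) P)"
  by (simp add: scaled_def)

lemma res_poly_Nil_nonzero: "P \<noteq> 0 \<Longrightarrow> res_poly [] P \<noteq> 0"
  unfolding res_poly_Nil by (subst red_scaled_eq_0_iff) (auto simp: above_def)

lemma above_gauss_mult:
  "above gauss_val \<alpha> P \<Longrightarrow> above gauss_val \<beta> Q \<Longrightarrow> above gauss_val (\<alpha> + \<beta>) (P * Q)"
  unfolding integral_scaled[symmetric] scaled_mult by (rule integral_poly_mult)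

text \<open>Gauss's lemma: the product of two nonzero reductions is nonzero.\<close>

lemma gauss_val_mult:
  assumes "P \<noteq> 0" "Q \<noteq> 0"
  shows "gauss_val (P * Q) = gauss_val P + gauss_val Q"
proof -
  have a: "above gauss_val (gauss_val P) P" "above gauss_val (gauss_val Q) Q" by (simp_all add: above_def)
  note pq = above_gauss_mult[OF a]
  have "red_poly (scaled (gauss_val P + gauss_val Q) (P * Q)) = res_poly [] P * res_poly [] Q"
    unfolding scaled_mult res_poly_Nil by (rule red_poly_mult) (simp_all add: integral_scaled above_def)
  also have "\<dots> \<noteq> 0" using assms by (simp add: res_poly_Nil_nonzero del: res_poly.simps)
  finally show ?thesis
    using red_scaled_eq_0_iff[OF pq] pq assms by (auto simp: above_def)
qed

text \<open>The right-hand side is visibly additive in \<open>P\<close>. It also covers a larger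
  Gauss value than \<alpha>, where both sides are zero.\<close>

lemma component_gauss:
  assumes "above gauss_val \<alpha> P"
  shows "component gauss_val (\<lambda>P. if P = 0 then 0 else x powi 0 * poly (res_poly [] P) x) \<alpha> P =
    poly (red_poly (scaled \<alpha> P)) x"
  using red_scaled_eq_0_iff[OF assms] assms
  by (auto simp: component_def res_poly_Nil above_def simp del: res_poly.simps)

lemma graded_gauss: "graded gauss_val (\<lambda>P. if P = 0 then 0 else x powi 0 * poly (res_poly [] P) x)"
proof
  fix P Q :: "'k poly" and \<alpha>
  show "gauss_val (P * Q) = gauss_val P + gauss_val Q" if "P \<noteq> 0" "Q \<noteq> 0"
    by (rule gauss_val_mult[OF that])
  have add: "above gauss_val \<alpha> (P + Q)" if "above gauss_val \<alpha> P" "above gauss_val \<alpha> Q" for \<alpha>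
    using that unfolding integral_scaled[symmetric] scaled_add
    by (auto simp: integral_poly_def integers_closed)
  show "min (gauss_val P) (gauss_val Q) \<le> gauss_val (P + Q)" if "P \<noteq> 0" "Q \<noteq> 0" "P + Q \<noteq> 0"
    using add[of "min (gauss_val P) (gauss_val Q)"] that by (auto simp: above_def)
  show "(if P * Q = 0 then 0 else x powi 0 * poly (res_poly [] (P * Q)) x) =
    (if P = 0 then 0 else x powi 0 * poly (res_poly [] P) x) *
    (if Q = 0 then 0 else x powi 0 * poly (res_poly [] Q) x)"
  proof (cases "P = 0 \<or> Q = 0")
    case False
    have "res_poly [] (P * Q) = res_poly [] P * res_poly [] Q"
      unfolding res_poly_Nil using False
      by (subst red_poly_mult[symmetric])
        (simp_all add: integral_scaled above_def gauss_val_mult scaled_mult)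
    then show ?thesis using False by (simp del: res_poly.simps)
  qed auto
  show "component gauss_val (\<lambda>P. if P = 0 then 0 else x powi 0 * poly (res_poly [] P) x) \<alpha> (P + Q) =
      component gauss_val (\<lambda>P. if P = 0 then 0 else x powi 0 * poly (res_poly [] P) x) \<alpha> P +
      component gauss_val (\<lambda>P. if P = 0 then 0 else x powi 0 * poly (res_poly [] P) x) \<alpha> Q"
    if "above gauss_val \<alpha> P" "above gauss_val \<alpha> Q"
    unfolding component_gauss[OF that(1)] component_gauss[OF that(2)] component_gauss[OF add[OF that]]
    using that by (simp add: scaled_add red_poly_add integral_scaled)
qed simp

lemma monic_integral_facts:
  assumes "monic_integral P"
  shows "P \<noteq> 0" "gauss_val P = 0" "res_poly [] P = red_poly P" "degree (red_poly P) = degree P"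
    "lead_coeff (red_poly P) = 1"
proof -
  have P: "integral_poly P" "lead_coeff P = 1" using assms by (auto simp: monic_integral_def)
  then show P0: "P \<noteq> 0" by auto
  have "0 \<le> gauss_val P" using P P0 by (simp add: integral_poly_iff above_def)
  moreover have "above gauss_val (gauss_val P) P" by (simp add: above_def)
  then have "gauss_val P \<le> 0" using P(2) v_one unfolding above_gauss_iff by (metis zero_neq_one)
  ultimately show g: "gauss_val P = 0" by simp
  then show "res_poly [] P = red_poly P" by simp
  have "coeff (red_poly P) (degree P) = 1" using P(2) by (simp add: coeff_red_poly red_one)
  moreover have "degree (red_poly P) \<le> degree P"
    by (intro degree_le) (auto simp: coeff_red_poly red_zero coeff_eq_0)
  ultimately show "degree (red_poly P) = degree P" "lead_coeff (red_poly P) = 1"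
    using le_degree[of "red_poly P" "degree P"] by (auto intro: antisym)
qed

lemma degree_red_poly_le: "degree (red_poly P) \<le> degree P"
  by (intro degree_le) (auto simp: coeff_red_poly red_zero coeff_eq_0)

lemma subfield_residue_field: "subfield_set \<F>"
proof -
  have "inverse (red x) \<in> \<F>" if x: "x \<in> \<O>" for x
  proof (cases "red x = 0")
    case True
    then show ?thesis using x by (auto simp: residue_field_def)
  next
    case False
    then have x0: "x \<noteq> 0" "v x = 0" using x red_kernel[OF x] by (auto simp: integers_def)
    then have inv: "inverse x \<in> \<O>" by (simp add: integers_def v_inverse)
    have "red (inverse x) * red x = 1"
      using red_mult[OF inv x] x0 red_one by simp
    then have "inverse (red x) = red (inverse x)" using False by (simp add: field_simps)
    then show ?thesis using inv by (auto simp: residue_field_def)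
  qed
  moreover have "red x - red y \<in> \<F>" "red x * red y \<in> \<F>" if "x \<in> \<O>" "y \<in> \<O>" for x y
  proof -
    have "red x - red y = red (x + - y)" using that by (simp only: red_add red_uminus integers_closed) simp
    moreover have "x + - y \<in> \<O>" using that by (intro integers_closed)
    ultimately show "red x - red y \<in> \<F>" unfolding residue_field_def by blast
    show "red x * red y \<in> \<F>"
      unfolding residue_field_def red_mult[OF that, symmetric] by (intro imageI integers_closed that)
  qed
  moreover have "1 \<in> \<F>" using red_one integers_closed(2) by (force simp: residue_field_def)
  ultimately show ?thesis unfolding subfield_set_def by (auto simp: residue_field_def)
qed

lemma poly_over_res_poly_Nil:
  assumes "P \<noteq> 0"
  shows "poly_over \<F> (res_poly [] P)"
proof -
  have "integral_poly (scaled (gauss_val P) P)" by (simp add: integral_scaled above_def)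
  then show ?thesis
    unfolding res_poly_Nil poly_over_def by (auto simp: coeff_red_poly residue_field_def integral_poly_def)
qed

section \<open>Sequences of levels and their polygons\<close>

definition initial :: "'k levels \<Rightarrow> 'k poly \<Rightarrow> int" where
  "initial L P = (case L of [] \<Rightarrow> 0 | (\<phi>, lam) # L' \<Rightarrow>
     \<lfloor>initial_abscissa (side lam (principal_polygon (val L') \<phi> P))\<rfloor>)"

text \<open>
  The twist that turns the residual polynomial, which starts at a varying abscissa, into a
  multiplicative and additive invariant of initial forms.
\<close>

definition twist :: "'k levels \<Rightarrow> 'k poly \<Rightarrow> int" where
  "twist L P = (case L of [] \<Rightarrow> 0 | (\<phi>, lam) # L' \<Rightarrow>
     (initial L P - ell L * val L P) div slope_e lam)"

text \<open>The invariant of the induction over the levels. The condition on the coefficients is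
  needed because a nonzero residual polynomial of degree below that of \<psi> is nonzero at the root
  of \<psi> only if it lies over the field where \<psi> is irreducible.\<close>

definition regular :: "'k levels \<Rightarrow> bool" where
  "regular L \<longleftrightarrow> residual_system (val L) (twist L) (res_poly L) (L = []) \<and>
     subfield_set (tower L) \<and> (\<forall>P. P \<noteq> 0 \<longrightarrow> poly_over (tower L) (res_poly L P))"

lemma regular_Nil: "regular []"
  unfolding regular_def
proof (intro conjI allI impI)
  have v: "val [] = gauss_val" by (intro ext) simp
  show "residual_system (val []) (twist []) (res_poly []) ([] = [])"
    unfolding v
  proof (rule residual_system.intro)
    show "graded gauss_val (\<lambda>P. if P = 0 then 0 else x powi twist [] P * poly (res_poly [] P) x)" for x
      using graded_gauss[of x] by (simp only: twist_def list.case)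
  qed (auto simp: twist_def res_poly_Nil_nonzero simp del: res_poly.simps)
qed (simp_all add: subfield_residue_field poly_over_res_poly_Nil del: res_poly.simps)

definition term_val :: "'k levels \<Rightarrow> 'k poly \<Rightarrow> 'k poly \<Rightarrow> nat \<Rightarrow> int" where
  "term_val L \<phi> P j = val L (adic_coeff \<phi> P j * \<phi> ^ j)"

lemma newton_polygon_points:
  "newton_polygon (val L) \<phi> P = lower_hull (points (adic_support \<phi> P) (term_val L \<phi> P))"
proof -
  have "{(of_nat j, of_int (val L (adic_coeff \<phi> P j * \<phi> ^ j))) | j. adic_coeff \<phi> P j \<noteq> 0} =
      points (adic_support \<phi> P) (term_val L \<phi> P)"
    by (auto simp: points_def adic_support_def term_val_def)
  then show ?thesis by (simp add: newton_polygon_def)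
qed

abbreviation polygon_side :: "'k levels \<Rightarrow> 'k poly \<Rightarrow> rat \<Rightarrow> 'k poly \<Rightarrow> nat \<Rightarrow> nat \<Rightarrow> bool" where
  "polygon_side L \<phi> lam P \<equiv> side_of_points lam (adic_support \<phi> P) (term_val L \<phi> P)"

lemma polygon_side_exists:
  assumes "0 < degree \<phi>" "P \<noteq> 0"
  obtains s t where "polygon_side L \<phi> lam P s t"
  using side_of_points_exists[OF finite_adic_support[OF assms(1)] adic_support_nonempty[OF assms]] by metis

lemma
  assumes deg: "0 < degree \<phi>" and lam: "lam < 0" and side: "polygon_side L \<phi> lam P s t"
  shows side_principal_polygon: "side lam (principal_polygon (val L) \<phi> P) =
      side lam (lower_hull (points (adic_support \<phi> P) (term_val L \<phi> P)))"
    and initial_side: "initial ((\<phi>, lam) # L) P = int s"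
    and val_side: "val ((\<phi>, lam) # L) P = height_along lam (term_val L \<phi> P) s"
proof -
  note fin = finite_adic_support[OF deg, of P]
  show *: "side lam (principal_polygon (val L) \<phi> P) =
      side lam (lower_hull (points (adic_support \<phi> P) (term_val L \<phi> P)))"
    unfolding principal_polygon_def newton_polygon_points by (rule side_negative_part[OF fin side lam])
  show "initial ((\<phi>, lam) # L) P = int s"
    by (simp add: initial_def * initial_abscissa_side[OF side lam])
  have "of_int (slope_e lam) * (of_int (height_along lam (term_val L \<phi> P) s) / of_int (slope_e lam)) =
      (of_int (height_along lam (term_val L \<phi> P) s) :: real)"
    using negative_slope(2)[OF lam] by simp
  then show "val ((\<phi>, lam) # L) P = height_along lam (term_val L \<phi> P) s"
    by (simp add: * ordinate_side[OF side lam])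
qed

text \<open>Without a part of slope minus infinity \<phi> does not divide \<open>P\<close>, so the
  abscissa \<open>0\<close> occurs and must be the initial one.\<close>

lemma single_side_D:
  assumes deg: "0 < degree \<phi>" and lam: "lam < 0" and P: "P \<noteq> 0"
    and single: "single_side (val L) \<phi> lam P"
  obtains t where "polygon_side L \<phi> lam P 0 t" "0 < t" "\<And>j. j \<in> adic_support \<phi> P \<Longrightarrow> j \<le> t"
proof -
  obtain s t where st: "polygon_side L \<phi> lam P s t" using polygon_side_exists[OF deg P] by metis
  have eq: "lower_hull (points (adic_support \<phi> P) (term_val L \<phi> P)) =
      side lam (lower_hull (points (adic_support \<phi> P) (term_val L \<phi> P)))"
    and len: "0 < side_length (side lam (lower_hull (points (adic_support \<phi> P) (term_val L \<phi> P))))"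
    and ord: "poly_ord \<phi> P = 0"
    using single by (auto simp: single_side_def newton_polygon_points)
  note bounds = single_side_bounds[OF finite_adic_support[OF deg] st lam eq]
  have "\<not> \<phi> dvd P" using ord poly_ord_dvd_iff[OF deg P, of 1] by simp
  then have "0 \<in> adic_support \<phi> P" by (simp add: adic_support_def adic_coeff_def dvd_eq_mod_eq_0)
  then have "s = 0" using bounds by blast
  moreover have "s < t" using len unfolding side_length_side[OF st lam] by simp
  ultimately show ?thesis using that st bounds by blast
qed

end

section \<open>The higher levels\<close>

context montes_setting
begin

text \<open>What the next step requires of \<phi>. The degree bound keeps polynomials of smaller
  degree from vanishing at the root; the divisibility of \<open>val L \<phi>\<close> makes the
  exponent in \<open>shift_unit\<close> an exact quotient.\<close>

definition is_key :: "'k levels \<Rightarrow> 'k poly \<Rightarrow> bool" where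
  "is_key L \<phi> \<longleftrightarrow> monic_integral \<phi> \<and> 0 < degree \<phi> \<and> monic_irreducible_over (tower L) (psi L \<phi>) \<and>
     (\<forall>a. a \<noteq> 0 \<longrightarrow> degree a < degree \<phi> \<longrightarrow> degree (res_poly L a) < degree (psi L \<phi>)) \<and>
     (case L of [] \<Rightarrow> True | (\<phi>', lam') # L' \<Rightarrow> slope_e lam' dvd val L \<phi>)"

definition root :: "'k levels \<Rightarrow> 'k poly \<Rightarrow> 'l" where
  "root L \<phi> = root_of (psi L \<phi>)"

text \<open>The map \<rho> of the next augmentation: the twisted residual polynomial evaluated at
  the class of \<open>y\<close>.\<close>

definition lift_coeff :: "'k levels \<Rightarrow> 'k poly \<Rightarrow> 'k poly \<Rightarrow> 'l" where
  "lift_coeff L \<phi> P = (if P = 0 then 0 else root L \<phi> powi twist L P * poly (res_poly L P) (root L \<phi>))"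

text \<open>
  The residual coefficients are normalised by the ordinates of the points and not by the values of
  the coefficients of the development; the \<open>j\<close>-th one acquires the factor \<open>shift_unit L \<phi> ^ j\<close>.
\<close>

definition shift_unit :: "'k levels \<Rightarrow> 'k poly \<Rightarrow> 'l" where
  "shift_unit L \<phi> = (case L of [] \<Rightarrow> 1 | (\<phi>', lam') # L' \<Rightarrow>
     root L \<phi> powi (- (ell L * (val L \<phi> div slope_e lam'))))"

lemma key_polynomial_psi:
  assumes reg: "regular L" and key: "is_key L \<phi>"
  shows "key_polynomial (val L) (twist L) (res_poly L) (L = []) \<phi> (psi L \<phi>)
    (lead_coeff (res_poly L \<phi>)) (root L \<phi>)"
proof -
  have sys: "residual_system (val L) (twist L) (res_poly L) (L = [])"
    and F: "subfield_set (tower L)" and over: "\<And>P. P \<noteq> 0 \<Longrightarrow> poly_over (tower L) (res_poly L P)"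
    using reg by (auto simp: regular_def)
  have deg: "0 < degree \<phi>" and irr: "monic_irreducible_over (tower L) (psi L \<phi>)"
    and small: "\<And>a. a \<noteq> 0 \<Longrightarrow> degree a < degree \<phi> \<Longrightarrow> degree (res_poly L a) < degree (psi L \<phi>)"
    using key by (auto simp: is_key_def)
  then have degpsi: "0 < degree (psi L \<phi>)" by (simp add: monic_irreducible_over_def)
  have R: "res_poly L P \<noteq> 0" if "P \<noteq> 0" for P
    by (rule residual_system.R_nonzero[OF sys that])
  have "\<phi> \<noteq> 0" using deg by auto
  then have 1: "res_poly L \<phi> = smult (lead_coeff (res_poly L \<phi>)) (psi L \<phi>)"
    using R by (simp add: psi_def normalize_monic_def)
  have 2: "poly (psi L \<phi>) (root L \<phi>) = 0"
    unfolding root_def by (rule root_of_root[OF degpsi])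
  have 3: "poly (res_poly L a) (root L \<phi>) \<noteq> 0" if a: "a \<noteq> 0" "degree a < degree \<phi>" for a
    unfolding root_def by (rule poly_root_nonzero[OF F irr over[OF a(1)] R[OF a(1)] small[OF a]])
  show ?thesis
    by (intro key_polynomial.intro key_polynomial_axioms.intro sys deg degpsi 1 2 3)
qed

lemma augmentation_levels:
  assumes reg: "regular L" and key: "is_key L \<phi>" and lam: "lam < 0"
  shows "augmentation (val L) (lift_coeff L \<phi>) \<phi> lam (ell ((\<phi>, lam) # L)) (shift_unit L \<phi>)"
proof -
  interpret kp: key_polynomial "val L" "twist L" "res_poly L" "L = []" \<phi> "psi L \<phi>"
    "lead_coeff (res_poly L \<phi>)" "root L \<phi>"
    by (rule key_polynomial_psi[OF reg key])
  have z: "root L \<phi> \<noteq> 0 \<or> L = []" using kp.z_nonzero by blast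
  have "graded (val L) (lift_coeff L \<phi>)"
    using kp.graded[OF z] by (rule graded_cong) (simp_all add: lift_coeff_def)
  moreover have "shift_unit L \<phi> \<noteq> 0"
    using z by (auto simp: shift_unit_def split: list.split)
  moreover have powi: "root L \<phi> powi twist L P \<noteq> 0" for P
    using z by (auto simp: twist_def)
  then have "lift_coeff L \<phi> a \<noteq> 0" if "a \<noteq> 0" "degree a < degree \<phi>" for a
    using kp.nonroot[OF that] that by (simp add: lift_coeff_def)
  moreover have "lift_coeff L \<phi> \<phi> = 0"
  proof -
    have "poly (res_poly L \<phi>) (root L \<phi>) = 0" by (subst kp.R_phi) (simp add: kp.root)
    then show ?thesis by (simp add: lift_coeff_def)
  qed
  ultimately show ?thesis
    using kp.deg lam ell[OF lam, of \<phi> L]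
    by (intro augmentation.intro augmentation_axioms.intro) auto
qed

text \<open>The ordinate of the \<open>j\<close>-th point is the value of its coefficient plus
  \<open>j\<close> times the value of \<phi>. So the exponent in the residual coefficient differs
  from \<open>twist\<close> by a fixed integer times \<open>j\<close>, which is the power of
  \<open>shift_unit\<close>. At order \<open>0\<close> the value of \<phi> is \<open>0\<close> and
  nothing changes.\<close>

lemma res_coeff_eq:
  assumes reg: "regular L" and key: "is_key L \<phi>" and a: "adic_coeff \<phi> P j \<noteq> 0"
  shows "res_coeff L \<phi> P j =
    (if (of_nat j, of_int (term_val L \<phi> P j)) \<in> principal_polygon (val L) \<phi> P
     then shift_unit L \<phi> ^ j * lift_coeff L \<phi> (adic_coeff \<phi> P j) else 0)"
proof -
  interpret kp: key_polynomial "val L" "twist L" "res_poly L" "L = []" \<phi> "psi L \<phi>"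
    "lead_coeff (res_poly L \<phi>)" "root L \<phi>"
    by (rule key_polynomial_psi[OF reg key])
  define b where "b = adic_coeff \<phi> P j"
  have val: "term_val L \<phi> P j = val L b + int j * val L \<phi>"
    using a kp.phi_nonzero by (simp add: term_val_def b_def kp.w_mult kp.w_power)
  have zz: "root_of (normalize_monic (res_poly L \<phi>)) = root L \<phi>"
    by (simp add: root_def psi_def)
  show ?thesis
  proof (cases L)
    case Nil
    have "gauss_val \<phi> = 0" using key by (auto simp: is_key_def dest: monic_integral_facts)
    then have "term_val L \<phi> P j = gauss_val b" using val Nil by simp
    then show ?thesis
      using a zz Nil
      by (simp add: Let_def b_def shift_unit_def lift_coeff_def twist_def term_val_def)
  next
    case (Cons hd L')
    obtain \<phi>' lam' where hd: "hd = (\<phi>', lam')" by (cases hd)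
    note L = Cons[unfolded hd]
    define q where "q = val L \<phi> div slope_e lam'"
    have "slope_e lam' dvd val L \<phi>" using key L by (auto simp: is_key_def)
    then have q: "val L \<phi> = slope_e lam' * q" by (simp add: q_def)
    have z: "root L \<phi> \<noteq> 0" using kp.z_nonzero L by simp
    have pos: "slope_e lam' > 0" using quotient_of_denom_pos' by (simp add: slope_e_def)
    have eq: "initial L b - ell L * term_val L \<phi> P j =
        (initial L b - ell L * val L b) + slope_e lam' * (- (ell L * q * int j))"
      unfolding val q by (simp add: algebra_simps)
    have "(initial L b - ell L * term_val L \<phi> P j) div slope_e lam' =
        twist L b + - (ell L * q) * int j"
      unfolding eq div_mult_self2[OF pos[THEN less_imp_neq, symmetric]]
      by (simp add: twist_def L del: val.simps)
    moreover have "shift_unit L \<phi> = root L \<phi> powi (- (ell L * q))"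
      by (simp add: shift_unit_def L q_def del: val.simps)
    ultimately have "root L \<phi> powi ((initial L b - ell L * term_val L \<phi> P j) div slope_e lam') =
        root L \<phi> powi twist L b * shift_unit L \<phi> ^ j"
      by (simp only: power_int_add[OF disjI1[OF z]] power_int_mult power_int_of_nat)
    then show ?thesis
      using a zz unfolding L
      by (simp add: Let_def b_def lift_coeff_def term_val_def initial_def)
  qed
qed

text \<open>The bridge between the operators, which are read off from real polygons, and the
  discrete construction in \<open>augmentation\<close>.\<close>

lemma level_facts:
  assumes reg: "regular L" and key: "is_key L \<phi>" and lam: "lam < 0" and P: "P \<noteq> 0"
    and side: "polygon_side L \<phi> lam P s t"
  obtains d where "t = s + d * nat (slope_e lam)"
    "res_poly ((\<phi>, lam) # L) P = augmentation.aR (val L) (lift_coeff L \<phi>) \<phi> lam (shift_unit L \<phi>) P s d"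
    "degree (res_poly ((\<phi>, lam) # L) P) = d" "coeff (res_poly ((\<phi>, lam) # L) P) 0 \<noteq> 0"
proof -
  interpret ag: augmentation "val L" "lift_coeff L \<phi>" \<phi> lam "ell ((\<phi>, lam) # L)" "shift_unit L \<phi>"
    by (rule augmentation_levels[OF reg key lam])
  have u: "ag.u P = term_val L \<phi> P" by (intro ext) (simp add: ag.u_def term_val_def)
  note side' = side[folded u]
  note fin = finite_adic_support[OF ag.deg, of P]
  define e where "e = slope_e lam"
  obtain d where d: "t = s + d * nat e" unfolding e_def by (rule ag.aR_exact[OF P side'])
  have e: "0 < e" using ag.e_pos by (simp add: e_def)
  define S where "S = side lam (principal_polygon (val L) \<phi> P)"
  have S: "S = side lam (lower_hull (points (adic_support \<phi> P) (term_val L \<phi> P)))"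
    unfolding S_def by (rule side_principal_polygon[OF ag.deg lam side])
  have s: "nat \<lfloor>initial_abscissa S\<rfloor> = s" by (simp add: S initial_abscissa_side[OF side lam])
  have "side_length S / of_int e = of_nat d"
    using e by (simp add: S side_length_side[OF side lam] d)
  then have d': "nat \<lfloor>side_length S / of_int e\<rfloor> = d" by simp
  have c: "res_coeff L \<phi> P (s + k * nat e) = (if ag.on_line P (s + k * nat e)
      then shift_unit L \<phi> ^ (s + k * nat e) * lift_coeff L \<phi> (adic_coeff \<phi> P (s + k * nat e)) else 0)"
    if "k \<le> d" for k
  proof (cases "s + k * nat e \<in> adic_support \<phi> P")
    case True
    have j: "s \<le> s + k * nat e" "s + k * nat e \<le> t" using that by (auto simp: d)
    have "(of_nat (s + k * nat e), of_int (term_val L \<phi> P (s + k * nat e))) \<in> principal_polygon (val L) \<phi> P \<longleftrightarrow>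
        ag.on_line P (s + k * nat e)"
      unfolding principal_polygon_def newton_polygon_points
        point_on_negative_part_iff[OF fin side lam True j] ag.on_line_def ag.aw_side[OF P side'] u
      using True by simp
    then show ?thesis
      using True res_coeff_eq[OF reg key] by (simp add: adic_support_def del: res_coeff.simps)
  next
    case False
    then show ?thesis by (simp add: adic_support_def ag.on_line_def Let_def)
  qed
  have "res_poly ((\<phi>, lam) # L) P = (\<Sum>k\<le>d. monom (res_coeff L \<phi> P (s + k * nat e)) k)"
    unfolding res_poly.simps residual_def Let_def S_def[symmetric] s e_def[symmetric] d' ..
  also have "\<dots> = ag.aR P s d"
    unfolding ag.aR_def e_def[symmetric] by (intro sum.cong) (simp_all add: c del: res_coeff.simps)
  finally have R: "res_poly ((\<phi>, lam) # L) P = ag.aR P s d" .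
  show ?thesis
    using that[of d] d R ag.coeff_aR_nonzero[OF P side' d[unfolded e_def]] by (simp add: e_def)
qed

text \<open>The twisted residual polynomial of the new level is the map \<open>aT\<close> of the
  augmentation, hence graded. Its coefficients are values at the root of polynomials over the
  previous field, so they lie in the next field of the tower.\<close>

lemma regular_Cons:
  assumes reg: "regular L" and key: "is_key L \<phi>" and lam: "lam < 0"
  shows "regular ((\<phi>, lam) # L)"
proof -
  interpret ag: augmentation "val L" "lift_coeff L \<phi>" \<phi> lam "ell ((\<phi>, lam) # L)" "shift_unit L \<phi>"
    by (rule augmentation_levels[OF reg key lam])
  have u: "ag.u P = term_val L \<phi> P" for P by (intro ext) (simp add: ag.u_def term_val_def)
  define L1 where "L1 = (\<phi>, lam) # L"
  have facts: "val L1 P = ag.aw P" "coeff (res_poly L1 P) 0 \<noteq> 0"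
    "x \<noteq> 0 \<Longrightarrow> x powi twist L1 P * poly (res_poly L1 P) x = ag.aT x P"
    "\<exists>s d. res_poly L1 P = ag.aR P s d" if P: "P \<noteq> 0" for P x
  proof -
    obtain s t where st: "polygon_side L \<phi> lam P s t" using polygon_side_exists[OF ag.deg P] by metis
    note st' = st[folded u]
    obtain d where d: "t = s + d * nat (slope_e lam)" "res_poly L1 P = ag.aR P s d"
      "coeff (res_poly L1 P) 0 \<noteq> 0"
      unfolding L1_def by (rule level_facts[OF reg key lam P st])
    show val: "val L1 P = ag.aw P"
      unfolding L1_def val_side[OF ag.deg lam st] ag.aw_side[OF P st'] u ..
    show "coeff (res_poly L1 P) 0 \<noteq> 0" by (rule d(3))
    have "twist L1 P = ag.expo (ag.aw P) s"
      by (simp add: twist_def L1_def initial_side[OF ag.deg lam st] ag.expo_def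
          val[unfolded L1_def] del: val.simps)
    then show "x powi twist L1 P * poly (res_poly L1 P) x = ag.aT x P" if "x \<noteq> 0"
      using ag.aT_aR[OF P st' d(1) that] d(2) by simp
    show "\<exists>s d. res_poly L1 P = ag.aR P s d" using d(2) by blast
  qed
  have sys: "residual_system (val L1) (twist L1) (res_poly L1) (L1 = [])"
  proof (rule residual_system.intro)
    fix x :: 'l assume "x \<noteq> 0 \<or> L1 = []"
    then have x: "x \<noteq> 0" by (simp add: L1_def)
    show "graded (val L1) (\<lambda>P. if P = 0 then 0 else x powi twist L1 P * poly (res_poly L1 P) x)"
      using ag.graded_aw[OF x]
      by (rule graded_cong) (use facts x in \<open>auto simp: ag.aT_def\<close>)
  next
    fix P :: "'k poly" assume "P \<noteq> 0"
    from facts(2)[OF this] show "res_poly L1 P \<noteq> 0" "coeff (res_poly L1 P) 0 \<noteq> 0" by auto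
  qed (simp add: L1_def)
  have F: "subfield_set (tower L)" and over: "\<And>P. P \<noteq> 0 \<Longrightarrow> poly_over (tower L) (res_poly L P)"
    using reg by (auto simp: regular_def)
  have irr: "monic_irreducible_over (tower L) (psi L \<phi>)" using key by (simp add: is_key_def)
  have tower: "tower L1 = quotient_field (tower L) (psi L \<phi>)" by (simp add: L1_def)
  have F1: "subfield_set (tower L1)" unfolding tower by (rule subfield_quotient_field[OF F irr])
  have z: "root L \<phi> \<in> tower L1" unfolding tower root_def by (rule root_in_quotient_field[OF F])
  have lift: "lift_coeff L \<phi> P \<in> tower L1" for P
  proof (cases "P = 0")
    case False
    have "poly (res_poly L P) (root L \<phi>) \<in> tower L1"
      unfolding tower root_def by (rule poly_in_quotient_field[OF over[OF False]])
    then show ?thesis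
      using False by (simp add: lift_coeff_def subfield_setD(3)[OF F1] subfield_set_powi[OF F1 z])
  qed (simp add: lift_coeff_def subfield_setD[OF F1])
  have shift: "shift_unit L \<phi> \<in> tower L1"
    using subfield_set_powi[OF F1 z] subfield_setD(2)[OF F1]
    by (auto simp: shift_unit_def simp del: val.simps split: list.split)
  have "poly_over (tower L1) (ag.aR P s d)" for P s d
    unfolding poly_over_def ag.coeff_aR
    by (auto simp: subfield_setD(1)[OF F1] intro!: subfield_setD(3)[OF F1] lift subfield_set_power[OF F1 shift])
  then have "poly_over (tower L1) (res_poly L1 P)" if "P \<noteq> 0" for P
    using facts(4)[OF that] by auto
  then show ?thesis using sys F1 unfolding regular_def L1_def by blast
qed

lemma is_key_Nil:
  assumes "monic_integral \<phi>" "monic_irreducible_over \<F> (red_poly \<phi>)"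
  shows "is_key [] \<phi>" "psi [] \<phi> = red_poly \<phi>"
proof -
  note m = monic_integral_facts[OF assms(1)]
  show psi: "psi [] \<phi> = red_poly \<phi>"
    unfolding psi_def m(3) normalize_monic_def m(5) by simp
  have "degree (res_poly [] a) \<le> degree a" for a
    unfolding res_poly_Nil scaled_def by (rule order_trans[OF degree_red_poly_le degree_smult_le])
  then show "is_key [] \<phi>"
    using assms m(4) unfolding is_key_def psi
    by (auto simp: monic_irreducible_over_def simp del: res_poly.simps intro: le_less_trans)
qed

text \<open>Let \<open>deg g = m e f\<close>. If \<open>deg a < m e f\<close>, the side of
  \<open>a\<close> ends at some \<open>t\<close> with \<open>t m \<le> deg a\<close>, so
  \<open>d e \<le> t < e f\<close> and the residual polynomial of \<open>a\<close> has degree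
  \<open>d < f\<close>. The side of \<open>g\<close> starts at abscissa \<open>0\<close>, where the
  height is a multiple of \<open>e\<close>; this gives the divisibility.\<close>

lemma is_key_Cons:
  assumes reg: "regular L" and key: "is_key L \<phi>" and lam: "lam < 0"
    and g: "monic_integral g" and single: "single_side (val L) \<phi> lam g"
    and irr: "monic_irreducible_over (tower ((\<phi>, lam) # L)) (psi ((\<phi>, lam) # L) g)"
    and deg: "int (degree g) = int (degree \<phi>) * slope_e lam * int (degree (psi ((\<phi>, lam) # L) g))"
  shows "is_key ((\<phi>, lam) # L) g"
proof -
  have deg\<phi>: "0 < degree \<phi>" using key by (simp add: is_key_def)
  have e: "0 < slope_e lam" using negative_slope(2)[OF lam] .
  have degpsi: "0 < degree (psi ((\<phi>, lam) # L) g)" using irr by (simp add: monic_irreducible_over_def)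
  have "0 < int (degree g)" unfolding deg using deg\<phi> e degpsi by simp
  then have degg: "0 < degree g" by simp
  then have g0: "g \<noteq> 0" by auto
  obtain t where "polygon_side L \<phi> lam g 0 t" by (rule single_side_D[OF deg\<phi> lam g0 single])
  then have "val ((\<phi>, lam) # L) g = slope_e lam * term_val L \<phi> g 0"
    using val_side[OF deg\<phi> lam] by (simp add: height_along_def del: val.simps)
  then have dvd: "slope_e lam dvd val ((\<phi>, lam) # L) g" by (simp del: val.simps)
  have "degree (res_poly ((\<phi>, lam) # L) a) < degree (psi ((\<phi>, lam) # L) g)"
    if a: "a \<noteq> 0" "degree a < degree g" for a
  proof -
    obtain s t where st: "polygon_side L \<phi> lam a s t" using polygon_side_exists[OF deg\<phi> a(1)] by metis
    obtain d where d: "t = s + d * nat (slope_e lam)" "degree (res_poly ((\<phi>, lam) # L) a) = d"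
      by (rule level_facts[OF reg key lam a(1) st])
    have "t \<in> adic_support \<phi> a" using st by (simp add: side_of_points_def)
    then have "t * degree \<phi> < degree g" using adic_support_degree[OF deg\<phi>] a(2) by fastforce
    moreover have "d * nat (slope_e lam) * degree \<phi> \<le> t * degree \<phi>" by (simp add: d)
    moreover have "degree g = degree (psi ((\<phi>, lam) # L) g) * nat (slope_e lam) * degree \<phi>"
    proof -
      have "int (degree g) = int (degree (psi ((\<phi>, lam) # L) g) * nat (slope_e lam) * degree \<phi>)"
        using deg e by simp
      then show ?thesis by (simp only: of_nat_eq_iff)
    qed
    ultimately have "d * (nat (slope_e lam) * degree \<phi>) <
        degree (psi ((\<phi>, lam) # L) g) * (nat (slope_e lam) * degree \<phi>)"
      by (simp only: mult.assoc)
    then show ?thesis using d(2) by simp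
  qed
  then show ?thesis using g degg irr dvd by (simp add: is_key_def del: val.simps res_poly.simps tower.simps)
qed

lemma valid_levels_regular:
  "valid_levels L \<Longrightarrow> regular L \<and> (\<forall>\<phi> lam L'. L = (\<phi>, lam) # L' \<longrightarrow> is_key L' \<phi> \<and> regular L' \<and> lam < 0)"
proof (induction L rule: valid_levels.induct)
  case 1
  show ?case by (simp add: regular_Nil)
next
  case (2 \<phi> lam)
  then have "is_key [] \<phi>" "lam < 0" by (auto intro: is_key_Nil)
  then show ?case using regular_Cons[OF regular_Nil] regular_Nil by auto
next
  case (3 \<phi> lam \<phi>' lam' L)
  then have IH: "regular ((\<phi>', lam') # L)" "is_key L \<phi>'" "regular L" "lam' < 0" by auto
  have "is_key ((\<phi>', lam') # L) \<phi>"
    using 3(2) by (intro is_key_Cons IH) auto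
  then show ?case using regular_Cons[OF IH(1)] IH(1) 3(2) by auto
qed

end

section \<open>Types and their extensions\<close>

lemma poly_ord_power:
  fixes g :: "'a::field poly"
  assumes "0 < degree g" "c \<noteq> 0"
  shows "poly_ord g (smult c (g ^ a)) = a"
proof (rule poly_ord_eqI)
  have g: "g \<noteq> 0" using assms by auto
  then show "smult c (g ^ a) \<noteq> 0" using assms by simp
  show "g ^ a dvd smult c (g ^ a)" by (simp add: dvd_smult)
  show "\<not> g ^ Suc a dvd smult c (g ^ a)"
  proof
    assume "g ^ Suc a dvd smult c (g ^ a)"
    then have "g ^ Suc a dvd g ^ a" using assms(2) by (rule dvd_smult_cancel)
    then have "degree (g ^ Suc a) \<le> degree (g ^ a)" using g by (intro dvd_imp_degree_le) auto
    then show False using assms g by (simp add: degree_power_eq del: power_Suc)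
  qed
qed (rule assms(1))

context montes_setting
begin

lemma valid_levels_ConsD:
  assumes "valid_levels ((\<phi>, lam) # L)"
  shows "valid_levels L" "regular L" "is_key L \<phi>" "lam < 0" "regular ((\<phi>, lam) # L)"
    "monic_integral \<phi>" "0 < degree \<phi>"
proof -
  have "regular ((\<phi>, lam) # L) \<and> is_key L \<phi> \<and> regular L \<and> lam < 0"
    using valid_levels_regular[OF assms] by blast
  then show "regular L" "is_key L \<phi>" "lam < 0" "regular ((\<phi>, lam) # L)"
    "monic_integral \<phi>" "0 < degree \<phi>"
    unfolding is_key_def by blast+
  show "valid_levels L"
  proof (cases L)
    case (Cons l L')
    then show ?thesis using assms by (cases l) simp
  qed simp
qed

text \<open>Taken together, these facts identify the multiplicity with the abscissa at which the
  principal polygon ends.\<close>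

lemma omega_polygon_end:
  assumes reg: "regular L" and key: "is_key L \<phi>" and P: "P \<noteq> 0"
  shows "omega (L, psi L \<phi>) P \<in> adic_support \<phi> P"
    and "j \<in> adic_support \<phi> P \<Longrightarrow>
      term_val L \<phi> P (omega (L, psi L \<phi>) P) \<le> term_val L \<phi> P j"
    and "j \<in> adic_support \<phi> P \<Longrightarrow> j < omega (L, psi L \<phi>) P \<Longrightarrow>
      term_val L \<phi> P (omega (L, psi L \<phi>) P) < term_val L \<phi> P j"
proof -
  interpret kp: key_polynomial "val L" "twist L" "res_poly L" "L = []" \<phi> "psi L \<phi>"
    "lead_coeff (res_poly L \<phi>)" "root L \<phi>"
    by (rule key_polynomial_psi[OF reg key])
  have "\<exists>s. s \<in> adic_support \<phi> P \<and>
      (\<forall>j\<in>adic_support \<phi> P. term_val L \<phi> P s \<le> term_val L \<phi> P j \<and>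
        (j < s \<longrightarrow> term_val L \<phi> P s < term_val L \<phi> P j)) \<and>
      poly_ord (psi L \<phi>) (res_poly L P) = s"
    unfolding term_val_def by (rule kp.multiplicity_eq_polygon_end[OF P]) blast
  then obtain s where s: "s \<in> adic_support \<phi> P"
    "\<And>j. j \<in> adic_support \<phi> P \<Longrightarrow> term_val L \<phi> P s \<le> term_val L \<phi> P j"
    "\<And>j. j \<in> adic_support \<phi> P \<Longrightarrow> j < s \<Longrightarrow> term_val L \<phi> P s < term_val L \<phi> P j"
    "poly_ord (psi L \<phi>) (res_poly L P) = s"
    by blast
  have "omega (L, psi L \<phi>) P = s" by (simp add: omega_def s(4))
  then show "omega (L, psi L \<phi>) P \<in> adic_support \<phi> P"
    "j \<in> adic_support \<phi> P \<Longrightarrow> term_val L \<phi> P (omega (L, psi L \<phi>) P) \<le> term_val L \<phi> P j"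
    "j \<in> adic_support \<phi> P \<Longrightarrow> j < omega (L, psi L \<phi>) P \<Longrightarrow>
      term_val L \<phi> P (omega (L, psi L \<phi>) P) < term_val L \<phi> P j"
    using s by auto
qed

text \<open>Beyond the first abscissa of least ordinate the term \<open>e u\<close> does not
  decrease below its value there and \<open>h j\<close> is strictly larger, so no line of negative
  slope is supported there.\<close>

lemma side_end_le_omega:
  assumes reg: "regular L" and key: "is_key L \<phi>" and lam: "lam < 0" and P: "P \<noteq> 0"
    and side: "polygon_side L \<phi> lam P s t"
  shows "t \<le> omega (L, psi L \<phi>) P"
proof (rule ccontr)
  define r where "r = omega (L, psi L \<phi>) P"
  assume "\<not> t \<le> omega (L, psi L \<phi>) P"
  then have "r < t" by (simp add: r_def)
  note om = omega_polygon_end[OF reg key P, folded r_def]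
  have t: "t \<in> adic_support \<phi> P" and min: "height_along lam (term_val L \<phi> P) t \<le> height_along lam (term_val L \<phi> P) r"
    using side om(1) by (auto simp: side_of_points_def)
  have "slope_e lam * term_val L \<phi> P r \<le> slope_e lam * term_val L \<phi> P t"
    using om(2)[OF t] negative_slope(2)[OF lam] by simp
  moreover have "slope_h lam * int r < slope_h lam * int t"
    using \<open>r < t\<close> negative_slope(1)[OF lam] by simp
  ultimately show False using min unfolding height_along_def by linarith
qed

text \<open>A power \<open>\<psi> ^ r\<close> divides a residual polynomial of degree
  \<open>d\<close>, so \<open>r \<le> d\<close>, and \<open>t = s + d e\<close>. The factor
  \<open>e\<close> is retained because it is needed to compare the product of all ramification
  indices with the degree of \<open>f\<close>.\<close>

lemma omega_le_side_end:
  assumes reg: "regular L" and key: "is_key L \<phi>" and lam: "lam < 0" and P: "P \<noteq> 0"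
    and side: "polygon_side L \<phi> lam P s t" and psi: "0 < degree \<psi>"
  shows "omega ((\<phi>, lam) # L, \<psi>) P * nat (slope_e lam) \<le> t"
proof -
  define r where "r = omega ((\<phi>, lam) # L, \<psi>) P"
  define R where "R = res_poly ((\<phi>, lam) # L) P"
  obtain d where d: "t = s + d * nat (slope_e lam)" "degree R = d" "coeff R 0 \<noteq> 0"
    unfolding R_def by (rule level_facts[OF reg key lam P side])
  then have "R \<noteq> 0" by auto
  have "r = poly_ord \<psi> R" by (simp add: r_def omega_def R_def del: res_poly.simps)
  then have "\<psi> ^ r dvd R" using poly_ord_dvd_iff[OF psi \<open>R \<noteq> 0\<close>] by blast
  then have "degree (\<psi> ^ r) \<le> d" using dvd_imp_degree_le[OF _ \<open>R \<noteq> 0\<close>] d(2) by blast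
  moreover have "degree (\<psi> ^ r) = r * degree \<psi>" using psi by (intro degree_power_eq) auto
  moreover have "r * 1 \<le> r * degree \<psi>" using psi by (intro mult_le_mono2) simp
  ultimately have "r \<le> d" by linarith
  then have "r * nat (slope_e lam) \<le> d * nat (slope_e lam)" by (rule mult_le_mono1)
  then show ?thesis unfolding d(1) r_def by (rule trans_le_add2)
qed

lemma omega_mono:
  assumes reg: "regular L" and key: "is_key L \<phi>" and lam: "lam < 0" and P: "P \<noteq> 0"
    and psi: "0 < degree \<psi>"
  shows "omega ((\<phi>, lam) # L, \<psi>) P \<le> omega (L, psi L \<phi>) P"
proof -
  have deg: "0 < degree \<phi>" using key by (simp add: is_key_def)
  obtain s t where st: "polygon_side L \<phi> lam P s t" using polygon_side_exists[OF deg P] by metis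
  have "1 \<le> nat (slope_e lam)" using negative_slope(2)[OF lam] by simp
  then have "omega ((\<phi>, lam) # L, \<psi>) P * 1 \<le> omega ((\<phi>, lam) # L, \<psi>) P * nat (slope_e lam)"
    by (rule mult_le_mono2)
  also have "\<dots> \<le> t" by (rule omega_le_side_end[OF reg key lam P st psi])
  also have "\<dots> \<le> omega (L, psi L \<phi>) P" by (rule side_end_le_omega[OF reg key lam P st])
  finally show ?thesis by simp
qed

text \<open>A single side runs from \<open>0\<close> to the last abscissa \<open>t\<close>, which is
  then also the end of the principal polygon; and \<open>t = d e\<close>, where \<open>d\<close> is
  the degree of the residual polynomial.\<close>

lemma degree_single_side:
  assumes val: "valid_levels ((\<phi>, lam) # L)" and P: "P \<noteq> 0"
    and deg: "degree P = degree \<phi> * omega (L, psi L \<phi>) P"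
    and single: "single_side (val L) \<phi> lam P"
  shows "degree P = degree \<phi> * nat (slope_e lam) * degree (res_poly ((\<phi>, lam) # L) P)"
proof -
  note v = valid_levels_ConsD[OF val]
  obtain t where t: "polygon_side L \<phi> lam P 0 t" "\<And>j. j \<in> adic_support \<phi> P \<Longrightarrow> j \<le> t"
    by (rule single_side_D[OF v(7) v(4) P single]) blast
  have "omega (L, psi L \<phi>) P = t"
    using side_end_le_omega[OF v(2,3,4) P t(1)] t(2) omega_polygon_end(1)[OF v(2,3) P]
    by (intro antisym) auto
  moreover obtain d where "t = 0 + d * nat (slope_e lam)" "degree (res_poly ((\<phi>, lam) # L) P) = d"
    by (rule level_facts[OF v(2,3,4) P t(1)])
  ultimately show ?thesis using deg by (simp del: res_poly.simps)
qed

text \<open>A representative is defined by its polygons and residual polynomials alone, whereas a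
  level must have degree \<open>m e f\<close>. This induction over the levels recovers the
  degree.\<close>

lemma has_type_degree:
  assumes "valid_levels ((\<phi>, lam) # L)" "monic_integral P" "has_type L (psi L \<phi>) P"
  shows "degree P = degree \<phi> * omega (L, psi L \<phi>) P"
  using assms(1,3)
proof (induction L arbitrary: \<phi> lam)
  case Nil
  have m: "monic_integral \<phi>" and irr: "monic_irreducible_over \<F> (red_poly \<phi>)" using Nil by auto
  have psi: "psi [] \<phi> = red_poly \<phi>" by (rule is_key_Nil[OF m irr])
  note m\<phi> = monic_integral_facts[OF m] and mP = monic_integral_facts[OF assms(2)]
  obtain a where a: "red_poly P = red_poly \<phi> ^ a" using Nil(2) psi by auto
  have degpos: "0 < degree (red_poly \<phi>)" using irr by (simp add: monic_irreducible_over_def)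
  have "omega ([], psi [] \<phi>) P = poly_ord (red_poly \<phi>) (smult 1 (red_poly \<phi> ^ a))"
    unfolding omega_def psi fst_conv snd_conv mP(3) a by simp
  then have "omega ([], psi [] \<phi>) P = a" using poly_ord_power[OF degpos, of 1 a] by simp
  moreover have "degree P = degree (red_poly \<phi> ^ a)" using mP(4) a by simp
  moreover have "\<dots> = a * degree (red_poly \<phi>)" using degpos by (intro degree_power_eq) auto
  ultimately show ?case using m\<phi>(4) by simp
next
  case (Cons l L)
  obtain \<phi>' lam' where l: "l = (\<phi>', lam')" by (cases l)
  note val = Cons.prems(1)[unfolded l] and ht = Cons.prems(2)[unfolded l]
  note v = valid_levels_ConsD[OF val]
  define \<psi> where "\<psi> = psi ((\<phi>', lam') # L) \<phi>"
  have P0: "P \<noteq> 0" using monic_integral_facts(1)[OF assms(2)] .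
  have ht': "has_type L (psi L \<phi>') P" "single_side (val L) \<phi>' lam' P"
    using ht by auto
  obtain a c where a: "c \<noteq> 0" "res_poly ((\<phi>', lam') # L) P = smult c (\<psi> ^ a)"
    using ht by (auto simp: \<psi>_def simp del: res_poly.simps)
  have irr: "monic_irreducible_over (tower ((\<phi>', lam') # L)) \<psi>"
    and degphi: "int (degree \<phi>) = int (degree \<phi>') * slope_e lam' * int (degree \<psi>)"
    using val by (auto simp: \<psi>_def)
  have degpos: "0 < degree \<psi>" using irr by (simp add: monic_irreducible_over_def)
  have degP: "degree P = degree \<phi>' * nat (slope_e lam') * degree (res_poly ((\<phi>', lam') # L) P)"
    using degree_single_side[OF v(1) P0 Cons.IH[OF v(1) ht'(1)] ht'(2)] .
  have "degree (res_poly ((\<phi>', lam') # L) P) = a * degree \<psi>"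
  proof -
    have "\<psi> \<noteq> 0" using degpos by auto
    then show ?thesis unfolding a(2) using a(1) by (simp add: degree_power_eq)
  qed
  moreover have "degree \<phi> = degree \<phi>' * nat (slope_e lam') * degree \<psi>"
  proof -
    have "0 < slope_e lam'" using negative_slope(2) valid_levels_ConsD(4)[OF v(1)] by blast
    then have "int (degree \<phi>) = int (degree \<phi>' * nat (slope_e lam') * degree \<psi>)"
      using degphi by simp
    then show ?thesis by (simp only: of_nat_eq_iff)
  qed
  moreover have "omega ((\<phi>', lam') # L, \<psi>) P = a"
    unfolding omega_def fst_conv snd_conv a(2) by (rule poly_ord_power[OF degpos a(1)])
  ultimately show ?case using degP unfolding l \<psi>_def[symmetric] by (simp del: res_poly.simps)
qed

text \<open>A representative, with any negative slope, can serve as the next level, and the type is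
  recovered from it.\<close>

lemma representative_levels:
  assumes t: "is_type (L, \<psi>)" and rep: "representative (L, \<psi>) g" and lam: "lam < 0"
  shows "psi L g = \<psi>" "valid_levels ((g, lam) # L)"
proof -
  have L: "valid_levels L" and irr: "monic_irreducible_over (tower L) \<psi>" using t by (auto simp: is_type_def)
  have g: "monic_integral g" using rep by (simp add: representative_def)
  have degpsi: "0 < degree \<psi>" and lc: "lead_coeff \<psi> = 1" using irr by (auto simp: monic_irreducible_over_def)
  have "psi L g = \<psi> \<and> valid_levels ((g, lam) # L)"
  proof (cases L)
    case Nil
    then have "red_poly g = \<psi>" using rep by (simp add: representative_def)
    then show ?thesis using is_key_Nil[OF g] irr g lam Nil by auto
  next
    case (Cons l L')
    obtain \<phi> lam' where l: "l = (\<phi>, lam')" by (cases l)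
    have ht: "has_type ((\<phi>, lam') # L') \<psi> g"
      using rep Cons by (simp add: representative_def l del: has_type.simps)
    obtain c where c: "c \<noteq> 0" "res_poly L g = smult c \<psi>"
      using rep Cons unfolding representative_def by (auto simp del: res_poly.simps)
    have psi: "psi L g = \<psi>" using c lc by (simp add: psi_def normalize_monic_def)
    note v = valid_levels_ConsD[OF L[unfolded Cons l]]
    have g0: "g \<noteq> 0" using monic_integral_facts(1)[OF g] .
    have ht': "has_type L' (psi L' \<phi>) g" "single_side (val L') \<phi> lam' g" using ht by auto
    have "degree g = degree \<phi> * nat (slope_e lam') * degree (res_poly ((\<phi>, lam') # L') g)"
      using degree_single_side[OF L[unfolded Cons l] g0
          has_type_degree[OF L[unfolded Cons l] g ht'(1)] ht'(2)] .
    also have "degree (res_poly ((\<phi>, lam') # L') g) = degree \<psi>"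
      using c by (simp add: Cons l del: res_poly.simps)
    finally have "int (degree g) = int (degree \<phi>) * slope_e lam' * int (degree \<psi>)"
      using negative_slope(2)[OF v(4)] by simp
    then show ?thesis
      using psi irr L g lam ht'(2) unfolding Cons l by (simp del: val.simps tower.simps)
  qed
  then show "psi L g = \<psi>" "valid_levels ((g, lam) # L)" by auto
qed

lemma coeff_res_poly_0:
  assumes val: "valid_levels ((\<phi>, lam) # L)" and P: "P \<noteq> 0"
  shows "coeff (res_poly ((\<phi>, lam) # L) P) 0 \<noteq> 0"
proof -
  note v = valid_levels_ConsD[OF val]
  obtain s t where "polygon_side L \<phi> lam P s t" using polygon_side_exists[OF v(7) P] by metis
  then show ?thesis by (rule level_facts[OF v(2,3,4) P])
qed

lemma extension_exists:
  assumes t: "is_type (L, \<psi>)" and rep: "representative (L, \<psi>) g" and f: "f \<noteq> 0"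
    and om: "2 \<le> omega (L, \<psi>) f" and sq: "\<not> g ^ 2 dvd f"
  obtains lam \<psi>' where "is_type ((g, lam) # L, \<psi>')" "0 < omega ((g, lam) # L, \<psi>') f"
proof -
  have val: "valid_levels ((g, lam) # L)" and psi: "psi L g = \<psi>" if "lam < 0" for lam
    using representative_levels[OF t rep that] by auto
  have "(-1::rat) < 0" by simp
  note v = valid_levels_ConsD[OF val[OF this]] and psi = psi[OF this]
  define r where "r = omega (L, \<psi>) f"
  note last = omega_polygon_end[OF v(2,3) f, unfolded psi, folded r_def]
  have fin: "finite (adic_support g f)" by (rule finite_adic_support[OF v(7)])
  have "\<exists>j\<in>adic_support g f. j < r"
  proof (rule ccontr)
    assume "\<not> (\<exists>j\<in>adic_support g f. j < r)"
    then have "2 \<le> j" if "j \<in> adic_support g f" for j using om that by (fastforce simp: r_def)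
    then have "g ^ 2 dvd (\<Sum>j\<in>adic_support g f. adic_coeff g f j * g ^ j)"
      by (intro dvd_sum dvd_mult le_imp_power_dvd)
    then show False using sq adic_expansion[OF v(7), of f] by simp
  qed
  then obtain j0 where j0: "j0 \<in> adic_support g f" "j0 < r" by blast
  \<comment> \<open>The horizontal line through the point at \<open>r\<close> satisfies the
    hypotheses: ordinates are larger to its left and not smaller to its right. The side obtained is
    the last one of negative slope.\<close>
  obtain lam i where lam: "lam < 0" and side: "polygon_side L g lam f i r" and ir: "i < r"
  proof (rule steeper_side_exists[of "adic_support g f" r j0 0 "term_val L g f"])
    fix j assume "j \<in> adic_support g f" "j < r"
    then show "0 * of_nat j < 0 * of_nat r + (of_int (term_val L g f j) :: rat) - of_int (term_val L g f r)"
      using last(3) by simp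
  next
    fix j assume "j \<in> adic_support g f" "r < j"
    then show "0 * of_nat j \<le> 0 * of_nat r + (of_int (term_val L g f j) :: rat) - of_int (term_val L g f r)"
      using last(2) by simp
  qed (use fin last(1) j0 in auto)
  note v' = valid_levels_ConsD[OF val[OF lam]]
  define L1 where "L1 = (g, lam) # L"
  obtain d where d: "r = i + d * nat (slope_e lam)" "degree (res_poly L1 f) = d" "coeff (res_poly L1 f) 0 \<noteq> 0"
    unfolding L1_def by (rule level_facts[OF v(2,3) lam f side])
  have "0 < degree (res_poly L1 f)" using d ir by (cases d) auto
  moreover have reg: "subfield_set (tower L1)" "poly_over (tower L1) (res_poly L1 f)"
    using v'(5) f by (auto simp: regular_def L1_def simp del: tower.simps res_poly.simps)
  ultimately obtain \<psi>' where \<psi>': "monic_irreducible_over (tower L1) \<psi>'" "\<psi>' dvd res_poly L1 f"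
    using irreducible_factor_over by blast
  have R0: "res_poly L1 f \<noteq> 0" using d(3) by auto
  \<comment> \<open>The residual polynomial starts at the initial abscissa of the side, so its
    constant term is nonzero and \<open>y\<close> is not a factor.\<close>
  have "\<psi>' \<noteq> monom 1 1"
  proof
    assume "\<psi>' = monom 1 1"
    then have "poly (res_poly L1 f) 0 = 0" using \<psi>'(2) by (auto elim!: dvdE simp: poly_monom)
    then show False using d(3) by (simp add: poly_0_coeff_0)
  qed
  then have "is_type (L1, \<psi>')"
    using val[OF lam] \<psi>'(1) by (simp add: is_type_def L1_def del: valid_levels.simps tower.simps)
  moreover have "0 < degree \<psi>'" using \<psi>'(1) by (simp add: monic_irreducible_over_def)
  then have "0 < omega (L1, \<psi>') f"
    using poly_ord_dvd_iff[OF _ R0, of \<psi>' 1] \<psi>'(2) by (simp add: omega_def)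
  ultimately show ?thesis using that unfolding L1_def by blast
qed

end

section \<open>The bound for the order\<close>

lemma coprime_poly_bezout:
  fixes f g :: "'a::field poly"
  assumes "coprime f g"
  obtains A B where "A * f + B * g = 1"
proof -
  define I where "I = (\<lambda>h. \<exists>A B. h = A * f + B * g)"
  have I_f: "I f" unfolding I_def by (intro exI[of _ 1] exI[of _ 0]) simp
  have I_g: "I g" unfolding I_def by (intro exI[of _ 0] exI[of _ 1]) simp
  have "f \<noteq> 0 \<or> g \<noteq> 0" using assms by auto
  then have "\<exists>h. I h \<and> h \<noteq> 0" using I_f I_g by blast
  then obtain h where h: "I h" "h \<noteq> 0" and min: "\<And>k. I k \<Longrightarrow> k \<noteq> 0 \<Longrightarrow> degree h \<le> degree k"
    using ex_has_least_nat[of "\<lambda>h. I h \<and> h \<noteq> 0" _ degree] by blast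
  have dvd: "h dvd k" if k: "I k" for k
  proof -
    obtain A B C D where "h = A * f + B * g" "k = C * f + D * g" using h(1) k by (auto simp: I_def)
    then have "k mod h = (C - k div h * A) * f + (D - k div h * B) * g"
      unfolding minus_div_mult_eq_mod[symmetric, of k h] by (simp add: algebra_simps)
    then have "I (k mod h)" unfolding I_def by blast
    then have "k mod h = 0" using min degree_mod_less[OF h(2), of k] by fastforce
    then show ?thesis by (simp add: dvd_eq_mod_eq_0)
  qed
  have "is_unit h" using assms dvd[OF I_f] dvd[OF I_g] by (rule coprime_common_divisor)
  then obtain u where u: "1 = h * u" by (rule dvdE)
  obtain A B where "h = A * f + B * g" using h(1) by (auto simp: I_def)
  then have "u * A * f + u * B * g = 1" using u by (simp add: algebra_simps)
  then show ?thesis by (rule that)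
qed

section \<open>Integral developments, growth of the values and derivatives\<close>

context montes_setting
begin

lemma integral_poly_add: "integral_poly P \<Longrightarrow> integral_poly Q \<Longrightarrow> integral_poly (P + Q)"
  by (simp add: integral_poly_def integers_closed)

lemma integral_poly_pderiv:
  assumes "integral_poly P"
  shows "integral_poly (pderiv P)"
proof -
  have "of_nat n \<in> \<O>" for n by (induction n) (auto simp: integers_closed)
  then have "of_nat (Suc n) * coeff P (Suc n) \<in> \<O>" for n
    using assms integers_closed(4) unfolding integral_poly_def by blast
  then show ?thesis by (simp add: integral_poly_def coeff_pderiv)
qed

text \<open>Division by a monic polynomial creates no denominators: each step of Horner's recursion
  subtracts an integral multiple of \<open>g\<close>.\<close>

lemma integral_poly_div_mod:
  assumes g: "monic_integral g"
  shows "integral_poly P \<Longrightarrow> integral_poly (P div g) \<and> integral_poly (P mod g)"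
proof (induction P)
  case 0
  then show ?case by simp
next
  case (pCons a P)
  have pC: "integral_poly (pCons b Q) \<longleftrightarrow> b \<in> \<O> \<and> integral_poly Q" for b Q
    by (auto simp: integral_poly_def coeff_pCons split: nat.split) 
  have P: "a \<in> \<O>" "integral_poly (P div g)" "integral_poly (P mod g)" using pCons pC by auto
  have g': "g \<noteq> 0" "lead_coeff g = 1" "integral_poly g" using g by (auto simp: monic_integral_def)
  define c where "c = coeff (pCons a (P mod g)) (degree g)"
  have r: "integral_poly (pCons a (P mod g))" using P pC by simp
  then have c: "c \<in> \<O>" unfolding c_def integral_poly_def by blast
  have "pCons a P div g = pCons c (P div g)" using g' by (simp add: div_pCons_eq c_def)
  moreover have "pCons a P mod g = pCons a (P mod g) - smult c g" using g' by (simp add: mod_pCons_eq c_def)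
  moreover have "integral_poly (pCons a (P mod g) + smult (- c) g)"
    using r g'(3) c by (intro integral_poly_add) (auto simp: integral_poly_def integers_closed)
  ultimately show ?case using c P pC by simp
qed

lemma integral_poly_power: "integral_poly P \<Longrightarrow> integral_poly (P ^ n)"
  by (induction n) (auto simp: integral_poly_mult, simp add: integral_poly_def integers_closed)

lemma monic_integral_power: "monic_integral P \<Longrightarrow> monic_integral (P ^ n)"
  by (simp add: monic_integral_def integral_poly_power lead_coeff_power)

lemma integral_adic_coeff: "monic_integral \<phi> \<Longrightarrow> integral_poly P \<Longrightarrow> integral_poly (adic_coeff \<phi> P j)"
  using integral_poly_div_mod monic_integral_power by (simp add: adic_coeff_def)

text \<open>The product \<open>e_1 ... e_n\<close>; on constants \<open>val L\<close> is this
  multiple of \<open>v\<close>.\<close>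

fun ramification :: "'k levels \<Rightarrow> int" where
  "ramification [] = 1"
| "ramification ((\<phi>, lam) # L) = slope_e lam * ramification L"

text \<open>The quantity \<Gamma> of the overview. The value \<open>0\<close> without levels matches
  the fact that differentiation does not lower the Gauss valuation.\<close>

fun top_val :: "'k levels \<Rightarrow> int" where
  "top_val [] = 0"
| "top_val ((\<phi>, lam) # L) = val ((\<phi>, lam) # L) \<phi>"

lemma graded_val:
  assumes "regular L"
  shows "graded (val L) (\<lambda>P. if P = 0 then 0 else 1 powi twist L P * poly (res_poly L P) 1)"
  using assms residual_system.graded[of "val L" "twist L" "res_poly L" "L = []" 1] by (simp add: regular_def)

lemma above_val_add: "regular L \<Longrightarrow> above (val L) \<alpha> P \<Longrightarrow> above (val L) \<alpha> Q \<Longrightarrow> above (val L) \<alpha> (P + Q)"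
  using graded.above_add[OF graded_val] by blast

lemma above_val_sum: "regular L \<Longrightarrow> (\<And>i. i \<in> A \<Longrightarrow> above (val L) \<alpha> (g i)) \<Longrightarrow> above (val L) \<alpha> (sum g A)"
  using graded.above_sum[OF graded_val] by blast

lemma above_val_mult:
  "regular L \<Longrightarrow> above (val L) \<alpha> P \<Longrightarrow> above (val L) \<beta> Q \<Longrightarrow> above (val L) (\<alpha> + \<beta>) (P * Q)"
  using graded.above_mult[OF graded_val] by blast

lemma val_mult: "regular L \<Longrightarrow> P \<noteq> 0 \<Longrightarrow> Q \<noteq> 0 \<Longrightarrow> val L (P * Q) = val L P + val L Q"
  using graded.w_mult[OF graded_val] by blast

lemma val_power: "regular L \<Longrightarrow> P \<noteq> 0 \<Longrightarrow> val L (P ^ n) = int n * val L P"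
  using graded.w_power[OF graded_val] by blast

lemma val_one: "regular L \<Longrightarrow> val L 1 = 0"
  using graded.w_one[OF graded_val] by blast

lemma val_monomial:
  assumes val: "valid_levels ((\<phi>, lam) # L)" and a: "a \<noteq> 0" "degree a < degree \<phi>"
  shows "val ((\<phi>, lam) # L) (a * \<phi> ^ i) = slope_e lam * (val L a + int i * val L \<phi>) + slope_h lam * int i"
proof -
  note v = valid_levels_ConsD[OF val]
  have supp: "adic_support \<phi> (a * \<phi> ^ i) = {i}" by (rule adic_support_monomial[OF v(7) a])
  have "\<phi> \<noteq> 0" using v(7) by auto
  then have "term_val L \<phi> (a * \<phi> ^ i) i = val L a + int i * val L \<phi>"
    using a v(2,7) by (simp add: term_val_def adic_coeff_monomial val_mult val_power)
  moreover have "polygon_side L \<phi> lam (a * \<phi> ^ i) i i"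
    unfolding side_of_points_def supp by simp
  ultimately show ?thesis using val_side[OF v(7) v(4)] by (simp add: height_along_def del: val.simps)
qed

lemma top_val_eq:
  assumes "valid_levels ((\<phi>, lam) # L)"
  shows "top_val ((\<phi>, lam) # L) = slope_e lam * val L \<phi> + slope_h lam"
  using val_monomial[OF assms, of 1 1] valid_levels_ConsD(2,7)[OF assms]
  by (simp add: val_one del: val.simps)

lemma val_const:
  assumes "valid_levels L" "c \<noteq> 0"
  shows "val L [:c:] = ramification L * v c"
  using assms(1)
proof (induction L)
  case Nil
  have "set (coeffs [:c:]) - {0} = {c}" using assms(2) by auto
  then show ?case by (simp add: gauss_val_def)
next
  case (Cons l L)
  obtain \<phi> lam where l: "l = (\<phi>, lam)" by (cases l)
  note v = valid_levels_ConsD[OF Cons.prems[unfolded l]]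
  have "val ((\<phi>, lam) # L) [:c:] = slope_e lam * val L [:c:]"
    using val_monomial[OF Cons.prems[unfolded l], of "[:c:]" 0] assms(2) v(7) by (simp del: val.simps)
  then show ?case using Cons.IH[OF v(1)] unfolding l by (simp del: val.simps)
qed

lemma integral_above_val:
  assumes "valid_levels L" "integral_poly P"
  shows "above (val L) 0 P"
  using assms
proof (induction L arbitrary: P)
  case Nil
  then have "above gauss_val 0 P" by (simp add: integral_poly_iff)
  then show ?case by (simp add: above_def)
next
  case (Cons l L)
  obtain \<phi> lam where l: "l = (\<phi>, lam)" by (cases l)
  note val = Cons.prems(1)[unfolded l]
  note v = valid_levels_ConsD[OF val]
  have \<phi>: "integral_poly \<phi>" using v(6) by (simp add: monic_integral_def)
  have "\<phi> \<noteq> 0" using v(7) by auto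
  have val\<phi>: "0 \<le> val L \<phi>" using Cons.IH[OF v(1) \<phi>] \<open>\<phi> \<noteq> 0\<close> by (simp add: above_def)
  have e: "0 < slope_e lam" "0 < slope_h lam" using negative_slope[OF v(4)] by auto
  have "above (val ((\<phi>, lam) # L)) 0 (adic_coeff \<phi> P j * \<phi> ^ j)" for j
  proof (cases "adic_coeff \<phi> P j = 0")
    case False
    then have "0 \<le> val L (adic_coeff \<phi> P j)"
      using Cons.IH[OF v(1) integral_adic_coeff[OF v(6) Cons.prems(2)], of j] by (simp add: above_def)
    then show ?thesis
      using val_monomial[OF val False] degree_adic_coeff[OF v(7), of P j] False val\<phi> e
      by (simp add: above_def del: val.simps)
  qed (simp add: above_def)
  then have "above (val ((\<phi>, lam) # L)) 0 (\<Sum>j\<in>adic_support \<phi> P. adic_coeff \<phi> P j * \<phi> ^ j)"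
    by (intro above_val_sum v(5))
  then show ?case unfolding l adic_expansion[OF v(7), symmetric] .
qed

text \<open>At the end of the side the height is \<open>e v(a_t) + t (e v(\<phi>) + h)\<close>,
  where \<open>v\<close> is the previous valuation. The bracket is the value of \<phi> at the new
  level, and \<open>a_t\<close> is integral.\<close>

lemma val_ge_side_end:
  assumes val: "valid_levels ((\<phi>, lam) # L)" and P: "integral_poly P" "P \<noteq> 0"
    and side: "polygon_side L \<phi> lam P s t"
  shows "int t * top_val ((\<phi>, lam) # L) \<le> val ((\<phi>, lam) # L) P"
proof -
  note v = valid_levels_ConsD[OF val]
  define a where "a = adic_coeff \<phi> P t"
  have t: "t \<in> adic_support \<phi> P" using side by (simp add: side_of_points_def)
  have "\<phi> \<noteq> 0" using v(7) by auto
  have a: "a \<noteq> 0" using t by (simp add: adic_support_def a_def)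
  have "0 \<le> val L a"
    using integral_above_val[OF v(1) integral_adic_coeff[OF v(6) P(1)], of t] a by (simp add: above_def a_def)
  then have "0 \<le> slope_e lam * val L a" using negative_slope(2)[OF v(4)] by simp
  moreover have "val ((\<phi>, lam) # L) P = height_along lam (term_val L \<phi> P) t"
    using val_side[OF v(7) v(4) side] side by (simp add: side_of_points_def)
  moreover have "term_val L \<phi> P t = val L a + int t * val L \<phi>"
    using a v(2) \<open>\<phi> \<noteq> 0\<close> by (simp add: term_val_def a_def val_mult val_power)
  ultimately show ?thesis
    unfolding top_val_eq[OF val] height_along_def by (simp add: algebra_simps del: val.simps)
qed

text \<open>The side of the new \<phi> has positive length, so it ends at an abscissa of at least
  \<open>1\<close>.\<close>

lemma top_val_le_next:
  assumes "valid_levels ((\<phi>, lam) # L)" "0 \<le> top_val L"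
  shows "top_val L \<le> val L \<phi>"
proof (cases L)
  case Nil
  then show ?thesis
    using monic_integral_facts(2)[OF valid_levels_ConsD(6)[OF assms(1)]] by simp
next
  case (Cons l L')
  obtain \<phi>' lam' where l: "l = (\<phi>', lam')" by (cases l)
  note v = valid_levels_ConsD[OF assms(1)]
  note v' = valid_levels_ConsD[OF v(1)[unfolded Cons l]]
  have \<phi>: "integral_poly \<phi>" "\<phi> \<noteq> 0" using v(6,7) by (auto simp: monic_integral_def)
  have "single_side (val L') \<phi>' lam' \<phi>" using assms(1) unfolding Cons l by simp
  then obtain t where t: "polygon_side L' \<phi>' lam' \<phi> 0 t" "0 < t"
    by (rule single_side_D[OF v'(7,4) \<phi>(2)])
  have "1 * top_val L \<le> int t * top_val L" using t(2) assms(2) by (intro mult_right_mono) auto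
  also have "\<dots> \<le> val L \<phi>"
    unfolding Cons l by (rule val_ge_side_end[OF v(1)[unfolded Cons l] \<phi> t(1)])
  finally show ?thesis by simp
qed

text \<open>Passing to the next level gives \<open>e v(\<phi>) + h\<close>, which is at least the
  previous top value plus one.\<close>

lemma length_le_top_val: "valid_levels L \<Longrightarrow> int (length L) \<le> top_val L"
proof (induction L)
  case (Cons l L)
  obtain \<phi> lam where l: "l = (\<phi>, lam)" by (cases l)
  note val = Cons.prems[unfolded l]
  note v = valid_levels_ConsD[OF val]
  have IH: "int (length L) \<le> top_val L" by (rule Cons.IH[OF v(1)])
  then have le: "top_val L \<le> val L \<phi>" "0 \<le> top_val L" using top_val_le_next[OF val] by auto
  have "1 * val L \<phi> \<le> slope_e lam * val L \<phi>"
    using le negative_slope(2)[OF v(4)] by (intro mult_right_mono) auto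
  then show ?case
    using IH le negative_slope(1)[OF v(4)] unfolding l top_val_eq[OF val] by simp
qed simp

text \<open>For a term \<open>a * \<phi> ^ j\<close> the part with \<open>pderiv a\<close> loses at
  most \<open>e\<close> times the previous top value, by induction, and that is at most \<Gamma>.
  The other part loses one factor \<phi>, of value \<Gamma>, and gains the integral factor
  \<open>pderiv \<phi>\<close>.\<close>

lemma above_val_pderiv:
  assumes "valid_levels L" "above (val L) \<alpha> P"
  shows "above (val L) (\<alpha> - top_val L) (pderiv P)"
  using assms
proof (induction L arbitrary: P \<alpha>)
  case Nil
  have val: "val [] = gauss_val" by (intro ext) simp
  have "integral_poly (scaled \<alpha> P)" using Nil(2) unfolding val integral_scaled .
  then have "integral_poly (pderiv (scaled \<alpha> P))" by (rule integral_poly_pderiv)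
  then have "integral_poly (scaled \<alpha> (pderiv P))" by (simp add: scaled_def pderiv_smult)
  then show ?case unfolding val integral_scaled by simp
next
  case (Cons l L)
  obtain \<phi> lam where l: "l = (\<phi>, lam)" by (cases l)
  define L1 where "L1 = (\<phi>, lam) # L"
  note val = Cons.prems(1)[unfolded l]
  note v = valid_levels_ConsD[OF val]
  have reg: "regular L1" using v(5) by (simp add: L1_def)
  have \<phi>0: "\<phi> \<noteq> 0" using v(7) by auto
  define \<Gamma> where "\<Gamma> = top_val L1"
  have \<Gamma>: "\<Gamma> = slope_e lam * val L \<phi> + slope_h lam" "\<Gamma> = val L1 \<phi>"
    using top_val_eq[OF val] by (simp_all add: \<Gamma>_def L1_def del: val.simps)
  have e: "0 < slope_e lam" "0 < slope_h lam" using negative_slope[OF v(4)] by auto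
  have le: "slope_e lam * top_val L \<le> \<Gamma>"
  proof -
    have "0 \<le> top_val L" using length_le_top_val[OF v(1)] by simp
    then have "slope_e lam * top_val L \<le> slope_e lam * val L \<phi>"
      using top_val_le_next[OF val] e by (intro mult_left_mono) auto
    then show ?thesis using e unfolding \<Gamma>(1) by linarith
  qed
  have mono: "above (val L1) (\<alpha> - \<Gamma>) (pderiv (a * \<phi> ^ j))"
    if a: "a \<noteq> 0" "degree a < degree \<phi>" and ab: "above (val L1) \<alpha> (a * \<phi> ^ j)" for a j
  proof -
    have va: "\<alpha> \<le> slope_e lam * (val L a + int j * val L \<phi>) + slope_h lam * int j"
      using ab a \<phi>0 val_monomial[OF val a] by (simp add: above_def L1_def del: val.simps)
    have "above (val L1) (\<alpha> - \<Gamma>) (pderiv a * \<phi> ^ j)"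
    proof (cases "pderiv a = 0")
      case False
      have "above (val L) (val L a - top_val L) (pderiv a)"
        by (rule Cons.IH[OF v(1)]) (simp add: above_def)
      then have "val L a - top_val L \<le> val L (pderiv a)" using False by (simp add: above_def)
      then have "slope_e lam * (val L a - top_val L) \<le> slope_e lam * val L (pderiv a)"
        using e by (intro mult_left_mono) auto
      moreover have "degree (pderiv a) < degree \<phi>" using a(2) by (simp add: degree_pderiv)
      ultimately show ?thesis
        using va le val_monomial[OF val False] by (simp add: above_def L1_def algebra_simps del: val.simps)
    qed (simp add: above_def)
    moreover have "above (val L1) (\<alpha> - \<Gamma>) (a * pderiv (\<phi> ^ j))"
    proof (cases j)
      case (Suc i)
      have "a * \<phi> ^ i \<noteq> 0" using a \<phi>0 by simp
      moreover have "val L1 (a * \<phi> ^ i * \<phi>) = val L1 (a * \<phi> ^ i) + \<Gamma>"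
        using a \<phi>0 unfolding \<Gamma>(2) by (intro val_mult reg) auto
      ultimately have 1: "above (val L1) (\<alpha> - \<Gamma>) (a * \<phi> ^ i)"
        using ab \<phi>0 a by (simp add: above_def Suc algebra_simps del: val.simps)
      have "integral_poly (pderiv \<phi>)" using v(6) by (simp add: integral_poly_pderiv monic_integral_def)
      moreover have "integral_poly (of_nat n)" for n
        by (induction n) (auto simp: integral_poly_add, auto simp: integral_poly_def integers_closed)
      ultimately have "integral_poly (of_nat (Suc i) * pderiv \<phi>)" by (intro integral_poly_mult)
      then have 2: "above (val L1) 0 (of_nat (Suc i) * pderiv \<phi>)"
        using Cons.prems(1) by (intro integral_above_val) (simp_all add: L1_def l)
      have "pderiv (\<phi> ^ j) = \<phi> ^ i * (of_nat (Suc i) * pderiv \<phi>)"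
        by (simp add: Suc pderiv_power_Suc of_nat_poly algebra_simps del: of_nat_Suc power_Suc)
      then show ?thesis using above_val_mult[OF reg 1 2] by (simp add: mult.assoc)
    qed (simp add: above_def)
    ultimately show ?thesis
      unfolding pderiv_mult using above_val_add[OF reg] by (simp add: ac_simps)
  qed
  have terms: "above (val L1) \<alpha> (adic_coeff \<phi> P j * \<phi> ^ j)" if j: "j \<in> adic_support \<phi> P" for j
  proof -
    have P: "P \<noteq> 0" using j by (auto simp: adic_support_def)
    have a: "adic_coeff \<phi> P j \<noteq> 0" "degree (adic_coeff \<phi> P j) < degree \<phi>"
      using j degree_adic_coeff[OF v(7), of P j] by (auto simp: adic_support_def)
    obtain s t where st: "polygon_side L \<phi> lam P s t" using polygon_side_exists[OF v(7) P] by metis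
    have "val L1 P \<le> height_along lam (term_val L \<phi> P) j"
      unfolding L1_def val_side[OF v(7) v(4) st] using st j by (simp add: side_of_points_def)
    also have "\<dots> = val L1 (adic_coeff \<phi> P j * \<phi> ^ j)"
      unfolding L1_def val_monomial[OF val a] height_along_def term_val_def
      using a(1) \<phi>0 by (simp add: val_mult[OF v(2)] val_power[OF v(2)] del: val.simps)
    finally show ?thesis using Cons.prems(2) P by (simp add: above_def L1_def l del: val.simps)
  qed
  have "above (val L1) (\<alpha> - \<Gamma>) (\<Sum>j\<in>adic_support \<phi> P. pderiv (adic_coeff \<phi> P j * \<phi> ^ j))"
  proof (rule above_val_sum[OF reg])
    fix j assume j: "j \<in> adic_support \<phi> P"
    show "above (val L1) (\<alpha> - \<Gamma>) (pderiv (adic_coeff \<phi> P j * \<phi> ^ j))"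
      using j degree_adic_coeff[OF v(7), of P j] by (intro mono terms) (auto simp: adic_support_def)
  qed
  moreover have "pderiv P = (\<Sum>j\<in>adic_support \<phi> P. pderiv (adic_coeff \<phi> P j * \<phi> ^ j))"
    using arg_cong[OF adic_expansion[OF v(7), of P], of pderiv]
    by (simp add: higher_pderiv_sum[of 1, simplified])
  ultimately show ?case unfolding l L1_def[symmetric] \<Gamma>_def by simp
qed

text \<open>Each level multiplies the degree by \<open>e f\<close> and the ramification only by
  \<open>e\<close>. The index of the top slope is not included; the caller supplies it.\<close>

lemma ramification_le_degree:
  assumes "valid_levels ((\<phi>, lam) # L)"
  shows "ramification L \<le> int (degree \<phi>)"
  using assms
proof (induction L arbitrary: \<phi> lam)
  case Nil
  then show ?case using valid_levels_ConsD(7) by fastforce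
next
  case (Cons l L)
  obtain \<phi>' lam' where l: "l = (\<phi>', lam')" by (cases l)
  note v = valid_levels_ConsD[OF Cons.prems[unfolded l]]
  note v' = valid_levels_ConsD[OF v(1)]
  have deg: "int (degree \<phi>) = int (degree \<phi>') * slope_e lam' * int (degree (psi ((\<phi>', lam') # L) \<phi>))"
    and irr: "monic_irreducible_over (tower ((\<phi>', lam') # L)) (psi ((\<phi>', lam') # L) \<phi>)"
    using Cons.prems unfolding l by simp_all
  have e: "0 < slope_e lam'" using negative_slope(2)[OF v'(4)] .
  have "slope_e lam' * ramification L \<le> slope_e lam' * int (degree \<phi>')"
    using Cons.IH[OF v(1)] e by (intro mult_left_mono) auto
  also have "\<dots> \<le> slope_e lam' * int (degree \<phi>') * int (degree (psi ((\<phi>', lam') # L) \<phi>))"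
  proof -
    have "1 \<le> int (degree (psi ((\<phi>', lam') # L) \<phi>))" using irr by (simp add: monic_irreducible_over_def)
    then have "slope_e lam' * int (degree \<phi>') * 1 \<le>
        slope_e lam' * int (degree \<phi>') * int (degree (psi ((\<phi>', lam') # L) \<phi>))"
      using e by (intro mult_left_mono) auto
    then show ?thesis by simp
  qed
  finally show ?case unfolding l deg by (simp add: ac_simps)
qed

lemma order_bound:
  assumes val: "valid_levels L" and L: "L \<noteq> []" and psi: "0 < degree \<psi>"
    and f: "monic_integral f" and om: "2 \<le> omega (L, \<psi>) f"
    and bezout: "A * f + B * pderiv f = 1"
    and N: "above gauss_val (- int N) A" "above gauss_val (- int N) B"
  shows "length L \<le> degree f * N"
proof -
  obtain \<phi> lam L' where L_eq: "L = (\<phi>, lam) # L'" using L by (cases L) auto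
  note v = valid_levels_ConsD[OF val[unfolded L_eq]]
  have reg: "regular L" using v(5) by (simp add: L_eq)
  have f0: "f \<noteq> 0" and fi: "integral_poly f" using f by (auto simp: monic_integral_def)
  obtain s t where st: "polygon_side L' \<phi> lam f s t" using polygon_side_exists[OF v(7) f0] by metis
  define e where "e = nat (slope_e lam)"
  have e: "1 \<le> e" "slope_e lam = int e" using negative_slope(2)[OF v(4)] by (auto simp: e_def)
  have "omega (L, \<psi>) f * e \<le> t"
    unfolding e_def L_eq by (rule omega_le_side_end[OF v(2,3,4) f0 st psi])
  moreover have "2 * e \<le> omega (L, \<psi>) f * e" using om by (rule mult_le_mono1)
  ultimately have t: "2 * e \<le> t" by linarith
  define \<Gamma> where "\<Gamma> = top_val L"
  have \<Gamma>: "int (length L) \<le> \<Gamma>" unfolding \<Gamma>_def by (rule length_le_top_val[OF val])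
  have "2 * \<Gamma> \<le> int t * \<Gamma>" using t e \<Gamma> by (intro mult_right_mono) auto
  also have "\<dots> \<le> val L f"
    unfolding \<Gamma>_def L_eq by (rule val_ge_side_end[OF val[unfolded L_eq] fi f0 st])
  finally have above_f: "above (val L) (2 * \<Gamma>) f" by (simp add: above_def)
  have "above (val L) (2 * \<Gamma> - \<Gamma>) (pderiv f)"
    unfolding \<Gamma>_def by (rule above_val_pderiv[OF val above_f[unfolded \<Gamma>_def]])
  then have above_f': "above (val L) \<Gamma> (pderiv f)" by simp
  define E where "E = ramification L"
  \<comment> \<open>Pull out \<open>\<pi> powi (- N)\<close>: the remaining factor is integral, and
    on constants \<open>val L\<close> is \<open>E\<close> times \<open>v\<close>.\<close>
  have bound: "above (val L) (- (E * int N)) Q" if Q: "above gauss_val (- int N) Q" for Q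
  proof -
    define c where "c = \<pi> powi (- int N)"
    have c: "c \<noteq> 0" "v c = - int N" unfolding c_def by (rule pi_powi_nonzero v_pi_powi)+
    have "val L [:c:] = - (E * int N)" using val_const[OF val c(1)] c(2) by (simp add: E_def)
    then have 1: "above (val L) (- (E * int N)) [:c:]" by (simp add: above_def)
    have "above (val L) 0 (scaled (- int N) Q)"
      using Q by (intro integral_above_val val) (simp add: integral_scaled)
    from above_val_mult[OF reg 1 this]
    have "above (val L) (- (E * int N)) ([:c:] * scaled (- int N) Q)" by simp
    moreover have "[:c:] * scaled (- int N) Q = Q"
      unfolding scaled_def c_def[symmetric] using c(1) by simp
    ultimately show ?thesis by simp
  qed
  have "above (val L) (- (E * int N) + 2 * \<Gamma>) (A * f)" "above (val L) (- (E * int N) + \<Gamma>) (B * pderiv f)"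
    by (rule above_val_mult[OF reg bound above_f] above_val_mult[OF reg bound above_f'] N)+
  then have "above (val L) (\<Gamma> - E * int N) (A * f + B * pderiv f)"
    using \<Gamma> by (intro above_val_add[OF reg]) (auto simp: above_def)
  \<comment> \<open>The value of \<open>1\<close> is \<open>0\<close>, and the weaker of the two
    bounds, that of the derivative term, is \<open>\<Gamma> - E N\<close>.\<close>
  then have "\<Gamma> \<le> E * int N" unfolding bezout by (simp add: above_def val_one[OF reg] del: val.simps)
  \<comment> \<open>The lower indices multiply to at most \<open>deg \<phi>\<close>, the top index
    is at most \<open>t\<close>, and \<open>t deg \<phi> \<le> deg f\<close> since the abscissa
    \<open>t\<close> occurs in the development of \<open>f\<close>.\<close>
  moreover have "E \<le> int (degree f)"
  proof -
    have "E = int e * ramification L'" by (simp add: E_def L_eq e)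
    also have "\<dots> \<le> int e * int (degree \<phi>)"
      using ramification_le_degree[OF val[unfolded L_eq]] by (intro mult_left_mono) auto
    also have "\<dots> = int (e * degree \<phi>)" by simp
    also have "\<dots> \<le> int (t * degree \<phi>)"
      unfolding of_nat_le_iff using t by (intro mult_le_mono1) simp
    also have "\<dots> \<le> int (degree f)"
      unfolding of_nat_le_iff using adic_support_degree[OF v(7), of t f] st
      by (simp add: side_of_points_def)
    finally show ?thesis .
  qed
  then have "E * int N \<le> int (degree f) * int N" by (intro mult_right_mono) auto
  ultimately have "int (length L) \<le> int (degree f * N)" using \<Gamma> by simp
  then show ?thesis by (simp only: of_nat_le_iff)
qed

lemma separable_order_bound:
  assumes f: "monic_integral f" and sep: "coprime f (pderiv f)"
  obtains M where "\<And>L \<psi>. valid_levels L \<Longrightarrow> 0 < degree \<psi> \<Longrightarrow> 2 \<le> omega (L, \<psi>) f \<Longrightarrow> length L \<le> M"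
proof -
  obtain A B where AB: "A * f + B * pderiv f = 1"
    by (rule coprime_poly_bezout[OF sep])
  \<comment> \<open>\<open>\<pi> ^ N\<close> clears the denominators of both cofactors. It depends
    only on \<open>A\<close> and \<open>B\<close>, not on the type, so the bound is uniform. If a
    cofactor is zero, its unspecified Gauss value does no harm.\<close>
  define N where "N = nat (max (- gauss_val A) (- gauss_val B))"
  have N: "above gauss_val (- int N) A" "above gauss_val (- int N) B" by (auto simp: above_def N_def)
  show ?thesis
  proof (rule that[of "degree f * N"])
    fix L :: "'k levels" and \<psi> :: "'l poly"
    assume "valid_levels L" "0 < degree \<psi>" "2 \<le> omega (L, \<psi>) f"
    then show "length L \<le> degree f * N"
      using order_bound[OF _ _ _ f _ AB N] by (cases "L = []") auto
  qed
qed

end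

section \<open>Sets of types of a polynomial\<close>

context universal_family
begin

text \<open>Order \<open>0\<close> is defined by divisibility of the reduction; here it is brought
  under the same description as the higher orders.\<close>

lemma omega_pos_of_types_of:
  assumes f: "monic_integral f" and t: "t \<in> types_of r f"
  shows "is_type t" "fixed_levels rep (fst t)" "type_order t = r" "0 < omega t f" "0 < degree (snd t)"
proof -
  obtain L \<psi> where t_eq: "t = (L, \<psi>)" by (cases t)
  note m = monic_integral_facts[OF f]
  have "is_type t \<and> fixed_levels rep (fst t) \<and> type_order t = r \<and> 0 < omega t f"
  proof (cases "r = 0")
    case True
    then have L: "L = []" and irr: "monic_irreducible_over \<F> \<psi>" and dvd: "\<psi> dvd red_poly f"
      using t by (auto simp: types_of_def t_eq)
    have "0 < degree \<psi>" using irr by (simp add: monic_irreducible_over_def)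
    moreover have "red_poly f \<noteq> 0" using m(5) by auto
    ultimately have "0 < poly_ord \<psi> (red_poly f)"
      using poly_ord_dvd_iff[of \<psi> "red_poly f" 1] dvd by simp
    then show ?thesis
      using irr m(3) True by (simp add: t_eq L is_type_def type_order_def omega_def del: res_poly.simps)
  qed (use t in \<open>auto simp: types_of_def\<close>)
  then show "is_type t" "fixed_levels rep (fst t)" "type_order t = r" "0 < omega t f" by auto
  then show "0 < degree (snd t)" by (auto simp: is_type_def t_eq monic_irreducible_over_def)
qed

lemma complete_iff_no_extension:
  assumes f: "monic_integral f" and sep: "coprime f (pderiv f)"
  shows "(\<forall>t\<in>types_of r f. complete_for f t) \<longleftrightarrow> types_of (r + 1) f = {}"
proof
  assume empty: "types_of (r + 1) f = {}"
  show "\<forall>t\<in>types_of r f. complete_for f t"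
  proof (rule ccontr)
    assume "\<not> (\<forall>t\<in>types_of r f. complete_for f t)"
    then obtain t where t: "t \<in> types_of r f" "omega t f \<noteq> 1" by (auto simp: complete_for_def)
    obtain L \<psi> where t_eq: "t = (L, \<psi>)" by (cases t)
    note ty = omega_pos_of_types_of[OF f t(1)]
    have om: "2 \<le> omega (L, \<psi>) f" using ty(4) t(2) by (simp add: t_eq)
    define g where "g = rep t"
    have g: "representative (L, \<psi>) g" unfolding g_def using rep[OF ty(1,2)] by (simp add: t_eq)
    have type: "is_type (L, \<psi>)" using ty(1) by (simp add: t_eq)
    have "(-1::rat) < 0" by simp
    note val = representative_levels[OF type g this]
    have degg: "0 < degree g" by (rule valid_levels_ConsD(7)[OF val(2)])
    \<comment> \<open>A square factor would divide both \<open>f\<close> and its derivative; this is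
      where separability excludes a polygon reduced to slope minus infinity.\<close>
    have "\<not> g ^ 2 dvd f"
    proof
      assume "g ^ 2 dvd f"
      then obtain q where "f = g ^ 2 * q" by (rule dvdE)
      then have q: "f = g * (g * q)" by (simp add: power2_eq_square mult.assoc)
      then have "g dvd f" by simp
      moreover have "g dvd pderiv f" unfolding q pderiv_mult by (intro dvd_add dvd_mult dvd_mult2) auto
      ultimately have "is_unit g" by (rule coprime_common_divisor[OF sep])
      then show False using degg dvd_imp_degree_le[of g 1] by simp
    qed
    then obtain lam \<psi>' where new: "is_type ((g, lam) # L, \<psi>')" "0 < omega ((g, lam) # L, \<psi>') f"
      using extension_exists[OF type g _ om] monic_integral_facts(1)[OF f] by blast
    define t' where "t' = ((g, lam) # L, \<psi>')"
    have trunc: "truncation t' = t" by (simp add: truncation_def t'_def val(1) t_eq)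
    have "fixed_levels rep (fst t')"
      using ty(2) val(1) by (simp add: t'_def t_eq g_def)
    then have "t' \<in> types_of (r + 1) f"
      using new om ty(3) trunc unfolding types_of_def
      by (auto simp: type_order_def t_eq t'_def)
    then show False using empty by simp
  qed
next
  assume complete: "\<forall>t\<in>types_of r f. complete_for f t"
  show "types_of (r + 1) f = {}"
  proof (rule ccontr)
    assume "types_of (r + 1) f \<noteq> {}"
    then obtain t where t: "t \<in> types_of (r + 1) f" by blast
    then have ty: "is_type t" "fixed_levels rep (fst t)" "type_order t = r + 1" "1 < omega (truncation t) f"
      by (auto simp: types_of_def)
    obtain \<phi> lam L \<psi> where t_eq: "t = ((\<phi>, lam) # L, \<psi>)"
      using ty(3) by (cases t; cases "fst t") (auto simp: type_order_def)
    have val: "valid_levels ((\<phi>, lam) # L)" using ty(1) by (simp add: is_type_def t_eq del: valid_levels.simps)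
    note v = valid_levels_ConsD[OF val]
    have trunc: "truncation t = (L, psi L \<phi>)" by (simp add: truncation_def t_eq)
    have om: "1 < omega (L, psi L \<phi>) f" using ty(4) trunc by simp
    have f0: "f \<noteq> 0" using monic_integral_facts(1)[OF f] .
    have irr: "monic_irreducible_over (tower L) (psi L \<phi>)" using v(3) by (simp add: is_key_def)
    have degpsi: "0 < degree (psi L \<phi>)" using irr by (simp add: monic_irreducible_over_def)
    have "(L, psi L \<phi>) \<in> types_of r f"
    proof (cases L)
      case Nil
      have "res_poly [] f = red_poly f" "red_poly f \<noteq> 0" using monic_integral_facts[OF f] by auto
      then have "psi L \<phi> dvd red_poly f"
        using poly_ord_dvd_iff[OF degpsi, of "red_poly f" 1] om by (simp add: omega_def Nil del: res_poly.simps)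
      then show ?thesis using irr ty(3) by (simp add: types_of_def Nil t_eq type_order_def)
    next
      case (Cons l L')
      obtain \<phi>' lam' where l: "l = (\<phi>', lam')" by (cases l)
      note val' = v(1)[unfolded Cons l] and v' = valid_levels_ConsD[OF v(1)[unfolded Cons l]]
      have "psi L \<phi> \<noteq> monom 1 1"
      proof
        assume "psi L \<phi> = monom 1 1"
        moreover have "coeff (res_poly L \<phi>) 0 \<noteq> 0"
          unfolding Cons l using v(7) by (intro coeff_res_poly_0[OF val']) auto
        then have "coeff (psi L \<phi>) 0 \<noteq> 0" by (auto simp: psi_def normalize_monic_def)
        ultimately show False by simp
      qed
      then have "is_type (L, psi L \<phi>)" using v(1) irr by (simp add: is_type_def)
      \<comment> \<open>Membership in \<open>types_of r f\<close> also requires a multiplicity above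
        \<open>1\<close> one order lower; it is inherited by monotonicity.\<close>
      moreover have "omega (L, psi L \<phi>) f \<le> omega (L', psi L' \<phi>') f"
        unfolding Cons l by (rule omega_mono[OF v'(2,3,4) f0 degpsi[unfolded Cons l]])
      ultimately show ?thesis
        using om ty(2,3) by (simp add: types_of_def t_eq type_order_def truncation_def Cons l)
    qed
    then show False using complete om by (auto simp: complete_for_def)
  qed
qed

lemma complete_for_large_order:
  assumes f: "monic_integral f" and sep: "coprime f (pderiv f)"
  shows "\<exists>r. \<forall>t\<in>types_of r f. complete_for f t"
proof -
  obtain M where M: "\<And>L \<psi>. valid_levels L \<Longrightarrow> 0 < degree \<psi> \<Longrightarrow> 2 \<le> omega (L, \<psi>) f \<Longrightarrow> length L \<le> M"
    by (rule separable_order_bound[OF f sep]) blast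
  \<comment> \<open>Orders up to \<open>M\<close> may still carry multiplicities of \<open>2\<close>
    or more; at order \<open>Suc M\<close> a positive multiplicity must be \<open>1\<close>.\<close>
  have "complete_for f t" if t: "t \<in> types_of (Suc M) f" for t
  proof -
    note ty = omega_pos_of_types_of[OF f t]
    obtain L \<psi> where t_eq: "t = (L, \<psi>)" by (cases t)
    have "\<not> 2 \<le> omega (L, \<psi>) f"
      using M[of L \<psi>] ty by (auto simp: t_eq is_type_def type_order_def)
    then show ?thesis using ty(4) by (simp add: complete_for_def t_eq)
  qed
  then show ?thesis by blast
qed

end

theorem corollary4p19:
  fixes p :: nat
    and Qp :: "'k::field_char_0 set"
    and v :: "'k \<Rightarrow> int"
    and \<pi> :: 'k
    and red :: "'k \<Rightarrow> 'l::alg_closed_field"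
    and ell :: "'k levels \<Rightarrow> int"
    and rep :: "('k, 'l) mtype \<Rightarrow> 'k poly"
    and f :: "'k poly"
  assumes "universal_family p Qp v \<pi> red ell rep"
    and "padic_field.monic_integral v f"
    and "coprime f (pderiv f)"
  shows "(\<exists>r. \<forall>t \<in> universal_family.types_of v \<pi> red ell rep r f.
            montes_setting.complete_for v \<pi> red ell f t) \<and>
         (\<forall>r. (\<forall>t \<in> universal_family.types_of v \<pi> red ell rep r f.
                  montes_setting.complete_for v \<pi> red ell f t) \<longleftrightarrow>
              universal_family.types_of v \<pi> red ell rep (r + 1) f = {})"
proof -
  interpret universal_family p Qp v \<pi> red ell rep by (rule assms(1))
  show ?thesis
    using complete_for_large_order[OF assms(2,3)] complete_iff_no_extension[OF assms(2,3)] by blast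
qed

end
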